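(* Let $n\ge1$, $\alpha>0$, $1<p<\infty$. For $f\in\mathrm{VO}(\mathbb{C}^n)$ the Toeplitz operator $T_f$ on $F_\alpha^p$ satisfies $\sigma_{ess}(T_f)=f(\partial\mathbb{C}^n)$.
   Context: For $\nu>0$ let $d\mu_\nu(z)=(\nu/\pi)^n e^{-\nu|z|^2}dz$ on $\mathbb{C}^n$ ($dz$ Lebesgue measure). $L_\alpha^p=L^p(\mathbb{C}^n,\mu_{p\alpha/2})$, and $F_\alpha^p$ is its closed subspace of entire functions. $P_\alpha:L_\alpha^p\to L_\alpha^p$, $(P_\alpha g)(z)=\int_{\mathbb{C}^n}e^{\alpha\langle z,w\rangle}g(w)\,d\mu_\alpha(w)$ (with $\langle\cdot,\cdot\rangle$ the standard Hermitian inner product, linear in the first argument), is a bounded projection onto $F_\alpha^p$. For $f\in L^\infty(\mathbb{C}^n)$ the Toeplitz operator is $T_f:F_\alpha^p\to F_\alpha^p$, $T_fg=P_\alpha(fg)$. For bounded continuous $f:\mathbb{C}^n\to\mathbb{C}$ let $\mathrm{Osc}_z^r(f)=\sup\{|f(z)-f(w)|:w\in\mathbb{C}^n,|z-w|\le r\}$. $\mathrm{VO}(\mathbb{C}^n)$ is the set of bounded continuous $f:\mathbb{C}^n\to\mathbb{C}$ with $\lim_{|z|\to\infty}\mathrm{Osc}_z^1(f)=0$. $f(\partial\mathbb{C}^n)$ denotes the set of limit points of $f(z)$ as $|z|\to\infty$, i.e. all $\lambda\in\mathbb{C}$ for which there is a sequence $(z_m)$ with $|z_m|\to\infty$ and $f(z_m)\to\lambda$.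 $\sigma_{ess}(A)=\{\lambda\in\mathbb{C}: A-\lambda\text{ is not Fredholm}\}$. *)

theory Defs
  imports "HOL-Analysis.Analysis" "HOL-Library.Function_Algebras"
begin

(* The space C^n is the type complex ^ 'n with n = CARD('n); its norm is the
   Euclidean one and lborel is Lebesgue measure on R^(2n). *)

definition hermitian :: "complex ^ 'n \<Rightarrow> complex ^ 'n \<Rightarrow> complex" where
  "hermitian z w = (\<Sum>i\<in>UNIV. z $ i * cnj (w $ i))"

definition gaussian :: "real \<Rightarrow> (complex ^ 'n) measure" where
  "gaussian \<nu> =
     density lborel (\<lambda>z. ennreal ((\<nu> / pi) ^ CARD('n) * exp (- \<nu> * (norm z)\<^sup>2)))"

definition Lp_space :: "real \<Rightarrow> real \<Rightarrow> (complex ^ 'n \<Rightarrow> complex) set" where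
  "Lp_space \<alpha> p =
     {g \<in> borel_measurable borel. integrable (gaussian (p * \<alpha> / 2)) (\<lambda>z. norm (g z) powr p)}"

definition Lp_norm :: "real \<Rightarrow> real \<Rightarrow> (complex ^ 'n \<Rightarrow> complex) \<Rightarrow> real" where
  "Lp_norm \<alpha> p g = (\<integral>z. norm (g z) powr p \<partial>gaussian (p * \<alpha> / 2)) powr (1 / p)"

(* Holomorphic on all of C^n: the real Frechet derivative exists everywhere and
   is complex linear. *)
definition entire :: "(complex ^ 'n \<Rightarrow> complex) \<Rightarrow> bool" where
  "entire g \<longleftrightarrow>
     (\<forall>z. \<exists>D. (g has_derivative D) (at z) \<and> (\<forall>c v. D (c *s v) = c * D v))"

(* Since entire functions are continuous, two of them that agree almost
   everywhere are equal; hence the Fock space can be taken as a set of genuine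
   functions instead of classes modulo null sets, and Lp_norm is a norm on it. *)
definition fock :: "real \<Rightarrow> real \<Rightarrow> (complex ^ 'n \<Rightarrow> complex) set" where
  "fock \<alpha> p = {g \<in> Lp_space \<alpha> p. entire g}"

definition fock_proj ::
    "real \<Rightarrow> (complex ^ 'n \<Rightarrow> complex) \<Rightarrow> complex ^ 'n \<Rightarrow> complex" where
  "fock_proj \<alpha> g z = (\<integral>w. exp (of_real \<alpha> * hermitian z w) * g w \<partial>gaussian \<alpha>)"

definition toeplitz ::
    "real \<Rightarrow> (complex ^ 'n \<Rightarrow> complex) \<Rightarrow> (complex ^ 'n \<Rightarrow> complex) \<Rightarrow> complex ^ 'n \<Rightarrow> complex"
  where "toeplitz \<alpha> f g = fock_proj \<alpha> (\<lambda>z. f z * g z)"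

definition Osc :: "real \<Rightarrow> (complex ^ 'n \<Rightarrow> complex) \<Rightarrow> complex ^ 'n \<Rightarrow> real" where
  "Osc r f z = (SUP w\<in>{w. norm (z - w) \<le> r}. norm (f z - f w))"

definition VO :: "(complex ^ 'n \<Rightarrow> complex) set" where
  "VO = {f. bounded (range f) \<and> continuous_on UNIV f \<and> (Osc 1 f \<longlongrightarrow> 0) at_infinity}"

definition limit_values :: "(complex ^ 'n \<Rightarrow> complex) \<Rightarrow> complex set" where
  "limit_values f =
     {c. \<exists>z :: nat \<Rightarrow> complex ^ 'n.
         filterlim (\<lambda>m. norm (z m)) at_top sequentially \<and> (\<lambda>m. f (z m)) \<longlonglongrightarrow> c}"

definition fscale :: "complex \<Rightarrow> ('a \<Rightarrow> complex) \<Rightarrow> 'a \<Rightarrow> complex" where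
  "fscale c g = (\<lambda>z. c * g z)"

interpretation cfun: vector_space "fscale :: complex \<Rightarrow> ('a \<Rightarrow> complex) \<Rightarrow> 'a \<Rightarrow> complex"
  by unfold_locales (auto simp: fscale_def fun_eq_iff algebra_simps)

(* In the following X is the carrier of a complex vector space of functions with
   pointwise operations, and N is its norm. *)

definition bounded_operator_on ::
    "('a \<Rightarrow> complex) set \<Rightarrow> (('a \<Rightarrow> complex) \<Rightarrow> real) \<Rightarrow>
     (('a \<Rightarrow> complex) \<Rightarrow> 'a \<Rightarrow> complex) \<Rightarrow> bool" where
  "bounded_operator_on X N A \<longleftrightarrow>
     A ` X \<subseteq> X \<and>
     (\<forall>g\<in>X. \<forall>h\<in>X. A (g + h) = A g + A h) \<and>
     (\<forall>c. \<forall>g\<in>X. A (fscale c g) = fscale c (A g)) \<and>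
     (\<exists>C. \<forall>g\<in>X. N (A g) \<le> C * N g)"

(* Bounded with finite-dimensional kernel and cokernel X / A X.  The last clause
   says that the classes of finitely many elements of X span X / A X.  Closedness
   of the range is automatic when X is complete. *)
definition fredholm_on ::
    "('a \<Rightarrow> complex) set \<Rightarrow> (('a \<Rightarrow> complex) \<Rightarrow> real) \<Rightarrow>
     (('a \<Rightarrow> complex) \<Rightarrow> 'a \<Rightarrow> complex) \<Rightarrow> bool" where
  "fredholm_on X N A \<longleftrightarrow>
     bounded_operator_on X N A \<and>
     (\<exists>B. finite B \<and> {g \<in> X. A g = 0} \<subseteq> cfun.span B) \<and>
     (\<exists>B. finite B \<and> B \<subseteq> X \<and> X \<subseteq> cfun.span (A ` X \<union> B))"

definition essential_spectrum_on ::
    "('a \<Rightarrow> complex) set \<Rightarrow> (('a \<Rightarrow> complex) \<Rightarrow> real) \<Rightarrow>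
     (('a \<Rightarrow> complex) \<Rightarrow> 'a \<Rightarrow> complex) \<Rightarrow> complex set" where
  "essential_spectrum_on X N A = {c. \<not> fredholm_on X N (\<lambda>g. A g - fscale c g)}"

end

theory Submission
  imports Defs "HOL-Probability.Distributions" "HOL-Complex_Analysis.Cauchy_Integral_Formula"
begin

text \<open>
  Weighted by \<open>exp (- \<alpha> |z|\<^sup>2 / 2)\<close>, the kernel of \<open>fock_proj\<close> is dominated by the convolution kernel
  \<open>exp (- \<alpha> |z - w|\<^sup>2 / 2)\<close>. Hence for a symbol \<open>h\<close> of vanishing oscillation the commutator
  \<open>fock_proj (h u) - h u\<close> is small in norm outside large balls, whereas what happens inside a ball is of
  finite rank up to a small error, by the Taylor expansion of \<open>exp (\<alpha> \<langle>z, w\<rangle>)\<close>.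

  If \<open>c\<close> is not a limit value, take \<open>h = f - c\<close> and \<open>g = 1 / h\<close> outside a ball. Both \<open>T\<^sub>g T\<^sub>h\<close> and
  \<open>T\<^sub>h T\<^sub>g\<close> are then the identity plus a small operator plus a finite-rank one, and a Neumann series
  bounds the kernel of \<open>T\<^sub>h\<close> through the first product and its cokernel through the second.

  If \<open>c\<close> is a limit value, the same kernel bound gives
  \<open>|T\<^sub>h u (z\<^sub>m)| exp (- \<alpha> |z\<^sub>m|\<^sup>2 / 2) \<le> \<epsilon>\<^sub>m \<parallel>u\<parallel>\<close> with \<open>\<epsilon>\<^sub>m \<longlonglongrightarrow> 0\<close> along a sequence
  \<open>z\<^sub>m\<close>. Sums of reproducing kernels over infinitely many sparse points \<open>z\<^sub>m\<close>, with coefficients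
  decaying more slowly than \<open>\<epsilon>\<^sub>m\<close>, are independent modulo the range of \<open>T\<^sub>h\<close>, whose codimension is
  therefore infinite.
\<close>

section \<open>Gaussian integrals and orthogonal invariance of Lebesgue measure\<close>

text \<open>Kernel and cokernel in \<open>fredholm_on\<close> are purely algebraic, and this shapes
  both halves. Normalised kernels on which \<open>T\<^sub>h\<close> tends to zero would refute
  Fredholmness only after an argument on closed ranges and open mappings. Smallness of every element
  of the range at the points \<open>z\<^sub>m\<close> refutes finite codimension directly. In the
  other half neither compact operators nor quotient algebras occur: the error of the parametrix is
  split explicitly into a finite-rank operator and a small one. In a product the inner symbol must
  oscillate slowly, so the two products need this of \<open>h\<close> and of \<open>g\<close>
  respectively. Estimates concern \<open>p\<close>-th powers with values in \<open>ennreal\<close>,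
  which are meaningful before finiteness is known. The price is a factor \<open>2 powr p\<close> in
  each triangle inequality; in infinite sums it is the ratio \<open>4 powr - p\<close> that pays for
  it, since \<open>4 powr - p\<close> remains summable after multiplication by
  \<open>2 powr p\<close> per term.\<close>

lemma nn_integral_gaussian:
  assumes "\<beta> > 0"
  shows "(\<integral>\<^sup>+(x::'a::euclidean_space). ennreal (exp (- \<beta> * (norm x)\<^sup>2)) \<partial>lborel)
    = ennreal (sqrt (pi / \<beta>) ^ DIM('a))"
proof -
  have one: "(\<integral>\<^sup>+(x::real). ennreal (exp (- \<beta> * x\<^sup>2)) \<partial>lborel) = ennreal (sqrt (pi / \<beta>))"
  proof -
    define \<sigma> where "\<sigma> = sqrt (1 / (2 * \<beta>))"
    have \<sigma>: "\<sigma> > 0" "\<sigma>\<^sup>2 = 1 / (2 * \<beta>)" using assms by (auto simp: \<sigma>_def)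
    have "(\<integral>\<^sup>+x. ennreal (exp (- \<beta> * x\<^sup>2)) \<partial>lborel)
      = (\<integral>\<^sup>+x. ennreal (sqrt (pi / \<beta>)) * ennreal (normal_density 0 \<sigma> x) \<partial>lborel)"
      using assms by (intro nn_integral_cong)
        (simp add: normal_density_def \<sigma> ennreal_mult[symmetric] field_simps)
    also have "\<dots> = ennreal (sqrt (pi / \<beta>)) * (\<integral>\<^sup>+x. ennreal (normal_density 0 \<sigma> x) \<partial>lborel)"
      by (rule nn_integral_cmult) simp
    also have "(\<integral>\<^sup>+x. ennreal (normal_density 0 \<sigma> x) \<partial>lborel) = 1"
      using \<sigma> by (subst nn_integral_eq_integral) auto
    finally show ?thesis by simp
  qed
  have "(\<integral>\<^sup>+(x::'a). ennreal (exp (- \<beta> * (norm x)\<^sup>2)) \<partial>lborel)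
      = (\<integral>\<^sup>+(x::'a). (\<Prod>b\<in>Basis. ennreal (exp (- \<beta> * (x \<bullet> b)\<^sup>2))) \<partial>lborel)"
  proof (rule nn_integral_cong)
    fix x :: 'a
    have "(norm x)\<^sup>2 = (\<Sum>b\<in>Basis. (x \<bullet> b)\<^sup>2)"
      unfolding power2_norm_eq_inner by (subst euclidean_inner) (simp add: power2_eq_square)
    then show "ennreal (exp (- \<beta> * (norm x)\<^sup>2)) = (\<Prod>b\<in>Basis. ennreal (exp (- \<beta> * (x \<bullet> b)\<^sup>2)))"
      by (simp add: prod_ennreal exp_sum[symmetric] sum_distrib_left sum_negf)
  qed
  also have "\<dots> = (\<Prod>b\<in>(Basis::'a set). ennreal (sqrt (pi / \<beta>)))"
    using one by (subst nn_integral_lborel_prod) auto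
  finally show ?thesis using assms by (simp add: ennreal_power)
qed

lemma nn_integral_lborel_reflect:
  fixes f :: "'a::euclidean_space \<Rightarrow> ennreal"
  assumes [measurable]: "f \<in> borel_measurable borel"
  shows "(\<integral>\<^sup>+x. f (z - x) \<partial>lborel) = (\<integral>\<^sup>+x. f x \<partial>lborel)"
proof -
  have "(\<integral>\<^sup>+x. f x \<partial>lborel) = (\<integral>\<^sup>+x. f (z - x) \<partial>lborel)"
    by (subst lborel_affine[of "-1" z]) (auto simp: nn_integral_density nn_integral_distr)
  then show ?thesis by simp
qed

lemma nn_integral_lborel_translate:
  fixes f :: "'a::euclidean_space \<Rightarrow> ennreal"
  assumes [measurable]: "f \<in> borel_measurable borel"
  shows "(\<integral>\<^sup>+x. f (z + x) \<partial>lborel) = (\<integral>\<^sup>+x. f x \<partial>lborel)"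
proof -
  have "(\<integral>\<^sup>+x. f x \<partial>lborel) = (\<integral>\<^sup>+x. f (z + x) \<partial>lborel)"
    by (subst lborel_affine[of "1" z]) (auto simp: nn_integral_density nn_integral_distr)
  then show ?thesis by simp
qed

text \<open>Uniqueness of Haar measure by Fubini: both measures are translation invariant, and the
  Gaussian, which does not see \<open>T\<close>, has the same finite mass for both.\<close>

lemma lborel_distr_orthogonal:
  fixes T :: "'a::euclidean_space \<Rightarrow> 'a"
  assumes T: "orthogonal_transformation T"
  shows "distr lborel borel T = lborel"
proof (rule measure_eqI)
  show "sets (distr lborel borel T) = sets lborel" by simp
  fix A assume "A \<in> sets (distr lborel borel T)"
  then have A[measurable]: "A \<in> sets borel" by simp
  have lin: "linear T" using T by (rule orthogonal_transformation_linear)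
  have Tm[measurable]: "T \<in> borel_measurable borel"
    using lin by (intro borel_measurable_continuous_onI linear_continuous_on linear_conv_bounded_linear[THEN iffD1])
  let ?g = "\<lambda>x::'a. ennreal (exp (- (norm x)\<^sup>2))"
  let ?I = "indicator A :: 'a \<Rightarrow> ennreal"
  have G: "(\<integral>\<^sup>+x. ?g x \<partial>lborel) = ennreal (sqrt pi ^ DIM('a))"
    using nn_integral_gaussian[of 1, where 'a='a] by simp
  have surj: "\<exists>x. T x = y" for y
    using orthogonal_transformation_surj[OF T] by (metis surjD)
  have "(\<integral>\<^sup>+x. ?g x \<partial>lborel) * (\<integral>\<^sup>+x. ?I (T x) \<partial>lborel)
    = (\<integral>\<^sup>+y. (\<integral>\<^sup>+x. ?g y * ?I (T x) \<partial>lborel) \<partial>lborel)"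
    by (simp add: nn_integral_cmult nn_integral_multc)
  \<comment> \<open>For fixed \<open>y\<close> the variable \<open>x\<close> is translated by a
    preimage of \<open>y\<close> under \<open>T\<close>: this is translation invariance of the image
    measure.\<close>
  also have "\<dots> = (\<integral>\<^sup>+y. (\<integral>\<^sup>+x. ?g y * ?I (y + T x) \<partial>lborel) \<partial>lborel)"
  proof (rule nn_integral_cong)
    fix y
    obtain y' where y': "T y' = y" using surj by blast
    have "(\<integral>\<^sup>+x. ?g y * ?I (T x) \<partial>lborel) = (\<integral>\<^sup>+x. ?g y * ?I (T (y' + x)) \<partial>lborel)"
      by (rule nn_integral_lborel_translate[symmetric]) measurable
    then show "(\<integral>\<^sup>+x. ?g y * ?I (T x) \<partial>lborel) = (\<integral>\<^sup>+x. ?g y * ?I (y + T x) \<partial>lborel)"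
      by (simp add: linear_add[OF lin] y')
  qed
  also have "\<dots> = (\<integral>\<^sup>+x. (\<integral>\<^sup>+y. ?g y * ?I (y + T x) \<partial>lborel) \<partial>lborel)"
    by (rule lborel_pair.Fubini') measurable
  also have "\<dots> = (\<integral>\<^sup>+x. (\<integral>\<^sup>+y. ?g (y - T x) * ?I y \<partial>lborel) \<partial>lborel)"
  proof (rule nn_integral_cong)
    fix x
    show "(\<integral>\<^sup>+y. ?g y * ?I (y + T x) \<partial>lborel) = (\<integral>\<^sup>+y. ?g (y - T x) * ?I y \<partial>lborel)"
      using nn_integral_lborel_translate[of "\<lambda>y. ?g (y - T x) * ?I y" "T x"]
      by (simp add: add.commute)
  qed
  also have "\<dots> = (\<integral>\<^sup>+y. (\<integral>\<^sup>+x. ?g (y - T x) * ?I y \<partial>lborel) \<partial>lborel)"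
    by (rule lborel_pair.Fubini') measurable
  \<comment> \<open>With \<open>T y' = y\<close>, the norms of \<open>y - T x\<close> and
    \<open>y' - x\<close> agree, so the inner integral is the full Gaussian mass.\<close>
  also have "\<dots> = (\<integral>\<^sup>+y. (\<integral>\<^sup>+x. ?g x \<partial>lborel) * ?I y \<partial>lborel)"
  proof (rule nn_integral_cong)
    fix y
    obtain y' where y': "T y' = y" using surj by blast
    have "norm (y - T x) = norm (y' - x)" for x
      using orthogonal_transformation_norm[OF T, of "y' - x"] by (simp add: linear_diff[OF lin] y')
    then show "(\<integral>\<^sup>+x. ?g (y - T x) * ?I y \<partial>lborel) = (\<integral>\<^sup>+x. ?g x \<partial>lborel) * ?I y"
      using nn_integral_lborel_reflect[of ?g y'] by (simp add: nn_integral_multc)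
  qed
  also have "\<dots> = (\<integral>\<^sup>+x. ?g x \<partial>lborel) * (\<integral>\<^sup>+y. ?I y \<partial>lborel)"
    by (simp add: nn_integral_cmult)
  \<comment> \<open>Only the Gaussian mass is cancelled, which is positive and finite; the measure
    of \<open>A\<close> may be infinite.\<close>
  finally have "(\<integral>\<^sup>+x. ?I (T x) \<partial>lborel) = (\<integral>\<^sup>+y. ?I y \<partial>lborel)"
    unfolding G by (simp add: ennreal_mult_cancel_left)
  moreover have "(\<integral>\<^sup>+x. ?I (T x) \<partial>lborel) = emeasure (distr lborel borel T) A"
    using nn_integral_distr[of T lborel borel ?I] by simp
  ultimately show "emeasure (distr lborel borel T) A = emeasure lborel A"
    by simp
qed

section \<open>Convolution with a Gaussian\<close>

text \<open>By \<open>nn_integral_gaussian\<close> this is the Lebesgue integral of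
  \<open>exp (- \<beta> |x|\<^sup>2)\<close>; the type argument conveys the dimension.\<close>

definition gauss_mass :: "'a::euclidean_space itself \<Rightarrow> real \<Rightarrow> real" where
  "gauss_mass _ \<beta> = sqrt (pi / \<beta>) ^ DIM('a)"

lemma gauss_mass_nonneg: "\<beta> > 0 \<Longrightarrow> 0 \<le> gauss_mass TYPE('a::euclidean_space) \<beta>"
  by (simp add: gauss_mass_def)

lemma nn_integral_gaussian_shift:
  fixes z :: "'a::euclidean_space"
  assumes "\<beta> > 0"
  shows "(\<integral>\<^sup>+w. ennreal (exp (- \<beta> * (norm (z - w))\<^sup>2)) \<partial>lborel) = ennreal (gauss_mass TYPE('a) \<beta>)"
  using nn_integral_lborel_reflect[of "\<lambda>x. ennreal (exp (- \<beta> * (norm x)\<^sup>2))" z] nn_integral_gaussian[OF assms, where 'a='a]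
  by (simp add: gauss_mass_def)

text \<open>A substitute for the Hoelder inequality up to constants, by optimising over \<open>s\<close>.\<close>

lemma powr_young:
  fixes x s p :: real
  assumes "x \<ge> 0" "s > 0" "p \<ge> 1"
  shows "x \<le> s + s powr (1 - p) * x powr p"
proof (cases "x \<le> s")
  case False
  then have "x = x powr (1 - p) * x powr p" using assms
    by (simp add: powr_add[symmetric])
  also have "\<dots> \<le> s powr (1 - p) * x powr p"
    using False assms by (intro mult_right_mono powr_mono2') auto
  finally show ?thesis using assms by simp
qed (use assms in \<open>auto intro: add_increasing2\<close>)

text \<open>\<open>powr_young\<close> is integrated against the Gaussian, whose mass is known.
  Leaving \<open>s\<close> free postpones its choice until the value of the last integral can enter
  it.\<close>

lemma gauss_young:
  fixes U :: "'a::euclidean_space \<Rightarrow> real"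
  assumes [measurable]: "U \<in> borel_measurable borel" and U: "\<And>w. U w \<ge> 0"
    and "\<beta> > 0" "p \<ge> 1" "s > 0"
  shows "(\<integral>\<^sup>+w. ennreal (exp (- \<beta> * (norm (z - w))\<^sup>2) * U w) \<partial>lborel)
    \<le> ennreal (gauss_mass TYPE('a) \<beta> * s) + ennreal (s powr (1 - p)) *
      (\<integral>\<^sup>+w. ennreal (exp (- \<beta> * (norm (z - w))\<^sup>2) * U w powr p) \<partial>lborel)"
proof -
  let ?k = "\<lambda>w. exp (- \<beta> * (norm (z - w))\<^sup>2)"
  have "(\<integral>\<^sup>+w. ennreal (?k w * U w) \<partial>lborel)
    \<le> (\<integral>\<^sup>+w. ennreal (?k w) * ennreal s + ennreal (s powr (1 - p)) * ennreal (?k w * U w powr p) \<partial>lborel)"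
  proof (rule nn_integral_mono)
    fix w
    have "?k w * U w \<le> ?k w * (s + s powr (1 - p) * U w powr p)"
      using powr_young[OF U \<open>s > 0\<close> \<open>p \<ge> 1\<close>] by (intro mult_left_mono) auto
    also have "\<dots> = ?k w * s + s powr (1 - p) * (?k w * U w powr p)"
      by (simp add: algebra_simps)
    finally have "ennreal (?k w * U w) \<le> ennreal (?k w * s + s powr (1 - p) * (?k w * U w powr p))"
      by (rule ennreal_leI)
    also have "\<dots> = ennreal (?k w) * ennreal s + ennreal (s powr (1 - p)) * ennreal (?k w * U w powr p)"
      using \<open>s > 0\<close> by (simp add: ennreal_plus ennreal_mult)
    finally show "ennreal (?k w * U w) \<le> ennreal (?k w) * ennreal s + ennreal (s powr (1 - p)) * ennreal (?k w * U w powr p)" .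
  qed
  also have "\<dots> = (\<integral>\<^sup>+w. ennreal (?k w) \<partial>lborel) * ennreal s
      + ennreal (s powr (1 - p)) * (\<integral>\<^sup>+w. ennreal (?k w * U w powr p) \<partial>lborel)"
    by (subst nn_integral_add, measurable) (simp add: nn_integral_cmult nn_integral_multc del: mult_minus_left)
  also have "(\<integral>\<^sup>+w. ennreal (?k w) \<partial>lborel) * ennreal s = ennreal (gauss_mass TYPE('a) \<beta> * s)"
    unfolding nn_integral_gaussian_shift[OF \<open>\<beta> > 0\<close>] using \<open>\<beta> > 0\<close> \<open>s > 0\<close> by (simp add: ennreal_mult gauss_mass_nonneg)
  finally show ?thesis .
qed

text \<open>Up to the constant this is Hoelder's inequality for a finite measure. If
  \<open>B\<close> is the integral on the right, \<open>s = B powr (1 / p)\<close> makes both terms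
  of \<open>gauss_young\<close> multiples of \<open>s\<close>.\<close>

lemma gauss_schur_local:
  fixes U :: "'a::euclidean_space \<Rightarrow> real"
  assumes [measurable]: "U \<in> borel_measurable borel" and U: "\<And>w. U w \<ge> 0"
    and "\<beta> > 0" "p \<ge> 1" "c \<ge> 0" "V \<ge> 0"
    and V: "ennreal V \<le> ennreal c * (\<integral>\<^sup>+w. ennreal (exp (- \<beta> * (norm (z - w))\<^sup>2) * U w) \<partial>lborel)"
  shows "ennreal (V powr p) \<le> ennreal ((c * (gauss_mass TYPE('a) \<beta> + 1)) powr p) *
      (\<integral>\<^sup>+w. ennreal (exp (- \<beta> * (norm (z - w))\<^sup>2) * U w powr p) \<partial>lborel)"
proof (cases "c = 0")
  case True
  then show ?thesis using V \<open>V \<ge> 0\<close> by (simp add: ennreal_eq_0_iff)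
next
  case False
  let ?m = "gauss_mass TYPE('a) \<beta>"
  let ?b = "\<integral>\<^sup>+w. ennreal (exp (- \<beta> * (norm (z - w))\<^sup>2) * U w powr p) \<partial>lborel"
  let ?K = "(c * (?m + 1)) powr p"
  have m: "?m \<ge> 0" using \<open>\<beta> > 0\<close> by (rule gauss_mass_nonneg)
  have "c * (?m + 1) > 0" using m False \<open>c \<ge> 0\<close> by simp
  then have K: "?K > 0" using powr_gt_zero by fastforce
  show ?thesis
  proof (cases ?b)
    case (real B)
    \<comment> \<open>\<open>B\<close> may be 0, and then \<open>s\<close> would vanish; so every
      \<open>t > B\<close> takes its place and \<open>dense_ge\<close> passes to the limit.\<close>
    have "V powr p \<le> ?K * t" if "t > B" for t
    proof -
      have "t > 0" using that real by simp
      define s where "s = t powr (1 / p)"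
      have s: "s > 0" "s powr p = t" using \<open>t > 0\<close> \<open>p \<ge> 1\<close> by (auto simp: s_def powr_powr)
      have "ennreal V \<le> ennreal c * (ennreal (?m * s) + ennreal (s powr (1 - p)) * ?b)"
        using gauss_young[OF assms(1) U \<open>\<beta> > 0\<close> \<open>p \<ge> 1\<close> \<open>s > 0\<close>] by (intro order_trans[OF V] mult_left_mono) auto
      also have "\<dots> = ennreal (c * (?m * s + s powr (1 - p) * B))"
        using real m s \<open>c \<ge> 0\<close> by (simp add: ennreal_mult ennreal_plus)
      finally have "V \<le> c * (?m * s + s powr (1 - p) * B)"
        using real m s \<open>c \<ge> 0\<close> by (subst (asm) ennreal_le_iff) auto
      also have "\<dots> \<le> c * (?m * s + s powr (1 - p) * s powr p)"
        using that s \<open>c \<ge> 0\<close> by (intro mult_left_mono add_left_mono) auto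
      also have "\<dots> = (c * (?m + 1)) * s"
      proof -
        have "s powr (1 - p) * s powr p = s"
          using s(1) by (simp only: powr_add[symmetric]) simp
        then show ?thesis by (simp only:) (simp add: algebra_simps)
      qed
      finally have "V powr p \<le> ((c * (?m + 1)) * s) powr p"
        using \<open>V \<ge> 0\<close> \<open>p \<ge> 1\<close> by (intro powr_mono2) auto
      also have "\<dots> = ?K * t" using s m \<open>c \<ge> 0\<close> by (simp add: powr_mult)
      finally show ?thesis .
    qed
    then have "V powr p / ?K \<le> t" if "t > B" for t
      using that K by (simp add: field_simps)
    then have "V powr p / ?K \<le> B" by (rule dense_ge)
    then have "V powr p \<le> ?K * B" using K by (simp add: field_simps)
    then show ?thesis using real K by (simp add: ennreal_mult[symmetric])
  next
    case top
    then show ?thesis using K by (simp add: ennreal_mult_top)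
  qed
qed

text \<open>The Gaussian factor in \<open>gauss_schur_local\<close> is at most 1. This form is the
  source of bounded point evaluations.\<close>

lemma gauss_schur_point:
  fixes U :: "'a::euclidean_space \<Rightarrow> real"
  assumes [measurable]: "U \<in> borel_measurable borel" and U: "\<And>w. U w \<ge> 0"
    and "\<beta> > 0" "p \<ge> 1" "c \<ge> 0" "V \<ge> 0"
    and V: "ennreal V \<le> ennreal c * (\<integral>\<^sup>+w. ennreal (exp (- \<beta> * (norm (z - w))\<^sup>2) * U w) \<partial>lborel)"
  shows "ennreal (V powr p) \<le> ennreal ((c * (gauss_mass TYPE('a) \<beta> + 1)) powr p) * (\<integral>\<^sup>+w. ennreal (U w powr p) \<partial>lborel)"
  using \<open>\<beta> > 0\<close> by (intro order_trans[OF gauss_schur_local[OF assms]] mult_left_mono nn_integral_mono ennreal_leI)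
    (auto intro!: mult_left_le_one_le)

text \<open>Schur's test: the local bound is integrated in \<open>z\<close>, and after Fubini the
  symmetric kernel contributes the same mass for every \<open>w\<close>.\<close>

lemma gauss_schur:
  fixes U V :: "'a::euclidean_space \<Rightarrow> real"
  assumes [measurable]: "U \<in> borel_measurable borel" and U: "\<And>w. U w \<ge> 0"
    and "\<beta> > 0" "p \<ge> 1" "c \<ge> 0" "\<And>z. V z \<ge> 0"
    and V: "\<And>z. ennreal (V z) \<le> ennreal c * (\<integral>\<^sup>+w. ennreal (exp (- \<beta> * (norm (z - w))\<^sup>2) * U w) \<partial>lborel)"
  shows "(\<integral>\<^sup>+z. ennreal (V z powr p) \<partial>lborel)
    \<le> ennreal ((c * (gauss_mass TYPE('a) \<beta> + 1)) powr p * gauss_mass TYPE('a) \<beta>) * (\<integral>\<^sup>+w. ennreal (U w powr p) \<partial>lborel)"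
proof -
  let ?m = "gauss_mass TYPE('a) \<beta>"
  let ?K = "(c * (?m + 1)) powr p"
  let ?k = "\<lambda>z w::'a. exp (- \<beta> * (norm (z - w))\<^sup>2)"
  have "(\<integral>\<^sup>+z. ennreal (V z powr p) \<partial>lborel) \<le> (\<integral>\<^sup>+z. ennreal ?K * (\<integral>\<^sup>+w. ennreal (?k z w * U w powr p) \<partial>lborel) \<partial>lborel)"
    by (intro nn_integral_mono gauss_schur_local) (use assms in auto)
  also have "\<dots> = ennreal ?K * (\<integral>\<^sup>+z. (\<integral>\<^sup>+w. ennreal (?k z w * U w powr p) \<partial>lborel) \<partial>lborel)"
    by (rule nn_integral_cmult) measurable
  also have "(\<integral>\<^sup>+z. (\<integral>\<^sup>+w. ennreal (?k z w * U w powr p) \<partial>lborel) \<partial>lborel)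
      = (\<integral>\<^sup>+w. (\<integral>\<^sup>+z. ennreal (?k z w * U w powr p) \<partial>lborel) \<partial>lborel)"
    by (rule lborel_pair.Fubini') measurable
  also have "\<dots> = (\<integral>\<^sup>+w. ennreal ?m * ennreal (U w powr p) \<partial>lborel)"
  proof (rule nn_integral_cong)
    fix w :: 'a
    have "(\<integral>\<^sup>+z. ennreal (?k z w * U w powr p) \<partial>lborel) = (\<integral>\<^sup>+z. ennreal (?k w z) * ennreal (U w powr p) \<partial>lborel)"
      by (simp add: ennreal_mult norm_minus_commute)
    also have "\<dots> = ennreal ?m * ennreal (U w powr p)"
      by (subst nn_integral_multc) (simp_all only: nn_integral_gaussian_shift[OF \<open>\<beta> > 0\<close>], measurable)
    finally show "(\<integral>\<^sup>+z. ennreal (?k z w * U w powr p) \<partial>lborel) = ennreal ?m * ennreal (U w powr p)" .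
  qed
  also have "\<dots> = ennreal ?m * (\<integral>\<^sup>+w. ennreal (U w powr p) \<partial>lborel)"
    by (rule nn_integral_cmult) measurable
  finally show ?thesis using gauss_mass_nonneg[OF \<open>\<beta> > 0\<close>, where 'a='a] by (simp add: ennreal_mult mult.assoc)
qed

section \<open>Weights and the kernel of the projection\<close>

lemma Re_hermitian: "Re (hermitian z w) = z \<bullet> w"
  by (simp add: hermitian_def inner_vec_def inner_complex_def)

lemma norm_diff_sq: "(norm (z - w :: complex ^ 'n))\<^sup>2 = (norm z)\<^sup>2 + (norm w)\<^sup>2 - 2 * Re (hermitian z w)"
  unfolding Re_hermitian power2_norm_eq_inner by (simp add: inner_diff inner_commute)

lemma norm_hermitian_le: "norm (hermitian z w) \<le> norm z * norm w"
proof -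
  have "norm (hermitian z w) \<le> (\<Sum>i\<in>UNIV. norm (z $ i) * norm (w $ i))"
    unfolding hermitian_def by (rule order_trans[OF norm_sum]) (simp add: norm_mult)
  also have "\<dots> \<le> norm z * norm w"
    unfolding norm_vec_def by (intro L2_set_mult_ineq[THEN order_trans[rotated]] sum_mono) auto
  finally show ?thesis .
qed

lemma hermitian_add_left: "hermitian (z + v) w = hermitian z w + hermitian v w"
  by (simp add: hermitian_def algebra_simps sum.distrib)
lemma hermitian_add_right: "hermitian w (z + v) = hermitian w z + hermitian w v"
  by (simp add: hermitian_def algebra_simps sum.distrib)
lemma hermitian_scale_left: "hermitian (c *s z) w = c * hermitian z w"
  by (simp add: hermitian_def algebra_simps sum_distrib_left)
lemma hermitian_scaleR_left: "hermitian (c *\<^sub>R z) w = c *\<^sub>R hermitian z w"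
  by (simp add: hermitian_def scaleR_sum_right)
lemma hermitian_commute: "hermitian w z = cnj (hermitian z w)"
  by (simp add: hermitian_def mult.commute)

lemma continuous_hermitian [continuous_intros]:
  "continuous_on S f \<Longrightarrow> continuous_on S g \<Longrightarrow> continuous_on S (\<lambda>x. hermitian (f x) (g x))"
  unfolding hermitian_def by (intro continuous_intros)

lemma borel_measurable_hermitian [measurable]:
  fixes f g :: "'a \<Rightarrow> complex ^ 'n"
  assumes "f \<in> borel_measurable M" "g \<in> borel_measurable M"
  shows "(\<lambda>x. hermitian (f x) (g x)) \<in> borel_measurable M"
proof -
  have "(\<lambda>q. hermitian (fst q) (snd q)) \<in> borel_measurable (borel :: ((complex ^ 'n) \<times> (complex ^ 'n)) measure)"
    by (intro borel_measurable_continuous_onI continuous_intros)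
  then have "(\<lambda>q. hermitian (fst q) (snd q)) \<in> borel_measurable (borel \<Otimes>\<^sub>M borel :: ((complex ^ 'n) \<times> (complex ^ 'n)) measure)"
    by (simp only: borel_prod)
  from measurable_compose[OF measurable_Pair[OF assms] this] show ?thesis by simp
qed

lemma sets_gaussian [simp, measurable_cong]: "sets (gaussian \<nu>) = sets borel"
  by (simp add: gaussian_def)

lemma space_gaussian [simp]: "space (gaussian \<nu>) = UNIV"
  by (simp add: gaussian_def)

text \<open>The \<open>p\<close>-th power of the factor is the exponential in
  \<open>gaussian (p * \<alpha> / 2)\<close>, so one weight serves every \<open>p\<close> and turns
  the weighted space into an unweighted one.\<close>

definition wt :: "real \<Rightarrow> (complex ^ 'n \<Rightarrow> complex) \<Rightarrow> complex ^ 'n \<Rightarrow> real" where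
  "wt \<alpha> u z = norm (u z) * exp (- (\<alpha> / 2) * (norm z)\<^sup>2)"

text \<open>Up to a constant factor, \<open>energy\<close> is the \<open>p\<close>-th power of the norm; with it a triangle
  inequality up to constants replaces that of Minkowski.\<close>

definition energy :: "real \<Rightarrow> real \<Rightarrow> (complex ^ 'n \<Rightarrow> complex) \<Rightarrow> ennreal" where
  "energy \<alpha> p u = (\<integral>\<^sup>+z. ennreal (wt \<alpha> u z powr p) \<partial>lborel)"

lemma wt_nonneg [simp]: "wt \<alpha> u z \<ge> 0"
  by (simp add: wt_def)

lemma wt_measurable [measurable]: "u \<in> borel_measurable borel \<Longrightarrow> wt \<alpha> u \<in> borel_measurable borel"
  unfolding wt_def[abs_def] by (rule borel_measurable_times)
    (auto intro: borel_measurable_norm measurable_compose intro!: borel_measurable_continuous_onI[where f = "\<lambda>z. exp (_ * _ z)"] continuous_intros)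

text \<open>Completing the square: half of the density \<open>exp (- \<alpha> |w|\<^sup>2)\<close>
  joins the kernel and the weight at \<open>z\<close> to form a convolution kernel, the other half
  stays as the weight at \<open>w\<close>.\<close>

lemma norm_fock_kernel:
  "norm (exp (of_real \<alpha> * hermitian z w)) * exp (- \<alpha> * (norm w)\<^sup>2) * exp (- (\<alpha> / 2) * (norm z)\<^sup>2)
    = exp (- (\<alpha> / 2) * (norm (z - w))\<^sup>2) * exp (- (\<alpha> / 2) * (norm w)\<^sup>2)"
  by (simp add: norm_diff_sq exp_add[symmetric] algebra_simps)

lemma wt_fock_proj_le:
  fixes G :: "complex ^ 'n \<Rightarrow> complex"
  assumes [measurable]: "G \<in> borel_measurable borel" and "\<alpha> > 0"
  shows "ennreal (wt \<alpha> (fock_proj \<alpha> G) z) \<le> ennreal ((\<alpha> / pi) ^ CARD('n)) *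
    (\<integral>\<^sup>+w. ennreal (exp (- (\<alpha> / 2) * (norm (z - w))\<^sup>2) * wt \<alpha> G w) \<partial>lborel)"
proof -
  let ?f = "\<lambda>w. exp (of_real \<alpha> * hermitian z w) * G w"
  \<comment> \<open>Without integrability the Bochner integral in \<open>fock_proj\<close> is 0 by
    convention, so the bound holds for every measurable \<open>G\<close>.\<close>
  have 1: "ennreal (norm (fock_proj \<alpha> G z)) \<le> (\<integral>\<^sup>+w. ennreal (norm (?f w)) \<partial>gaussian \<alpha>)"
  proof (cases "integrable (gaussian \<alpha>) ?f")
    case True
    then show ?thesis unfolding fock_proj_def by (rule integral_norm_bound_ennreal)
  qed (simp add: fock_proj_def not_integrable_integral_eq)
  have "ennreal (wt \<alpha> (fock_proj \<alpha> G) z)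
    \<le> (\<integral>\<^sup>+w. ennreal (norm (?f w)) \<partial>gaussian \<alpha>) * ennreal (exp (- (\<alpha> / 2) * (norm z)\<^sup>2))"
    unfolding wt_def by (subst ennreal_mult) (auto intro!: mult_right_mono 1)
  also have "\<dots> = (\<integral>\<^sup>+w. ennreal (norm (?f w)) * ennreal (exp (- (\<alpha> / 2) * (norm z)\<^sup>2)) \<partial>gaussian \<alpha>)"
    by (rule nn_integral_multc[symmetric]) measurable
  also have "\<dots> = (\<integral>\<^sup>+w. ennreal ((\<alpha> / pi) ^ CARD('n)) *
      ennreal (exp (- (\<alpha> / 2) * (norm (z - w))\<^sup>2) * wt \<alpha> G w) \<partial>lborel)"
    unfolding gaussian_def
  proof (subst nn_integral_density; (measurable; fail)?; intro nn_integral_cong)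
    fix w
    have "((\<alpha> / pi) ^ CARD('n) * exp (- \<alpha> * (norm w)\<^sup>2)) * (norm (?f w) * exp (- (\<alpha> / 2) * (norm z)\<^sup>2))
       = (\<alpha> / pi) ^ CARD('n) * norm (G w) * (norm (exp (of_real \<alpha> * hermitian z w)) * exp (- \<alpha> * (norm w)\<^sup>2) * exp (- (\<alpha> / 2) * (norm z)\<^sup>2))"
      by (simp add: norm_mult mult_ac)
    also have "\<dots> = (\<alpha> / pi) ^ CARD('n) * (exp (- (\<alpha> / 2) * (norm (z - w))\<^sup>2) * wt \<alpha> G w)"
      unfolding norm_fock_kernel by (simp add: wt_def mult_ac)
    finally show "ennreal ((\<alpha> / pi) ^ CARD('n) * exp (- \<alpha> * (norm w)\<^sup>2)) * (ennreal (norm (?f w)) * ennreal (exp (- (\<alpha> / 2) * (norm z)\<^sup>2)))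
      = ennreal ((\<alpha> / pi) ^ CARD('n)) * ennreal (exp (- (\<alpha> / 2) * (norm (z - w))\<^sup>2) * wt \<alpha> G w)"
      using \<open>\<alpha> > 0\<close> by (simp add: ennreal_mult[symmetric] del: mult_minus_left)
  qed
  also have "\<dots> = ennreal ((\<alpha> / pi) ^ CARD('n)) *
    (\<integral>\<^sup>+w. ennreal (exp (- (\<alpha> / 2) * (norm (z - w))\<^sup>2) * wt \<alpha> G w) \<partial>lborel)"
    by (rule nn_integral_cmult) measurable
  finally show ?thesis .
qed

section \<open>Entire functions and the reproducing formula\<close>

lemma entire_continuous: "entire u \<Longrightarrow> continuous_on UNIV u"
  unfolding entire_def continuous_on_eq_continuous_within by (blast intro: has_derivative_continuous)

lemma entire_measurable: "entire u \<Longrightarrow> u \<in> borel_measurable borel"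
  by (intro borel_measurable_continuous_onI entire_continuous)

lemma entire_add: "entire u \<Longrightarrow> entire v \<Longrightarrow> entire (\<lambda>z. u z + v z)"
  unfolding entire_def
proof
  fix z assume *: "\<forall>z. \<exists>D. (u has_derivative D) (at z) \<and> (\<forall>c v. D (c *s v) = c * D v)"
    "\<forall>z. \<exists>D. (v has_derivative D) (at z) \<and> (\<forall>c v. D (c *s v) = c * D v)"
  obtain D where D: "(u has_derivative D) (at z)" "\<And>c v. D (c *s v) = c * D v" using * by blast
  obtain E where E: "(v has_derivative E) (at z)" "\<And>c v. E (c *s v) = c * E v" using * by blast
  show "\<exists>D. ((\<lambda>z. u z + v z) has_derivative D) (at z) \<and> (\<forall>c v. D (c *s v) = c * D v)"
    by (rule exI[of _ "\<lambda>h. D h + E h"]) (auto intro!: has_derivative_add D E simp: D(2) E(2) algebra_simps)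
qed

lemma entire_mult: "entire u \<Longrightarrow> entire v \<Longrightarrow> entire (\<lambda>z. u z * v z)"
  unfolding entire_def
proof
  fix z assume *: "\<forall>z. \<exists>D. (u has_derivative D) (at z) \<and> (\<forall>c v. D (c *s v) = c * D v)"
    "\<forall>z. \<exists>D. (v has_derivative D) (at z) \<and> (\<forall>c v. D (c *s v) = c * D v)"
  obtain D where D: "(u has_derivative D) (at z)" "\<And>c v. D (c *s v) = c * D v" using * by blast
  obtain E where E: "(v has_derivative E) (at z)" "\<And>c v. E (c *s v) = c * E v" using * by blast
  show "\<exists>D. ((\<lambda>z. u z * v z) has_derivative D) (at z) \<and> (\<forall>c v. D (c *s v) = c * D v)"
    using has_derivative_mult[OF D(1) E(1)]
    by (intro exI[of _ "\<lambda>h. u z * E h + D h * v z"] conjI) (auto simp: D(2) E(2) algebra_simps)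
qed

lemma entire_const: "entire (\<lambda>z. c)"
  unfolding entire_def by (intro allI exI[of _ "\<lambda>h. 0"]) auto

lemma entire_coord: "entire (\<lambda>z. z $ i)"
  unfolding entire_def
  by (intro allI exI[of _ "\<lambda>h. h $ i"] conjI bounded_linear_imp_has_derivative bounded_linear_vec_nth) simp

lemma linear_hermitian_left: "linear (\<lambda>w. c * hermitian w a)"
  by (rule linearI) (simp_all add: hermitian_add_left hermitian_scaleR_left distrib_left)

lemma entire_exp_hermitian: "entire (\<lambda>w. exp (c * hermitian w a))"
  unfolding entire_def
proof
  fix z
  have L: "((\<lambda>w. c * hermitian w a) has_derivative (\<lambda>w. c * hermitian w a)) (at z)"
    by (intro bounded_linear_imp_has_derivative linear_conv_bounded_linear[THEN iffD1] linear_hermitian_left)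
  have "(exp has_derivative (*) (exp (c * hermitian z a))) (at (c * hermitian z a))"
    using DERIV_exp unfolding has_field_derivative_def .
  from has_derivative_compose[OF L this]
  show "\<exists>D. ((\<lambda>w. exp (c * hermitian w a)) has_derivative D) (at z) \<and> (\<forall>c v. D (c *s v) = c * D v)"
    by (intro exI conjI) (auto simp: hermitian_scale_left)
qed

lemma entire_translate: "entire u \<Longrightarrow> entire (\<lambda>w. u (z + w))"
  unfolding entire_def
proof
  fix w assume "\<forall>z. \<exists>D. (u has_derivative D) (at z) \<and> (\<forall>c v. D (c *s v) = c * D v)"
  then obtain D where D: "(u has_derivative D) (at (z + w))" "\<And>c v. D (c *s v) = c * D v" by blast
  have "((\<lambda>w. z + w) has_derivative (\<lambda>h. h)) (at w)" by (auto intro!: derivative_eq_intros)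
  from has_derivative_compose[OF this D(1)] D(2)
  show "\<exists>D. ((\<lambda>w. u (z + w)) has_derivative D) (at w) \<and> (\<forall>c v. D (c *s v) = c * D v)" by blast
qed

lemma linear_vector_scalar_mult_left: "linear (\<lambda>h::complex. h *s (w :: complex ^ 'n))"
  by (rule linearI) (simp_all add: vec_eq_iff distrib_right)

text \<open>Complex linearity turns the derivative along the line through \<open>w\<close> into
  multiplication by \<open>D w\<close>.\<close>

lemma entire_slice_holomorphic:
  assumes "entire u" shows "(\<lambda>\<zeta>. u (\<zeta> *s w)) holomorphic_on UNIV"
proof (rule holomorphic_onI)
  fix \<zeta> :: complex
  obtain D where D: "(u has_derivative D) (at (\<zeta> *s w))" "\<And>c v. D (c *s v) = c * D v"
    using assms unfolding entire_def by blast
  have "((\<lambda>h. h *s w) has_derivative (\<lambda>h. h *s w)) (at \<zeta>)"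
    by (intro bounded_linear_imp_has_derivative linear_conv_bounded_linear[THEN iffD1] linear_vector_scalar_mult_left)
  from has_derivative_compose[OF this D(1)]
  have "((\<lambda>\<zeta>. u (\<zeta> *s w)) has_field_derivative D w) (at \<zeta>)"
    unfolding has_field_derivative_def D(2) by (simp add: mult.commute[of _ "D w"])
  then show "(\<lambda>\<zeta>. u (\<zeta> *s w)) field_differentiable at \<zeta> within UNIV"
    using field_differentiable_def by auto
qed

text \<open>Cauchy's formula on the unit circle, where dividing by the variable cancels against the
  derivative of the parametrisation.\<close>

lemma holomorphic_circle_mean:
  assumes "g holomorphic_on UNIV"
  shows "((\<lambda>t. g (exp (2 * of_real pi * \<i> * of_real t))) has_integral g 0) {0..1}"
proof -
  have "((\<lambda>u. g u / (u - 0)) has_contour_integral (2 * of_real pi * \<i> * g 0)) (circlepath 0 1)"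
    using assms by (intro Cauchy_integral_circlepath_simple) (auto intro: holomorphic_on_subset)
  then have "((\<lambda>x. g (circlepath 0 1 x) / circlepath 0 1 x * vector_derivative (circlepath 0 1) (at x within {0..1}))
      has_integral (2 * of_real pi * \<i> * g 0)) {0..1}"
    unfolding has_contour_integral_def by simp
  then have "((\<lambda>x. 2 * of_real pi * \<i> * g (exp (2 * of_real pi * \<i> * of_real x)))
      has_integral (2 * of_real pi * \<i> * g 0)) {0..1}"
    by (rule has_integral_eq[rotated]) (simp add: vector_derivative_circlepath01, simp add: circlepath)
  from has_integral_mult_right[OF this, of "1 / (2 * of_real pi * \<i>)"]
  show ?thesis by simp
qed

text \<open>The real dimension is \<open>2 * CARD('n)\<close>, which removes the square
  root.\<close>

lemma gaussian_dimension: "sqrt (pi / \<nu>) ^ DIM(complex ^ 'n) = (pi / \<nu>) ^ CARD('n)" if "\<nu> > 0"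
proof -
  have "DIM(complex ^ 'n) = 2 * CARD('n)" by simp
  then show ?thesis using that by (simp only: power_mult) simp
qed

lemma prob_space_gaussian:
  assumes "\<nu> > 0" shows "prob_space (gaussian \<nu> :: (complex ^ 'n) measure)"
proof
  have "emeasure (gaussian \<nu> :: (complex ^ 'n) measure) UNIV
      = (\<integral>\<^sup>+z. ennreal ((\<nu> / pi) ^ CARD('n)) * ennreal (exp (- \<nu> * (norm (z :: complex ^ 'n))\<^sup>2)) \<partial>lborel)"
    using assms unfolding gaussian_def by (subst emeasure_density) (auto simp: ennreal_mult)
  also have "\<dots> = ennreal ((\<nu> / pi) ^ CARD('n)) * ennreal ((pi / \<nu>) ^ CARD('n))"
    by (subst nn_integral_cmult, measurable)
      (simp only: nn_integral_gaussian[OF assms, where 'a="complex ^ 'n"] gaussian_dimension[OF assms, where 'n='n])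
  also have "\<dots> = 1" using assms by (simp add: ennreal_mult[symmetric] power_mult_distrib[symmetric])
  finally show "emeasure (gaussian \<nu> :: (complex ^ 'n) measure) (space (gaussian \<nu>)) = 1" by simp
qed

lemma integral_gaussian:
  fixes f :: "complex ^ 'n \<Rightarrow> complex"
  assumes "\<nu> > 0" and [measurable]: "f \<in> borel_measurable borel"
  shows "integral\<^sup>L (gaussian \<nu>) f = (\<integral>w. ((\<nu> / pi) ^ CARD('n) * exp (- \<nu> * (norm w)\<^sup>2)) *\<^sub>R f w \<partial>lborel)"
  using assms(1) unfolding gaussian_def by (intro integral_density) auto

lemma integrable_gaussian_iff:
  fixes f :: "complex ^ 'n \<Rightarrow> complex"
  assumes "\<nu> > 0" and [measurable]: "f \<in> borel_measurable borel"
  shows "integrable (gaussian \<nu>) f \<longleftrightarrow> integrable lborel (\<lambda>w. ((\<nu> / pi) ^ CARD('n) * exp (- \<nu> * (norm w)\<^sup>2)) *\<^sub>R f w)"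
  using assms(1) unfolding gaussian_def by (intro integrable_density) auto

lemma norm_vector_scalar_mult: "norm (c *s (w :: complex ^ 'n)) = norm c * norm w"
  by (simp add: norm_vec_def norm_mult L2_set_def power_mult_distrib sum_distrib_left[symmetric] real_sqrt_mult)

lemma orthogonal_vector_scalar_mult:
  assumes "norm c = 1" shows "orthogonal_transformation ((*s) c :: complex ^ 'n \<Rightarrow> complex ^ 'n)"
  unfolding orthogonal_transformation
  by (auto intro!: linearI simp: vec_eq_iff distrib_left norm_vector_scalar_mult assms)

lemma gaussian_rotation:
  assumes "\<nu> > 0" "norm c = 1"
  shows "distr (gaussian \<nu>) borel ((*s) c) = (gaussian \<nu> :: (complex ^ 'n) measure)"
proof -
  let ?T = "(*s) c :: complex ^ 'n \<Rightarrow> complex ^ 'n"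
  have T: "orthogonal_transformation ?T" using assms(2) by (rule orthogonal_vector_scalar_mult)
  have [measurable]: "?T \<in> borel_measurable borel"
    by (intro borel_measurable_continuous_onI linear_continuous_on linear_conv_bounded_linear[THEN iffD1]
      orthogonal_transformation_linear[OF T])
  let ?d = "\<lambda>z::complex ^ 'n. ennreal ((\<nu> / pi) ^ CARD('n) * exp (- \<nu> * (norm z)\<^sup>2))"
  have "gaussian \<nu> = density (distr lborel borel ?T) ?d"
    unfolding lborel_distr_orthogonal[OF T] gaussian_def ..
  also have "\<dots> = distr (density lborel (\<lambda>x. ?d (?T x))) borel ?T"
    by (rule density_distr) measurable
  also have "density lborel (\<lambda>x. ?d (?T x)) = gaussian \<nu>"
    unfolding gaussian_def by (simp add: norm_vector_scalar_mult assms(2))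
  finally show ?thesis ..
qed

text \<open>Average over the rotations \<open>w \<mapsto> exp (2 \<pi> \<i> t) w\<close>, which preserve the Gaussian measure, and apply
  the one-variable mean value property on each complex line.\<close>

lemma gaussian_mean_value:
  fixes u :: "complex ^ 'n \<Rightarrow> complex"
  assumes \<nu>: "\<nu> > 0" and u: "entire u" and int: "integrable (gaussian \<nu>) u"
  shows "integral\<^sup>L (gaussian \<nu>) u = u 0"
proof -
  interpret G: prob_space "gaussian \<nu> :: (complex ^ 'n) measure" using \<nu> by (rule prob_space_gaussian)
  interpret P: pair_sigma_finite "lborel :: real measure" "gaussian \<nu> :: (complex ^ 'n) measure" ..
  define e where "e t = exp (2 * of_real pi * \<i> * of_real t)" for t :: real
  have ne: "norm (e t) = 1" for t by (simp add: e_def)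
  define F where "F t w = indicat_real {0..1} t *\<^sub>R u (e t *s w)" for t and w :: "complex ^ 'n"
  have um [measurable]: "u \<in> borel_measurable borel" using u by (rule entire_measurable)
  have "(\<lambda>q. u (e (fst q) *s snd q)) \<in> borel_measurable (borel :: (real \<times> (complex ^ 'n)) measure)"
    unfolding e_def vector_scalar_mult_def
    by (intro borel_measurable_continuous_onI continuous_on_compose2[OF entire_continuous[OF u]] continuous_intros) auto
  then have [measurable]: "(\<lambda>q. u (e (fst q) *s snd q)) \<in> borel_measurable (borel \<Otimes>\<^sub>M borel :: (real \<times> (complex ^ 'n)) measure)"
    by (simp only: borel_prod)
  have Fm [measurable]: "case_prod F \<in> borel_measurable (lborel \<Otimes>\<^sub>M gaussian \<nu>)"
    unfolding F_def[abs_def] split_beta' by measurable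
  have [measurable]: "(*s) (e t) \<in> (borel :: (complex ^ 'n) measure) \<rightarrow>\<^sub>M borel" for t
    by (intro borel_measurable_continuous_onI linear_continuous_on linear_conv_bounded_linear[THEN iffD1]
      orthogonal_transformation_linear orthogonal_vector_scalar_mult ne)
  \<comment> \<open>A general \<open>h\<close> serves twice: as \<open>norm\<close> to justify
    Fubini, and as the identity to evaluate the integral.\<close>
  have rot: "(\<integral>w. h (u (e t *s w)) \<partial>gaussian \<nu>) = (\<integral>w. h (u w) \<partial>gaussian \<nu>)"
    "integrable (gaussian \<nu>) (\<lambda>w. u (e t *s w))"
    if [measurable]: "h \<in> borel_measurable borel" for t and h :: "complex \<Rightarrow> 'b::{banach,second_countable_topology}"
  proof -
    show "(\<integral>w. h (u (e t *s w)) \<partial>gaussian \<nu>) = (\<integral>w. h (u w) \<partial>gaussian \<nu>)"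
      by (subst (2) gaussian_rotation[OF \<nu> ne[of t], symmetric], subst integral_distr) auto
    show "integrable (gaussian \<nu>) (\<lambda>w. u (e t *s w))"
      using int by (subst (asm) gaussian_rotation[OF \<nu> ne[of t], symmetric], subst (asm) integrable_distr_eq) auto
  qed
  have iF: "integrable (lborel \<Otimes>\<^sub>M gaussian \<nu>) (case_prod F)"
  proof (rule P.Fubini_integrable[OF Fm])
    have "(\<lambda>t. \<integral>w. norm (case_prod F (t, w)) \<partial>gaussian \<nu>) = (\<lambda>t. indicat_real {0..1} t * (\<integral>w. norm (u w) \<partial>gaussian \<nu>))"
      by (simp add: F_def rot(1)[of norm])
    then show "integrable lborel (\<lambda>t. \<integral>w. norm (case_prod F (t, w)) \<partial>gaussian \<nu>)" by simp
    show "AE t in lborel. integrable (gaussian \<nu>) (\<lambda>w. case_prod F (t, w))"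
      unfolding F_def split using rot(2)[of id] by (intro AE_I2 integrable_scaleR_right) auto
  qed
  have "(\<integral>w. (\<integral>t. F t w \<partial>lborel) \<partial>gaussian \<nu>) = (\<integral>t. (\<integral>w. F t w \<partial>gaussian \<nu>) \<partial>lborel)"
    by (rule P.Fubini_integral[OF iF])
  moreover have "(\<integral>t. F t w \<partial>lborel) = u 0" for w
  proof -
    have hol: "((\<lambda>t. u (e t *s w)) has_integral u 0) {0..1}"
      using holomorphic_circle_mean[OF entire_slice_holomorphic[OF u], of w] by (simp add: e_def)
    have "continuous_on {0..1} (\<lambda>t. u (e t *s w))"
      unfolding e_def vector_scalar_mult_def
      by (intro continuous_on_compose2[OF entire_continuous[OF u]] continuous_intros) auto
    then have "set_integrable lborel {0..1} (\<lambda>t. u (e t *s w))" by (rule borel_integrable_atLeastAtMost')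
    from set_borel_integral_eq_integral(2)[OF this] hol
    show ?thesis by (simp add: F_def set_lebesgue_integral_def integral_unique)
  qed
  moreover have "(\<integral>w. F t w \<partial>gaussian \<nu>) = indicat_real {0..1} t *\<^sub>R integral\<^sup>L (gaussian \<nu>) u" for t
    using rot(1)[of "\<lambda>x. x" t] by (simp add: F_def)
  ultimately show ?thesis using G.prob_space by simp
qed

text \<open>As a function of \<open>w\<close>, \<open>exp (\<alpha> <z, w>)\<close> is
  antiholomorphic. Shifting \<open>w\<close> by \<open>z\<close> and expanding
  \<open>|z + w|\<^sup>2\<close> leaves \<open>exp (- \<alpha> <w, z>)\<close> in its place, which
  is holomorphic, so that the mean value property becomes applicable.\<close>

lemma fock_proj_translate:
  fixes u :: "complex ^ 'n \<Rightarrow> complex"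
  assumes "\<alpha> > 0" and um [measurable]: "u \<in> borel_measurable borel"
  shows "fock_proj \<alpha> u z = (\<integral>w. exp (- of_real \<alpha> * hermitian w z) * u (z + w) \<partial>gaussian \<alpha>)" (is ?A)
    and "integrable (gaussian \<alpha>) (\<lambda>w. exp (of_real \<alpha> * hermitian z w) * u w) \<Longrightarrow>
      integrable (gaussian \<alpha>) (\<lambda>w. exp (- of_real \<alpha> * hermitian w z) * u (z + w))" (is "?B \<Longrightarrow> ?C")
proof -
  let ?d = "\<lambda>w::complex ^ 'n. (\<alpha> / pi) ^ CARD('n) * exp (- \<alpha> * (norm w)\<^sup>2)"
  let ?f = "\<lambda>w. ?d w *\<^sub>R (exp (of_real \<alpha> * hermitian z w) * u w)"
  have eq: "?f (z + w) = ?d w *\<^sub>R (exp (- of_real \<alpha> * hermitian w z) * u (z + w))" for w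
  proof -
    have n: "(norm (z + w))\<^sup>2 = (norm z)\<^sup>2 + (norm w)\<^sup>2 + 2 * Re (hermitian z w)"
      unfolding Re_hermitian power2_norm_eq_inner by (simp add: inner_add inner_commute)
    have zz: "hermitian z z = of_real ((norm z)\<^sup>2)"
      by (rule complex_eqI) (simp_all add: Re_hermitian power2_norm_eq_inner, simp add: hermitian_def)
    have re: "of_real (2 * Re (hermitian z w)) = hermitian z w + hermitian w z"
      using complex_add_cnj[of "hermitian z w"] by (simp add: hermitian_commute[of w z])
    have "of_real (exp (- \<alpha> * (norm (z + w))\<^sup>2)) * exp (of_real \<alpha> * hermitian z (z + w))
      = exp (of_real (- \<alpha> * (norm (z + w))\<^sup>2) + of_real \<alpha> * hermitian z (z + w))"
      by (simp only: exp_add exp_of_real)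
    also have "of_real (- \<alpha> * (norm (z + w))\<^sup>2) + of_real \<alpha> * hermitian z (z + w)
      = of_real (- \<alpha> * (norm w)\<^sup>2) + (- of_real \<alpha> * hermitian w z)"
    proof -
      have "of_real (- \<alpha> * (norm (z + w))\<^sup>2) = - of_real \<alpha> * (of_real ((norm z)\<^sup>2) + of_real ((norm w)\<^sup>2) + of_real (2 * Re (hermitian z w)) :: complex)"
        unfolding n by simp
      then show ?thesis unfolding re hermitian_add_right zz by (simp add: algebra_simps)
    qed
    also have "exp \<dots> = of_real (exp (- \<alpha> * (norm w)\<^sup>2)) * exp (- of_real \<alpha> * hermitian w z)"
      by (simp only: exp_add exp_of_real)
    finally have *: "of_real (exp (- \<alpha> * (norm (z + w))\<^sup>2)) * exp (of_real \<alpha> * hermitian z (z + w))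
      = of_real (exp (- \<alpha> * (norm w)\<^sup>2)) * exp (- of_real \<alpha> * hermitian w z)" .
    have "?f (z + w) = of_real ((\<alpha> / pi) ^ CARD('n)) *
        (of_real (exp (- \<alpha> * (norm (z + w))\<^sup>2)) * exp (of_real \<alpha> * hermitian z (z + w))) * u (z + w)"
      by (simp only: scaleR_conv_of_real of_real_mult mult.assoc)
    also have "\<dots> = of_real ((\<alpha> / pi) ^ CARD('n)) *
        (of_real (exp (- \<alpha> * (norm w)\<^sup>2)) * exp (- of_real \<alpha> * hermitian w z)) * u (z + w)"
      by (simp only: *)
    also have "\<dots> = ?d w *\<^sub>R (exp (- of_real \<alpha> * hermitian w z) * u (z + w))"
      by (simp only: scaleR_conv_of_real of_real_mult mult.assoc)
    finally show ?thesis .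
  qed
  have "integral\<^sup>L lborel ?f = (\<integral>w. ?f (z + w) \<partial>lborel)"
    by (subst lborel_distr_plus[of z, symmetric], subst integral_distr) auto
  then show ?A
    unfolding fock_proj_def eq by (subst (1 2) integral_gaussian[OF assms(1)]) auto
  have "integrable lborel ?f \<Longrightarrow> integrable lborel (\<lambda>w. ?f (z + w))"
    by (subst (asm) lborel_distr_plus[of z, symmetric], subst (asm) integrable_distr_eq) auto
  then show "?B \<Longrightarrow> ?C"
    unfolding eq by (subst (asm) integrable_gaussian_iff[OF assms(1)], measurable, subst integrable_gaussian_iff[OF assms(1)]) auto
qed

text \<open>The integrand of \<open>fock_proj_translate\<close> is entire, and at the origin its
  exponential factor is 1.\<close>

lemma fock_proj_reproducing:
  fixes u :: "complex ^ 'n \<Rightarrow> complex"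
  assumes "\<alpha> > 0" "entire u" "integrable (gaussian \<alpha>) (\<lambda>w. exp (of_real \<alpha> * hermitian z w) * u w)"
  shows "fock_proj \<alpha> u z = u z"
proof -
  have m: "u \<in> borel_measurable borel" using assms(2) by (rule entire_measurable)
  have "fock_proj \<alpha> u z = (\<integral>w. exp (- of_real \<alpha> * hermitian w z) * u (z + w) \<partial>gaussian \<alpha>)"
    by (rule fock_proj_translate(1)[OF assms(1) m])
  also have "\<dots> = exp (- of_real \<alpha> * hermitian 0 z) * u (z + 0)"
    by (intro gaussian_mean_value fock_proj_translate(2) entire_mult entire_exp_hermitian entire_translate assms m)
  finally show ?thesis by (simp add: hermitian_def)
qed

section \<open>The Fock space\<close>

lemma powr_add_le:
  fixes x y p :: real
  assumes "x \<ge> 0" "y \<ge> 0" "p \<ge> 0"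
  shows "(x + y) powr p \<le> 2 powr p * (x powr p + y powr p)"
proof -
  have "(x + y) powr p \<le> (2 * max x y) powr p"
    using assms by (intro powr_mono2) auto
  also have "\<dots> = 2 powr p * max x y powr p" using assms by (simp add: powr_mult)
  also have "max x y powr p \<le> x powr p + y powr p" by (simp add: max_def)
  finally show ?thesis by simp
qed

lemma energy_mono:
  assumes [measurable]: "v \<in> borel_measurable borel" and "\<And>z. norm (u z) \<le> c * norm (v z)" "c \<ge> 0" "p \<ge> 0"
  shows "energy \<alpha> p u \<le> ennreal (c powr p) * energy \<alpha> p v"
proof -
  have "energy \<alpha> p u \<le> (\<integral>\<^sup>+z. ennreal (c powr p) * ennreal (wt \<alpha> v z powr p) \<partial>lborel)"
    unfolding energy_def
  proof (rule nn_integral_mono)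
    fix z
    have "wt \<alpha> u z \<le> c * wt \<alpha> v z"
      using mult_right_mono[OF assms(2)[of z], of "exp (- (\<alpha> / 2) * (norm z)\<^sup>2)"] by (simp add: wt_def mult_ac)
    then have "wt \<alpha> u z powr p \<le> (c * wt \<alpha> v z) powr p"
      using \<open>p \<ge> 0\<close> by (intro powr_mono2) auto
    then show "ennreal (wt \<alpha> u z powr p) \<le> ennreal (c powr p) * ennreal (wt \<alpha> v z powr p)"
      using \<open>c \<ge> 0\<close> by (simp add: powr_mult ennreal_mult[symmetric])
  qed
  also have "\<dots> = ennreal (c powr p) * energy \<alpha> p v"
    unfolding energy_def by (rule nn_integral_cmult) measurable
  finally show ?thesis .
qed

lemma energy_add:
  assumes [measurable]: "u \<in> borel_measurable borel" "v \<in> borel_measurable borel" and "p \<ge> 0"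
  shows "energy \<alpha> p (\<lambda>z. u z + v z) \<le> ennreal (2 powr p) * (energy \<alpha> p u + energy \<alpha> p v)"
proof -
  have "energy \<alpha> p (\<lambda>z. u z + v z)
    \<le> (\<integral>\<^sup>+z. ennreal (2 powr p) * (ennreal (wt \<alpha> u z powr p) + ennreal (wt \<alpha> v z powr p)) \<partial>lborel)"
    unfolding energy_def
  proof (rule nn_integral_mono)
    fix z
    have "wt \<alpha> (\<lambda>z. u z + v z) z \<le> wt \<alpha> u z + wt \<alpha> v z"
      unfolding wt_def distrib_right[symmetric] by (intro mult_right_mono norm_triangle_ineq) auto
    then have "wt \<alpha> (\<lambda>z. u z + v z) z powr p \<le> (wt \<alpha> u z + wt \<alpha> v z) powr p"
      using \<open>p \<ge> 0\<close> by (intro powr_mono2) auto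
    also have "\<dots> \<le> 2 powr p * (wt \<alpha> u z powr p + wt \<alpha> v z powr p)"
      by (rule powr_add_le) (use \<open>p \<ge> 0\<close> in auto)
    finally show "ennreal (wt \<alpha> (\<lambda>z. u z + v z) z powr p)
      \<le> ennreal (2 powr p) * (ennreal (wt \<alpha> u z powr p) + ennreal (wt \<alpha> v z powr p))"
      by (simp add: ennreal_mult[symmetric] ennreal_plus[symmetric] del: ennreal_plus)
  qed
  also have "\<dots> = ennreal (2 powr p) * (energy \<alpha> p u + energy \<alpha> p v)"
    unfolding energy_def by (subst nn_integral_cmult, measurable, subst nn_integral_add) auto
  finally show ?thesis .
qed

text \<open>Half of the Gaussian decay absorbs any exponential of linear growth, at the cost of a
  constant.\<close>

lemma linear_minus_quadratic_le:
  fixes \<alpha> c x :: real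
  assumes "\<alpha> > 0" shows "c * x - (\<alpha> / 2) * x\<^sup>2 \<le> c\<^sup>2 / \<alpha> - (\<alpha> / 4) * x\<^sup>2"
proof -
  have "0 \<le> (2 * c - \<alpha> * x)\<^sup>2 / (4 * \<alpha>)" using assms by simp
  also have "\<dots> = c\<^sup>2 / \<alpha> - c * x + (\<alpha> / 4) * x\<^sup>2"
    using assms by (simp add: power2_eq_square field_simps)
  finally show ?thesis by (simp add: field_simps)
qed

lemma exp_quadratic_split: "exp (c\<^sup>2 / \<alpha> - (\<alpha> / 4) * x\<^sup>2) = exp (c\<^sup>2 / \<alpha>) * exp (- (\<alpha> / 4) * x\<^sup>2)" for x :: real
  by (simp add: exp_add[symmetric])

locale fock_setting =
  fixes \<alpha> p :: real
  assumes alpha_pos: "\<alpha> > 0" and p_gt1: "p > 1"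
begin

lemma energy_exp_growth:
  assumes "\<And>z :: complex ^ 'n. norm (u z) \<le> A * exp (c * norm z)"
  shows "energy \<alpha> p u < \<infinity>"
proof -
  have A: "A \<ge> 0" using order_trans[OF norm_ge_zero assms[of 0]] by simp
  let ?B = "A * exp (c\<^sup>2 / \<alpha>)"
  have "energy \<alpha> p u \<le> (\<integral>\<^sup>+(z::complex ^ 'n). ennreal (?B powr p) * ennreal (exp (- (p * \<alpha> / 4) * (norm z)\<^sup>2)) \<partial>lborel)"
    unfolding energy_def
  proof (rule nn_integral_mono)
    fix z :: "complex ^ 'n"
    have "wt \<alpha> u z \<le> (A * exp (c * norm z)) * exp (- (\<alpha> / 2) * (norm z)\<^sup>2)"
      unfolding wt_def by (intro mult_right_mono assms) auto
    also have "\<dots> = A * exp (c * norm z - (\<alpha> / 2) * (norm z)\<^sup>2)"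
      by (simp add: mult.assoc exp_add[symmetric])
    also have "\<dots> \<le> A * exp (c\<^sup>2 / \<alpha> - (\<alpha> / 4) * (norm z)\<^sup>2)"
      using A linear_minus_quadratic_le[OF alpha_pos, of c "norm z"] by (intro mult_left_mono) auto
    also have "\<dots> = ?B * exp (- (\<alpha> / 4) * (norm z)\<^sup>2)"
      unfolding exp_quadratic_split by (simp only: mult.assoc)
    finally have "wt \<alpha> u z powr p \<le> (?B * exp (- (\<alpha> / 4) * (norm z)\<^sup>2)) powr p"
      using p_gt1 by (intro powr_mono2) auto
    also have "\<dots> = ?B powr p * exp (- (\<alpha> / 4) * (norm z)\<^sup>2) powr p"
      by (rule powr_mult)
    also have "exp (- (\<alpha> / 4) * (norm z)\<^sup>2) powr p = exp (- (p * \<alpha> / 4) * (norm z)\<^sup>2)"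
      by (simp add: powr_def)
    finally show "ennreal (wt \<alpha> u z powr p) \<le> ennreal (?B powr p) * ennreal (exp (- (p * \<alpha> / 4) * (norm z)\<^sup>2))"
      by (simp add: ennreal_mult[symmetric])
  qed
  also have "\<dots> = ennreal (?B powr p) * ennreal (sqrt (pi / (p * \<alpha> / 4)) ^ DIM(complex ^ 'n))"
    using alpha_pos p_gt1 by (subst nn_integral_cmult, measurable, subst nn_integral_gaussian) auto
  also have "\<dots> < \<infinity>" by (simp add: ennreal_mult[symmetric] ennreal_mult_less_top)
  finally show ?thesis .
qed

text \<open>The density \<open>exp (- \<alpha> |w|\<^sup>2)\<close> is shared out: one half turns
  \<open>norm (G w)\<close> into \<open>wt\<close>, a quarter absorbs \<open>exp (c |w|)\<close>,
  and the last quarter is the Gaussian of \<open>gauss_young\<close>, used at the centre 0 with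
  \<open>s = 1\<close>.\<close>

lemma integrable_gaussianI:
  fixes f :: "complex ^ 'n \<Rightarrow> complex" and G :: "complex ^ 'n \<Rightarrow> complex"
  assumes [measurable]: "f \<in> borel_measurable borel" "G \<in> borel_measurable borel"
    and fin: "energy \<alpha> p G < \<infinity>" and le: "\<And>w. norm (f w) \<le> A * exp (c * norm w) * norm (G w)"
    and A: "A \<ge> 0"
  shows "integrable (gaussian \<alpha>) f"
proof (rule integrableI_bounded)
  show "f \<in> borel_measurable (gaussian \<alpha>)" by measurable
  let ?a = "(\<alpha> / pi) ^ CARD('n)"
  let ?K = "?a * A * exp (c\<^sup>2 / \<alpha>)"
  have K: "?K \<ge> 0" using A alpha_pos by simp
  have "(\<integral>\<^sup>+w. ennreal (norm (f w)) \<partial>gaussian \<alpha>)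
    = (\<integral>\<^sup>+w. ennreal (?a * exp (- \<alpha> * (norm w)\<^sup>2)) * ennreal (norm (f w)) \<partial>lborel)"
    unfolding gaussian_def by (subst nn_integral_density) auto
  also have "\<dots> \<le> (\<integral>\<^sup>+w. ennreal ?K * ennreal (exp (- (\<alpha> / 4) * (norm (0 - w))\<^sup>2) * wt \<alpha> G w) \<partial>lborel)"
  proof (rule nn_integral_mono)
    fix w :: "complex ^ 'n"
    have "exp (- \<alpha> * (norm w)\<^sup>2) * norm (f w)
      \<le> exp (- \<alpha> * (norm w)\<^sup>2) * (A * exp (c * norm w) * norm (G w))"
      by (intro mult_left_mono le) auto
    also have "\<dots> = A * exp (c * norm w - (\<alpha> / 2) * (norm w)\<^sup>2) * wt \<alpha> G w"
    proof -
      have "exp (- \<alpha> * (norm w)\<^sup>2) * exp (c * norm w) = exp (c * norm w - (\<alpha> / 2) * (norm w)\<^sup>2) * exp (- (\<alpha> / 2) * (norm w)\<^sup>2)"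
        unfolding exp_add[symmetric] by (simp add: field_simps)
      then have "exp (- \<alpha> * (norm w)\<^sup>2) * exp (c * norm w) * (A * norm (G w))
        = exp (c * norm w - (\<alpha> / 2) * (norm w)\<^sup>2) * exp (- (\<alpha> / 2) * (norm w)\<^sup>2) * (A * norm (G w))"
        by (simp only:)
      then show ?thesis unfolding wt_def by (simp only: mult_ac)
    qed
    also have "\<dots> \<le> A * exp (c\<^sup>2 / \<alpha> - (\<alpha> / 4) * (norm w)\<^sup>2) * wt \<alpha> G w"
      using A linear_minus_quadratic_le[OF alpha_pos, of c "norm w"] by (intro mult_left_mono mult_right_mono) auto
    also have "\<dots> = A * exp (c\<^sup>2 / \<alpha>) * (exp (- (\<alpha> / 4) * (norm (0 - w))\<^sup>2) * wt \<alpha> G w)"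
      unfolding exp_quadratic_split by (simp add: mult.assoc)
    finally have "?a * (exp (- \<alpha> * (norm w)\<^sup>2) * norm (f w)) \<le> ?a * (A * exp (c\<^sup>2 / \<alpha>) * (exp (- (\<alpha> / 4) * (norm (0 - w))\<^sup>2) * wt \<alpha> G w))"
      using alpha_pos by (intro mult_left_mono) auto
    then have "?a * exp (- \<alpha> * (norm w)\<^sup>2) * norm (f w) \<le> ?K * (exp (- (\<alpha> / 4) * (norm (0 - w))\<^sup>2) * wt \<alpha> G w)"
      by (simp only: mult.assoc)
    then show "ennreal (?a * exp (- \<alpha> * (norm w)\<^sup>2)) * ennreal (norm (f w))
      \<le> ennreal ?K * ennreal (exp (- (\<alpha> / 4) * (norm (0 - w))\<^sup>2) * wt \<alpha> G w)"
      using K alpha_pos by (subst (1 2) ennreal_mult[symmetric]) (auto intro!: ennreal_leI)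
  qed
  also have "\<dots> = ennreal ?K * (\<integral>\<^sup>+w. ennreal (exp (- (\<alpha> / 4) * (norm (0 - w))\<^sup>2) * wt \<alpha> G w) \<partial>lborel)"
    by (rule nn_integral_cmult) measurable
  also have "(\<integral>\<^sup>+w. ennreal (exp (- (\<alpha> / 4) * (norm (0 - w))\<^sup>2) * wt \<alpha> G w) \<partial>lborel)
    \<le> ennreal (gauss_mass TYPE(complex ^ 'n) (\<alpha> / 4) * 1) + ennreal (1 powr (1 - p)) *
      (\<integral>\<^sup>+w. ennreal (exp (- (\<alpha> / 4) * (norm (0 - w))\<^sup>2) * wt \<alpha> G w powr p) \<partial>lborel)"
    using alpha_pos p_gt1 by (intro gauss_young) auto
  also have "(\<integral>\<^sup>+w. ennreal (exp (- (\<alpha> / 4) * (norm (0 - w))\<^sup>2) * wt \<alpha> G w powr p) \<partial>lborel) \<le> energy \<alpha> p G"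
    unfolding energy_def using alpha_pos by (intro nn_integral_mono ennreal_leI mult_left_le_one_le) auto
  finally have "(\<integral>\<^sup>+w. ennreal (norm (f w)) \<partial>gaussian \<alpha>)
    \<le> ennreal ?K * (ennreal (gauss_mass TYPE(complex ^ 'n) (\<alpha> / 4) * 1) + ennreal (1 powr (1 - p)) * energy \<alpha> p G)"
    by (simp add: mult_left_mono add_left_mono)
  also have "\<dots> < \<infinity>" using fin by (simp add: ennreal_mult_less_top)
  finally show "(\<integral>\<^sup>+w. ennreal (norm (f w)) \<partial>gaussian \<alpha>) < \<infinity>" .
qed

lemma norm_exp_hermitian_le: "norm (exp (of_real \<alpha> * hermitian z w)) \<le> exp (\<alpha> * norm z * norm w)"
proof -
  have "\<alpha> * Re (hermitian z w) \<le> \<alpha> * (norm z * norm w)"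
    using abs_Re_le_cmod[of "hermitian z w"] norm_hermitian_le[of z w] alpha_pos by (intro mult_left_mono) auto
  then show ?thesis by (simp add: mult.assoc)
qed

lemma integrable_fock_kernel:
  fixes G :: "complex ^ 'n \<Rightarrow> complex"
  assumes [measurable]: "G \<in> borel_measurable borel" and fin: "energy \<alpha> p G < \<infinity>"
  shows "integrable (gaussian \<alpha>) (\<lambda>w. exp (of_real \<alpha> * hermitian z w) * G w)"
  by (rule integrable_gaussianI[OF _ assms, of _ 1 "\<alpha> * norm z"])
    (auto simp: norm_mult intro!: mult_right_mono norm_exp_hermitian_le[simplified])

lemma fock_proj_add:
  fixes G H :: "complex ^ 'n \<Rightarrow> complex"
  assumes "G \<in> borel_measurable borel" "energy \<alpha> p G < \<infinity>" "H \<in> borel_measurable borel" "energy \<alpha> p H < \<infinity>"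
  shows "fock_proj \<alpha> (\<lambda>w. G w + H w) z = fock_proj \<alpha> G z + fock_proj \<alpha> H z"
  unfolding fock_proj_def distrib_left by (intro Bochner_Integration.integral_add integrable_fock_kernel assms)

lemma fock_proj_scale: "fock_proj \<alpha> (\<lambda>w. c * G w) z = c * fock_proj \<alpha> G z"
  unfolding fock_proj_def by (subst integral_mult_right_zero[symmetric]) (simp add: mult.left_commute)

lemma energy_scale_finite:
  assumes "v \<in> borel_measurable borel" "energy \<alpha> p v < \<infinity>" "\<And>z. norm (u z) \<le> c * norm (v z)" "c \<ge> 0"
  shows "energy \<alpha> p u < \<infinity>"
proof -
  have "energy \<alpha> p u \<le> ennreal (c powr p) * energy \<alpha> p v"
    using assms p_gt1 by (intro energy_mono) auto
  also have "\<dots> < \<infinity>" using assms(2) by (simp add: ennreal_mult_less_top)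
  finally show ?thesis .
qed

lemma energy_add_finite:
  assumes "u \<in> borel_measurable borel" "energy \<alpha> p u < \<infinity>" "v \<in> borel_measurable borel" "energy \<alpha> p v < \<infinity>"
  shows "energy \<alpha> p (\<lambda>z. u z + v z) < \<infinity>"
proof -
  have "energy \<alpha> p (\<lambda>z. u z + v z) \<le> ennreal (2 powr p) * (energy \<alpha> p u + energy \<alpha> p v)"
    using assms p_gt1 by (intro energy_add) auto
  also have "\<dots> < \<infinity>" using assms(2,4) by (simp add: ennreal_mult_less_top)
  finally show ?thesis .
qed

lemma fock_proj_diff:
  fixes G H :: "complex ^ 'n \<Rightarrow> complex"
  assumes "G \<in> borel_measurable borel" "energy \<alpha> p G < \<infinity>" "H \<in> borel_measurable borel" "energy \<alpha> p H < \<infinity>"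
  shows "fock_proj \<alpha> (\<lambda>w. G w - H w) z = fock_proj \<alpha> G z - fock_proj \<alpha> H z"
  unfolding fock_proj_def right_diff_distrib by (intro Bochner_Integration.integral_diff integrable_fock_kernel assms)

lemma nn_integral_gaussian_powr:
  fixes g :: "complex ^ 'n \<Rightarrow> complex"
  assumes [measurable]: "g \<in> borel_measurable borel"
  shows "(\<integral>\<^sup>+z. ennreal (norm (g z) powr p) \<partial>gaussian (p * \<alpha> / 2))
    = ennreal ((p * \<alpha> / 2 / pi) ^ CARD('n)) * energy \<alpha> p g"
proof -
  have "(\<integral>\<^sup>+z. ennreal (norm (g z) powr p) \<partial>gaussian (p * \<alpha> / 2))
    = (\<integral>\<^sup>+z. ennreal ((p * \<alpha> / 2 / pi) ^ CARD('n)) * ennreal (wt \<alpha> g z powr p) \<partial>lborel)"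
    unfolding gaussian_def
  proof (subst nn_integral_density; (measurable; fail)?; intro nn_integral_cong)
    fix z
    have "wt \<alpha> g z powr p = norm (g z) powr p * exp (- (\<alpha> / 2) * (norm z)\<^sup>2) powr p"
      unfolding wt_def by (rule powr_mult)
    also have "exp (- (\<alpha> / 2) * (norm z)\<^sup>2) powr p = exp (- (p * \<alpha> / 2) * (norm z)\<^sup>2)"
      by (simp add: powr_def)
    finally show "ennreal ((p * \<alpha> / 2 / pi) ^ CARD('n) * exp (- (p * \<alpha> / 2) * (norm z)\<^sup>2)) * ennreal (norm (g z) powr p)
      = ennreal ((p * \<alpha> / 2 / pi) ^ CARD('n)) * ennreal (wt \<alpha> g z powr p)"
      using alpha_pos p_gt1 by (simp add: ennreal_mult[symmetric] mult_ac)
  qed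
  also have "\<dots> = ennreal ((p * \<alpha> / 2 / pi) ^ CARD('n)) * energy \<alpha> p g"
    unfolding energy_def by (rule nn_integral_cmult) measurable
  finally show ?thesis .
qed

text \<open>An entire function is continuous, hence measurable, so of membership in
  \<open>Lp_space\<close> only the finiteness of the energy remains.\<close>

lemma fock_iff: "u \<in> fock \<alpha> p \<longleftrightarrow> energy \<alpha> p u < \<infinity> \<and> entire u" for u :: "complex ^ 'n \<Rightarrow> complex"
proof -
  have "integrable (gaussian (p * \<alpha> / 2)) (\<lambda>z. norm (u z) powr p) \<longleftrightarrow> energy \<alpha> p u < \<infinity>" if "entire u"
  proof -
    have [measurable]: "u \<in> borel_measurable borel" using that by (rule entire_measurable)
    have "integrable (gaussian (p * \<alpha> / 2)) (\<lambda>z. norm (u z) powr p) \<longleftrightarrow>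
      (\<integral>\<^sup>+z. ennreal (norm (u z) powr p) \<partial>gaussian (p * \<alpha> / 2)) < \<infinity>"
      unfolding integrable_iff_bounded by simp
    also have "\<dots> \<longleftrightarrow> energy \<alpha> p u < \<infinity>"
      unfolding nn_integral_gaussian_powr[OF \<open>u \<in> borel_measurable borel\<close>] using alpha_pos p_gt1
      by (simp add: ennreal_mult_less_top top.not_eq_extremum[symmetric] ennreal_mult_eq_top_iff)
    finally show ?thesis .
  qed
  then show ?thesis unfolding fock_def Lp_space_def using entire_measurable by blast
qed

lemma Lp_norm_energy:
  fixes g :: "complex ^ 'n \<Rightarrow> complex"
  assumes [measurable]: "g \<in> borel_measurable borel"
  shows "Lp_norm \<alpha> p g = ((p * \<alpha> / 2 / pi) ^ CARD('n) * enn2real (energy \<alpha> p g)) powr (1 / p)"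
  unfolding Lp_norm_def using alpha_pos p_gt1
  by (subst integral_eq_nn_integral) (auto simp: nn_integral_gaussian_powr enn2real_mult)

lemma fockD:
  assumes "u \<in> fock \<alpha> p"
  shows "entire u" "energy \<alpha> p u < \<infinity>" "u \<in> borel_measurable borel" "fock_proj \<alpha> u = u"
proof -
  show u: "entire u" "energy \<alpha> p u < \<infinity>" using assms by (auto simp: fock_iff)
  then show "u \<in> borel_measurable borel" by (auto intro: entire_measurable)
  then show "fock_proj \<alpha> u = u"
    using u by (intro ext fock_proj_reproducing alpha_pos integrable_fock_kernel)
qed

text \<open>Both halves are Schur estimates with \<open>\<beta> = \<alpha> / 2\<close>. On the Fock
  space, where \<open>fock_proj \<alpha> u = u\<close>, the pointwise half says that weighted point
  evaluations are bounded uniformly.\<close>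

lemma fock_proj_bounds:
  "\<exists>C>0. \<forall>G :: complex ^ 'n \<Rightarrow> complex. G \<in> borel_measurable borel \<longrightarrow>
     (\<forall>z. ennreal (wt \<alpha> (fock_proj \<alpha> G) z powr p) \<le> ennreal C * energy \<alpha> p G) \<and>
     energy \<alpha> p (fock_proj \<alpha> G) \<le> ennreal C * energy \<alpha> p G"
proof -
  let ?m = "gauss_mass TYPE(complex ^ 'n) (\<alpha> / 2)"
  let ?c = "((\<alpha> / pi) ^ CARD('n) * (?m + 1)) powr p"
  define C where "C = ?c * (?m + 1)"
  have m: "?m \<ge> 0" using alpha_pos by (intro gauss_mass_nonneg) simp
  have c: "?c > 0" using m alpha_pos powr_gt_zero by fastforce
  show ?thesis
  proof (intro exI[of _ C] conjI allI impI)
    show "C > 0" unfolding C_def using m c by (intro mult_pos_pos) auto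
    fix G :: "complex ^ 'n \<Rightarrow> complex" assume [measurable]: "G \<in> borel_measurable borel"
    have "energy \<alpha> p (fock_proj \<alpha> G) \<le> ennreal (?c * ?m) * energy \<alpha> p G"
      unfolding energy_def using alpha_pos p_gt1 by (intro gauss_schur wt_fock_proj_le) auto
    also have "\<dots> \<le> ennreal C * energy \<alpha> p G"
      unfolding C_def using c m by (intro mult_right_mono ennreal_leI mult_left_mono) auto
    finally show "energy \<alpha> p (fock_proj \<alpha> G) \<le> ennreal C * energy \<alpha> p G" .
    fix z
    have "ennreal (wt \<alpha> (fock_proj \<alpha> G) z powr p) \<le> ennreal ?c * energy \<alpha> p G"
      unfolding energy_def using alpha_pos p_gt1 by (intro gauss_schur_point[OF _ _ _ _ _ _ wt_fock_proj_le]) auto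
    also have "\<dots> \<le> ennreal C * energy \<alpha> p G"
      unfolding C_def using c m by (intro mult_right_mono ennreal_leI) auto
    finally show "ennreal (wt \<alpha> (fock_proj \<alpha> G) z powr p) \<le> ennreal C * energy \<alpha> p G" .
  qed
qed

end

text \<open>If \<open>s\<close> is the series on the right, each of its terms gives
  \<open>a k \<le> s powr (1 / p) / 2 ^ k\<close>, and the geometric series adds up to the factor 2.
  It plays the part of Minkowski's inequality for terms that decay like \<open>1 / 4 ^ k\<close>,
  which can afford the weights \<open>2 ^ k\<close>.\<close>

lemma suminf_powr_le:
  fixes a :: "nat \<Rightarrow> real"
  assumes a: "\<And>k. a k \<ge> 0" and p: "p > 0"
  shows "ennreal ((\<Sum>k. a k) powr p) \<le> ennreal (2 powr p) * (\<Sum>k. ennreal ((2 ^ k * a k) powr p))"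
proof (cases "\<Sum>k. ennreal ((2 ^ k * a k) powr p)")
  case (real s)
  have "a k \<le> s powr (1 / p) * (1 / 2) ^ k" for k
  proof -
    have "(\<Sum>i\<in>{k}. ennreal ((2 ^ i * a i) powr p)) \<le> (\<Sum>k. ennreal ((2 ^ k * a k) powr p))"
      by (rule sum_le_suminf) auto
    then have "(2 ^ k * a k) powr p \<le> s" using real by simp
    then have "((2 ^ k * a k) powr p) powr (1 / p) \<le> s powr (1 / p)"
      using p by (intro powr_mono2) auto
    then have "2 ^ k * a k \<le> s powr (1 / p)" using p a by (simp add: powr_powr)
    then show ?thesis by (simp add: field_simps power_divide)
  qed
  note le = this
  have geo: "(\<lambda>k. s powr (1 / p) * (1 / 2) ^ k) sums (s powr (1 / p) * 2)"
    using sums_mult[OF geometric_sums[of "1 / 2 :: real"], of "s powr (1 / p)"] by simp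
  have "summable a" by (rule summable_comparison_test'[OF sums_summable[OF geo], of 0]) (use le a in auto)
  then have "(\<Sum>k. a k) \<le> s powr (1 / p) * 2"
    using le geo by (metis sums_le sums_unique summable_sums)
  moreover have "(\<Sum>k. a k) \<ge> 0" using a \<open>summable a\<close> by (intro suminf_nonneg)
  ultimately have "(\<Sum>k. a k) powr p \<le> (s powr (1 / p) * 2) powr p"
    using p by (intro powr_mono2) auto
  also have "\<dots> = 2 powr p * s" using p real by (simp add: powr_mult powr_powr)
  finally show ?thesis using real by (simp add: ennreal_mult[symmetric])
qed (simp add: ennreal_mult_top)

lemma powr_geometric_le:
  fixes x B p :: real
  assumes "x \<ge> 0" "p > 0" "B \<ge> 0" "x powr p \<le> B * (4 powr - p) ^ N"
  shows "x \<le> B powr (1 / p) * (1 / 4) ^ N"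
proof -
  have "(x powr p) powr (1 / p) \<le> (B * (4 powr - p) ^ N) powr (1 / p)"
    using assms by (intro powr_mono2) auto
  also have "(B * (4 powr - p) ^ N) powr (1 / p) = B powr (1 / p) * ((4 powr - p) ^ N) powr (1 / p)"
    by (rule powr_mult)
  also have "((4 powr - p) ^ N) powr (1 / p) = (1 / 4 :: real) ^ N"
  proof -
    have "(4 powr - p) ^ N = (4::real) powr (- p * real N)"
      by (simp add: powr_realpow[symmetric] powr_powr)
    then have "((4 powr - p) ^ N) powr (1 / p) = (4::real) powr (- real N)"
      using assms(2) by (simp add: powr_powr)
    then show ?thesis by (simp add: powr_minus powr_realpow power_divide inverse_eq_divide)
  qed
  finally show ?thesis using assms by (simp add: powr_powr)
qed

lemma norm_exp_minus_linear_le: "norm (exp x - 1 - x) \<le> exp (norm x) * (norm x)\<^sup>2" for x :: complex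
  using Taylor_exp_field[of x 1] by (simp add: power2_eq_square diff_diff_eq)

section \<open>Holomorphy of projections and completeness of the Fock space\<close>

context fock_setting
begin

text \<open>Differentiation under the integral sign. The candidate \<open>D\<close> integrates the
  derivative of the kernel; it is complex linear because \<open>hermitian\<close> is so in its first
  argument, and the remainder is of order \<open>|v|\<^sup>2\<close>.\<close>

lemma entire_fock_proj:
  fixes G :: "complex ^ 'n \<Rightarrow> complex"
  assumes Gm [measurable]: "G \<in> borel_measurable borel" and fin: "energy \<alpha> p G < \<infinity>"
  shows "entire (fock_proj \<alpha> G)"
  unfolding entire_def
proof
  fix z :: "complex ^ 'n"
  let ?e = "\<lambda>z w. exp (of_real \<alpha> * hermitian z w)"
  define D where "D v = (\<integral>w. ?e z w * (of_real \<alpha> * hermitian v w) * G w \<partial>gaussian \<alpha>)" for v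
  have xe: "x \<le> exp x" for x :: real using exp_ge_add_one_self[of x] by linarith
  have i1: "integrable (gaussian \<alpha>) (\<lambda>w. ?e y w * G w)" for y
    by (rule integrable_fock_kernel[OF assms])
  have i2: "integrable (gaussian \<alpha>) (\<lambda>w. ?e z w * (of_real \<alpha> * hermitian v w) * G w)" for v
  proof (rule integrable_gaussianI[OF _ assms, of _ "\<alpha> * norm v" "\<alpha> * norm z + 1"])
    fix w
    have "norm (?e z w * (of_real \<alpha> * hermitian v w) * G w) \<le> exp (\<alpha> * norm z * norm w) * (\<alpha> * (norm v * exp (norm w))) * norm (G w)"
      unfolding norm_mult using alpha_pos norm_hermitian_le[of v w] xe[of "norm w"] norm_exp_hermitian_le[of z w]
      by (intro mult_right_mono mult_mono) (auto intro!: order_trans[OF norm_hermitian_le] mult_left_mono)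
    also have "\<dots> = \<alpha> * norm v * exp ((\<alpha> * norm z + 1) * norm w) * norm (G w)"
      by (simp add: distrib_right exp_add)
    finally show "norm (?e z w * (of_real \<alpha> * hermitian v w) * G w) \<le> \<alpha> * norm v * exp ((\<alpha> * norm z + 1) * norm w) * norm (G w)" .
  qed (use alpha_pos in auto)
  \<comment> \<open>A majorant of the remainder divided by \<open>|v|\<^sup>2\<close>, valid for
    \<open>|v| \<le> 1\<close>. The exponent collects \<open>\<alpha> |z|\<close> from the kernel at
    \<open>z\<close>, \<open>\<alpha>\<close> from the remainder of \<open>exp\<close>, and 2 from
    \<open>|w|\<^sup>2 \<le> exp (2 |w|)\<close>.\<close>
  let ?q = "\<lambda>w. of_real (\<alpha>\<^sup>2 * exp ((\<alpha> * norm z + \<alpha> + 2) * norm w) * norm (G w)) :: complex"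
  define Q where "Q = (\<integral>w. norm (?q w) \<partial>gaussian \<alpha>)"
  have i3: "integrable (gaussian \<alpha>) (\<lambda>w. norm (?q w))"
    by (intro integrable_norm integrable_gaussianI[OF _ assms, of _ "\<alpha>\<^sup>2" "\<alpha> * norm z + \<alpha> + 2"])
      (auto simp: norm_mult norm_power)
  have lin: "linear D"
  proof (rule linearI)
    fix v w
    show "D (v + w) = D v + D w"
      unfolding D_def using i2 by (subst Bochner_Integration.integral_add[symmetric]) (auto simp: hermitian_add_left algebra_simps)
    fix r :: real
    show "D (r *\<^sub>R v) = r *\<^sub>R D v"
      unfolding D_def by (subst integral_scaleR_right[symmetric]) (auto simp: hermitian_scaleR_left algebra_simps)
  qed
  have clin: "D (c *s v) = c * D v" for c v
    unfolding D_def by (subst integral_mult_right_zero[symmetric]) (auto simp: hermitian_scale_left algebra_simps)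
  have bound: "norm (fock_proj \<alpha> G (z + v) - fock_proj \<alpha> G z - D v) \<le> Q * (norm v)\<^sup>2" if "norm v \<le> 1" for v
  proof -
    let ?r = "\<lambda>w. ?e (z + v) w * G w - ?e z w * G w - ?e z w * (of_real \<alpha> * hermitian v w) * G w"
    have "fock_proj \<alpha> G (z + v) - fock_proj \<alpha> G z - D v = (\<integral>w. ?r w \<partial>gaussian \<alpha>)"
      unfolding fock_proj_def D_def using i1 i2 by simp
    also have "norm \<dots> \<le> (\<integral>w. norm (?q w) * (norm v)\<^sup>2 \<partial>gaussian \<alpha>)"
    proof (rule Bochner_Integration.integral_norm_bound_integral)
      show "integrable (gaussian \<alpha>) ?r" using i1 i2 by simp
      show "integrable (gaussian \<alpha>) (\<lambda>w. norm (?q w) * (norm v)\<^sup>2)" using i3 by simp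
      fix w
      let ?x = "of_real \<alpha> * hermitian v w"
      have x: "norm ?x \<le> \<alpha> * (norm v * norm w)"
        using alpha_pos norm_hermitian_le[of v w] by (simp add: norm_mult mult_left_mono)
      also have "\<dots> \<le> \<alpha> * norm w" using that alpha_pos by (simp add: mult_left_le_one_le)
      finally have x1: "norm ?x \<le> \<alpha> * norm w" .
      have "(norm ?x)\<^sup>2 \<le> (\<alpha> * (norm v * norm w))\<^sup>2" using x by (intro power_mono) auto
      also have "\<dots> = \<alpha>\<^sup>2 * (norm v)\<^sup>2 * (norm w)\<^sup>2" by (simp add: power_mult_distrib)
      also have "\<dots> \<le> \<alpha>\<^sup>2 * (norm v)\<^sup>2 * (exp (norm w))\<^sup>2"
        using xe[of "norm w"] by (intro mult_left_mono power_mono) auto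
      also have "(exp (norm w))\<^sup>2 = exp (2 * norm w)" by (simp add: power2_eq_square exp_add[symmetric])
      finally have x2: "(norm ?x)\<^sup>2 \<le> \<alpha>\<^sup>2 * (norm v)\<^sup>2 * exp (2 * norm w)" .
      have "?r w = ?e z w * (exp ?x - 1 - ?x) * G w"
        by (simp add: hermitian_add_left exp_add algebra_simps)
      then have "norm (?r w) = norm (?e z w) * norm (exp ?x - 1 - ?x) * norm (G w)"
        by (simp add: norm_mult del: norm_exp_eq_Re)
      also have "\<dots> \<le> exp (\<alpha> * norm z * norm w) * (exp (\<alpha> * norm w) * (\<alpha>\<^sup>2 * (norm v)\<^sup>2 * exp (2 * norm w))) * norm (G w)"
        using x1 x2 by (intro mult_right_mono mult_mono norm_exp_hermitian_le order_trans[OF norm_exp_minus_linear_le]) auto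
      also have "\<dots> = norm (?q w) * (norm v)\<^sup>2"
        by (simp add: norm_mult norm_power distrib_right exp_add)
      finally show "norm (?r w) \<le> norm (?q w) * (norm v)\<^sup>2" .
    qed
    finally show ?thesis unfolding Q_def by (simp add: mult.commute)
  qed
  have "(fock_proj \<alpha> G has_derivative D) (at z)"
    unfolding has_derivative_at
  proof
    show "bounded_linear D" using lin by (simp add: linear_conv_bounded_linear)
    show "(\<lambda>v. norm (fock_proj \<alpha> G (z + v) - fock_proj \<alpha> G z - D v) / norm v) \<midarrow>0\<rightarrow> 0"
    proof (rule tendsto_sandwich[of "\<lambda>_. 0" _ _ "\<lambda>v. Q * norm v"])
      show "\<forall>\<^sub>F v in at 0. norm (fock_proj \<alpha> G (z + v) - fock_proj \<alpha> G z - D v) / norm v \<le> Q * norm v"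
        unfolding eventually_at
      proof (intro exI[of _ 1] conjI ballI impI)
        fix v :: "complex ^ 'n" assume v: "v \<noteq> 0 \<and> dist v 0 < 1"
        then show "norm (fock_proj \<alpha> G (z + v) - fock_proj \<alpha> G z - D v) / norm v \<le> Q * norm v"
          using bound[of v] by (simp add: divide_le_eq power2_eq_square)
      qed auto
      have "((\<lambda>v::complex ^ 'n. Q * norm v) \<longlongrightarrow> Q * norm (0 :: complex ^ 'n)) (at 0)"
        by (intro tendsto_intros)
      then show "(\<lambda>v::complex ^ 'n. Q * norm v) \<midarrow>0\<rightarrow> 0" by simp
    qed auto
  qed
  then show "\<exists>D. (fock_proj \<alpha> G has_derivative D) (at z) \<and> (\<forall>c v. D (c *s v) = c * D v)"
    using clin by blast
qed

lemma fock_proj_in_fock: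
  fixes G :: "complex ^ 'n \<Rightarrow> complex"
  assumes "G \<in> borel_measurable borel" "energy \<alpha> p G < \<infinity>"
  shows "fock_proj \<alpha> G \<in> fock \<alpha> p"
proof -
  obtain C where "energy \<alpha> p (fock_proj \<alpha> G) \<le> ennreal C * energy \<alpha> p G"
    using fock_proj_bounds assms(1) by blast
  also have "\<dots> < \<infinity>" using assms(2) by (simp add: ennreal_mult_less_top)
  finally show ?thesis unfolding fock_iff using entire_fock_proj[OF assms] by blast
qed

lemma fock_add:
  assumes "u \<in> fock \<alpha> p" "v \<in> fock \<alpha> p" shows "(\<lambda>z. u z + v z) \<in> fock \<alpha> p"
  unfolding fock_iff
  using energy_add_finite[OF fockD(3,2)[OF assms(1)] fockD(3,2)[OF assms(2)]]
    entire_add[OF fockD(1)[OF assms(1)] fockD(1)[OF assms(2)]] by (rule conjI)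

lemma fock_scale:
  assumes "u \<in> fock \<alpha> p" shows "(\<lambda>z. c * u z) \<in> fock \<alpha> p"
proof -
  have "energy \<alpha> p (\<lambda>z. c * u z) < \<infinity>"
    by (rule energy_scale_finite[OF fockD(3,2)[OF assms], of _ "norm c"]) (simp_all add: norm_mult)
  with entire_mult[OF entire_const fockD(1)[OF assms]] show ?thesis unfolding fock_iff by blast
qed

lemma fock_zero: "(\<lambda>z. 0) \<in> fock \<alpha> p"
  unfolding fock_iff by (simp add: entire_const energy_def wt_def)

lemma subspace_fock: "cfun.subspace (fock \<alpha> p)"
  unfolding cfun.subspace_def using fock_zero fock_add fock_scale
  by (auto simp: zero_fun_def plus_fun_def fscale_def)

lemma fock_sum: fixes N :: nat shows "(\<And>k. k < N \<Longrightarrow> u k \<in> fock \<alpha> p) \<Longrightarrow> (\<lambda>z. \<Sum>k<N. u k z) \<in> fock \<alpha> p"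
  by (induction N) (auto intro!: fock_zero fock_add)

text \<open>The limit is entire because it inherits \<open>fock_proj \<alpha> v = v\<close> from the partial sums.\<close>

lemma fock_complete:
  fixes u :: "nat \<Rightarrow> complex ^ 'n \<Rightarrow> complex"
  assumes u: "\<And>k. u k \<in> fock \<alpha> p" and A: "\<And>k. energy \<alpha> p (u k) \<le> ennreal (A * (4 powr - p) ^ k)" and "A \<ge> 0"
  obtains v B where "v \<in> fock \<alpha> p" "\<And>z. (\<lambda>k. u k z) sums v z" "B \<ge> 0"
    "\<And>N. energy \<alpha> p (\<lambda>z. v z - (\<Sum>k<N. u k z)) \<le> ennreal (B * (4 powr - p) ^ N)"
proof -
  have p0: "p > 0" using p_gt1 by simp
  have um [measurable]: "u k \<in> borel_measurable borel" for k using fockD(3)[OF u] .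
  obtain C where C: "C > 0" and bnd: "\<And>G::complex ^ 'n \<Rightarrow> complex. G \<in> borel_measurable borel \<Longrightarrow>
     (\<forall>z. ennreal (wt \<alpha> (fock_proj \<alpha> G) z powr p) \<le> ennreal C * energy \<alpha> p G)"
    using fock_proj_bounds by blast
  \<comment> \<open>Bounded point evaluations turn the decay of energies into pointwise geometric
    decay, hence pointwise convergence.\<close>
  have wt_u: "wt \<alpha> (u k) z \<le> (C * A) powr (1 / p) * (1 / 4) ^ k" for k z
  proof (rule powr_geometric_le)
    have "ennreal (wt \<alpha> (u k) z powr p) \<le> ennreal C * energy \<alpha> p (u k)"
      using bnd[OF um, of k] fockD(4)[OF u] by simp
    also have "\<dots> \<le> ennreal C * ennreal (A * (4 powr - p) ^ k)" by (intro mult_left_mono A) auto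
    also have "\<dots> = ennreal (C * A * (4 powr - p) ^ k)"
      using C \<open>A \<ge> 0\<close> by (simp add: ennreal_mult[symmetric] mult.assoc)
    finally show "wt \<alpha> (u k) z powr p \<le> C * A * (4 powr - p) ^ k"
      using C \<open>A \<ge> 0\<close> by simp
  qed (use C \<open>A \<ge> 0\<close> p0 in auto)
  have sm_wt: "summable (\<lambda>k. wt \<alpha> (u k) z)" for z
    by (rule summable_comparison_test'[of "\<lambda>k. (C * A) powr (1 / p) * (1 / 4) ^ k" 0])
      (use wt_u in \<open>auto intro!: summable_mult summable_geometric\<close>)
  have norm_wt: "norm (u k z) = wt \<alpha> (u k) z * exp ((\<alpha> / 2) * (norm z)\<^sup>2)" for k z
    by (simp add: wt_def mult.assoc exp_add[symmetric])
  have sm: "summable (\<lambda>k. norm (u k z))" for z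
    unfolding norm_wt by (intro summable_mult2 sm_wt)
  define v where "v z = (\<Sum>k. u k z)" for z
  have sums: "(\<lambda>k. u k z) sums v z" for z
    unfolding v_def using summable_norm_cancel[OF sm] by (rule summable_sums)
  have vm [measurable]: "v \<in> borel_measurable borel"
    unfolding v_def[abs_def] by (intro borel_measurable_suminf um)
  \<comment> \<open>The ratio that is left when the weights \<open>2 ^ k\<close> of
    \<open>suminf_powr_le\<close>, raised to the power \<open>p\<close>, meet the decay
    \<open>4 powr - p\<close>.\<close>
  define q where "q = 2 powr - p"
  have q: "0 < q" "q < 1" using p0 powr_less_one[of 2 "- p"] by (auto simp: q_def)
  define B where "B = 2 powr p * A * (1 / (1 - q))"
  have B: "B \<ge> 0" using q \<open>A \<ge> 0\<close> by (simp add: B_def)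
  have tail: "energy \<alpha> p (\<lambda>z. v z - (\<Sum>k<N. u k z)) \<le> ennreal (B * (4 powr - p) ^ N)" for N
  proof -
    have "energy \<alpha> p (\<lambda>z. v z - (\<Sum>k<N. u k z))
      \<le> (\<integral>\<^sup>+z. ennreal (2 powr p) * (\<Sum>k. ennreal ((2 ^ k * wt \<alpha> (u (k + N)) z) powr p)) \<partial>lborel)"
      unfolding energy_def
    proof (rule nn_integral_mono)
      fix z
      have sN: "summable (\<lambda>k. norm (u (k + N) z))" using sm by (rule summable_ignore_initial_segment)
      have "norm (v z - (\<Sum>k<N. u k z)) = norm (\<Sum>k. u (k + N) z)"
        unfolding v_def using suminf_minus_initial_segment[OF summable_norm_cancel[OF sm], of N] by simp
      also have "\<dots> \<le> (\<Sum>k. norm (u (k + N) z))" by (rule summable_norm[OF sN])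
      finally have "wt \<alpha> (\<lambda>z. v z - (\<Sum>k<N. u k z)) z \<le> (\<Sum>k. norm (u (k + N) z)) * exp (- (\<alpha> / 2) * (norm z)\<^sup>2)"
        unfolding wt_def by (intro mult_right_mono) auto
      also have "\<dots> = (\<Sum>k. wt \<alpha> (u (k + N)) z)"
        unfolding wt_def by (rule suminf_mult2[OF sN])
      finally have "wt \<alpha> (\<lambda>z. v z - (\<Sum>k<N. u k z)) z powr p \<le> (\<Sum>k. wt \<alpha> (u (k + N)) z) powr p"
        using p0 by (intro powr_mono2) auto
      then have "ennreal (wt \<alpha> (\<lambda>z. v z - (\<Sum>k<N. u k z)) z powr p) \<le> ennreal ((\<Sum>k. wt \<alpha> (u (k + N)) z) powr p)"
        by (rule ennreal_leI)
      also have "\<dots> \<le> ennreal (2 powr p) * (\<Sum>k. ennreal ((2 ^ k * wt \<alpha> (u (k + N)) z) powr p))"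
        by (rule suminf_powr_le) (use p0 in auto)
      finally show "ennreal (wt \<alpha> (\<lambda>z. v z - (\<Sum>k<N. u k z)) z powr p)
        \<le> ennreal (2 powr p) * (\<Sum>k. ennreal ((2 ^ k * wt \<alpha> (u (k + N)) z) powr p))" .
    qed
    also have "\<dots> = ennreal (2 powr p) * (\<Sum>k. \<integral>\<^sup>+z. ennreal ((2 ^ k * wt \<alpha> (u (k + N)) z) powr p) \<partial>lborel)"
      by (subst nn_integral_cmult, measurable, subst nn_integral_suminf) auto
    also have "(\<Sum>k. \<integral>\<^sup>+z. ennreal ((2 ^ k * wt \<alpha> (u (k + N)) z) powr p) \<partial>lborel)
      \<le> (\<Sum>k. ennreal (A * (4 powr - p) ^ N * q ^ k))"
    proof (rule suminf_le)
      fix k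
      have "(\<integral>\<^sup>+z. ennreal ((2 ^ k * wt \<alpha> (u (k + N)) z) powr p) \<partial>lborel)
        = (\<integral>\<^sup>+z. ennreal ((2 powr p) ^ k) * ennreal (wt \<alpha> (u (k + N)) z powr p) \<partial>lborel)"
      proof (rule nn_integral_cong)
        fix z
        have "(2 ^ k) powr p = (2 powr p :: real) ^ k"
          by (simp add: powr_realpow[symmetric] powr_powr mult.commute)
        then show "ennreal ((2 ^ k * wt \<alpha> (u (k + N)) z) powr p) = ennreal ((2 powr p) ^ k) * ennreal (wt \<alpha> (u (k + N)) z powr p)"
          by (simp add: powr_mult ennreal_mult)
      qed
      also have "\<dots> = ennreal ((2 powr p) ^ k) * energy \<alpha> p (u (k + N))"
        unfolding energy_def by (rule nn_integral_cmult) measurable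
      also have "\<dots> \<le> ennreal ((2 powr p) ^ k) * ennreal (A * (4 powr - p) ^ (k + N))"
        by (intro mult_left_mono A) auto
      also have "\<dots> = ennreal ((2 powr p) ^ k * (A * (4 powr - p) ^ (k + N)))"
        using \<open>A \<ge> 0\<close> by (subst ennreal_mult) auto
      also have "(2 powr p) ^ k * (A * (4 powr - p) ^ (k + N)) = A * (4 powr - p) ^ N * q ^ k"
      proof -
        have "2 powr p * 4 powr - p = q"
          using powr_mult[of 2 2 "- p"] by (simp add: q_def powr_minus field_simps)
        then have "(2 powr p) ^ k * (4 powr - p) ^ k = q ^ k" by (simp only: power_mult_distrib[symmetric])
        then show ?thesis by (simp add: power_add mult_ac)
      qed
      finally show "(\<integral>\<^sup>+z. ennreal ((2 ^ k * wt \<alpha> (u (k + N)) z) powr p) \<partial>lborel) \<le> ennreal (A * (4 powr - p) ^ N * q ^ k)" .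
    qed auto
    also have "(\<Sum>k. ennreal (A * (4 powr - p) ^ N * q ^ k)) = ennreal (A * (4 powr - p) ^ N * (1 / (1 - q)))"
      using q \<open>A \<ge> 0\<close> by (intro suminf_ennreal_eq sums_mult geometric_sums) auto
    also have "ennreal (2 powr p) * ennreal (A * (4 powr - p) ^ N * (1 / (1 - q))) = ennreal (B * (4 powr - p) ^ N)"
      using q \<open>A \<ge> 0\<close> by (simp add: B_def ennreal_mult[symmetric] mult_ac)
    finally show ?thesis by (simp add: mult_left_mono)
  qed
  have vfin: "energy \<alpha> p v < \<infinity>"
    using tail[of 0] by (simp add: le_less_trans)
  \<comment> \<open>The difference of \<open>P v\<close> and a partial sum is the projection of the
    tail, whose value at \<open>z\<close> is bounded by the energy of the tail. So the partial sums
    tend to \<open>P v\<close> as well as to \<open>v\<close>.\<close>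
  have "fock_proj \<alpha> v z = v z" for z
  proof (rule LIMSEQ_unique)
    let ?s = "\<lambda>N z. \<Sum>k<N. u k z"
    have sF: "?s N \<in> fock \<alpha> p" for N by (rule fock_sum) (rule u)
    have "wt \<alpha> (\<lambda>z. fock_proj \<alpha> v z - ?s N z) z \<le> (C * B) powr (1 / p) * (1 / 4) ^ N" for N
    proof (rule powr_geometric_le)
      have eq: "fock_proj \<alpha> (\<lambda>z. v z - ?s N z) = (\<lambda>z. fock_proj \<alpha> v z - ?s N z)"
        using fock_proj_diff[OF vm vfin fockD(3)[OF sF] fockD(2)[OF sF]] fockD(4)[OF sF] by (simp add: fun_eq_iff)
      have "(\<lambda>z. v z - ?s N z) \<in> borel_measurable borel" by measurable
      from bnd[OF this] have "ennreal (wt \<alpha> (\<lambda>z. fock_proj \<alpha> v z - ?s N z) z powr p) \<le> ennreal C * energy \<alpha> p (\<lambda>z. v z - ?s N z)"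
        unfolding eq by blast
      also have "\<dots> \<le> ennreal C * ennreal (B * (4 powr - p) ^ N)" by (intro mult_left_mono tail) auto
      also have "\<dots> = ennreal (C * B * (4 powr - p) ^ N)"
        using C B by (simp add: ennreal_mult[symmetric] mult.assoc)
      finally show "wt \<alpha> (\<lambda>z. fock_proj \<alpha> v z - ?s N z) z powr p \<le> C * B * (4 powr - p) ^ N"
        using C B by simp
    qed (use C B p0 in auto)
    then have le0: "wt \<alpha> (\<lambda>z. fock_proj \<alpha> v z - ?s N z) z * exp ((\<alpha> / 2) * (norm z)\<^sup>2)
        \<le> (C * B) powr (1 / p) * (1 / 4) ^ N * exp ((\<alpha> / 2) * (norm z)\<^sup>2)" for N
      by (intro mult_right_mono) auto
    have eq: "wt \<alpha> (\<lambda>z. fock_proj \<alpha> v z - ?s N z) z * exp ((\<alpha> / 2) * (norm z)\<^sup>2) = norm (fock_proj \<alpha> v z - ?s N z)" for N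
      by (simp add: wt_def mult.assoc exp_add[symmetric])
    have le: "norm (fock_proj \<alpha> v z - ?s N z) \<le> (C * B) powr (1 / p) * (1 / 4) ^ N * exp ((\<alpha> / 2) * (norm z)\<^sup>2)" for N
      using le0[of N] unfolding eq .
    have "(\<lambda>N. (C * B) powr (1 / p) * (1 / 4) ^ N * exp ((\<alpha> / 2) * (norm z)\<^sup>2)) \<longlonglongrightarrow> (C * B) powr (1 / p) * 0 * exp ((\<alpha> / 2) * (norm z)\<^sup>2)"
      by (intro tendsto_intros LIMSEQ_power_zero) simp
    then have lim: "(\<lambda>N. (C * B) powr (1 / p) * (1 / 4) ^ N * exp ((\<alpha> / 2) * (norm z)\<^sup>2)) \<longlonglongrightarrow> 0"
      by (simp only: mult_zero_right mult_zero_left)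
    have "(\<lambda>N. fock_proj \<alpha> v z - ?s N z) \<longlonglongrightarrow> 0"
      by (rule Lim_null_comparison[OF always_eventually lim]) (rule allI, rule le)
    from tendsto_diff[OF tendsto_const[of "fock_proj \<alpha> v z"] this] show "(\<lambda>N. ?s N z) \<longlonglongrightarrow> fock_proj \<alpha> v z" by simp
    show "(\<lambda>N. ?s N z) \<longlonglongrightarrow> v z" using sums[of z] by (simp add: sums_def)
  qed
  then have "fock_proj \<alpha> v = v" by (rule ext)
  with fock_proj_in_fock[OF vm vfin] have "v \<in> fock \<alpha> p" by simp
  then show thesis using sums B tail by (rule that)
qed

end

section \<open>Finite-rank approximation on balls\<close>

lemma power_over_fact_le_exp:
  fixes x :: real assumes "x \<ge> 0" shows "x ^ n / fact n \<le> exp x"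
proof -
  have "(\<Sum>k\<in>{n}. x ^ k /\<^sub>R fact k) \<le> (\<Sum>k. x ^ k /\<^sub>R fact k)"
    by (rule sum_le_suminf[OF summable_exp_generic]) (use assms in auto)
  then show ?thesis by (simp add: exp_def divide_inverse mult.commute)
qed

text \<open>Writing \<open>x ^ N\<close> as \<open>(1 / 2) ^ N * (2 * x) ^ N\<close> buys a
  geometric factor for a larger exponent. The 4 is the sum of 1 from the factor
  \<open>exp |x|\<close> of the remainder, 1 from an extra \<open>|x|\<close>, and 2 from
  \<open>(2 |x|) ^ N / fact N\<close>.\<close>

lemma exp_Taylor_geometric:
  "norm (exp x - (\<Sum>k\<le>N. x ^ k / fact k)) \<le> (1 / 2) ^ N * exp (4 * norm x)" for x :: complex
proof -
  have "norm (exp x - (\<Sum>k\<le>N. x ^ k / fact k)) \<le> exp (norm x) * (norm x ^ Suc N) / fact N"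
    by (rule Taylor_exp_field)
  also have "\<dots> = (1 / 2) ^ N * (exp (norm x) * norm x * ((2 * norm x) ^ N / fact N))"
    by (simp add: power_mult_distrib power_divide)
  also have "\<dots> \<le> (1 / 2) ^ N * (exp (norm x) * exp (norm x) * exp (2 * norm x))"
    using power_over_fact_le_exp[of "2 * norm x" N] order_trans[OF _ exp_ge_add_one_self[of "norm x"], of "norm x"]
    by (intro mult_left_mono mult_mono) auto
  also have "exp (norm x) * exp (norm x) * exp (2 * norm x) = exp (4 * norm x)"
    by (simp add: exp_add[symmetric])
  finally show ?thesis .
qed

lemma sum_fun_apply: "(\<Sum>i\<in>I. F i) z = (\<Sum>i\<in>I. F i z)" for F :: "'i \<Rightarrow> 'a \<Rightarrow> complex"
  by (induction I rule: infinite_finite_induct) (auto simp: zero_fun_def plus_fun_def)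

text \<open>Monomials are indexed by words of length \<open>k\<close> rather than by multi-indices:
  powers of \<open>hermitian\<close> then expand without multinomial coefficients, and repetitions
  do no harm because only a finite spanning set is wanted.\<close>

definition hmonomial :: "nat \<Rightarrow> (nat \<Rightarrow> 'n) \<Rightarrow> complex ^ 'n \<Rightarrow> complex" where
  "hmonomial k s z = (\<Prod>j<k. z $ s j)"

lemma hermitian_power:
  "hermitian z w ^ k = (\<Sum>s\<in>{..<k} \<rightarrow>\<^sub>E UNIV. hmonomial k s z * cnj (hmonomial k s w))"
proof -
  have "hermitian z w ^ k = (\<Prod>j<k. \<Sum>i\<in>UNIV. z $ i * cnj (w $ i))"
    by (simp add: hermitian_def)
  also have "\<dots> = (\<Sum>s\<in>{..<k} \<rightarrow>\<^sub>E UNIV. \<Prod>j<k. z $ s j * cnj (w $ s j))"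
    by (rule prod_sum_PiE) auto
  finally show ?thesis by (simp add: hmonomial_def prod.distrib)
qed

lemma norm_hmonomial: "norm (hmonomial k s z) \<le> norm z ^ k"
proof -
  have "norm (hmonomial k s z) = (\<Prod>j<k. norm (z $ s j))" by (simp add: hmonomial_def prod_norm)
  also have "\<dots> \<le> (\<Prod>j<k. norm z)" by (intro prod_mono) (simp add: Finite_Cartesian_Product.norm_nth_le)
  finally show ?thesis by simp
qed

lemma entire_hmonomial: "entire (hmonomial k s)"
proof (induction k)
  case (Suc k)
  have "hmonomial (Suc k) s = (\<lambda>z. hmonomial k s z * z $ s k)" by (simp add: hmonomial_def fun_eq_iff)
  then show ?case using entire_mult[OF Suc entire_coord] by simp
qed (simp add: hmonomial_def[abs_def] entire_const)

lemma borel_measurable_cnj [measurable]: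
  assumes "f \<in> borel_measurable M" shows "(\<lambda>x. cnj (f x)) \<in> borel_measurable M"
  by (rule measurable_compose[OF assms borel_measurable_continuous_onI]) (intro continuous_intros)

lemma hmonomial_measurable [measurable]: "hmonomial k s \<in> borel_measurable borel"
  by (rule entire_measurable[OF entire_hmonomial])

context fock_setting
begin

lemma hmonomial_in_fock: "hmonomial k s \<in> fock \<alpha> p"
  unfolding fock_iff
proof (intro conjI entire_hmonomial energy_exp_growth)
  fix z
  have "norm (hmonomial k s z) \<le> norm z ^ k" by (rule norm_hmonomial)
  also have "\<dots> \<le> fact k * exp (1 * norm z)"
    using power_over_fact_le_exp[of "norm z" k] by (simp add: field_simps)
  finally show "norm (hmonomial k s z) \<le> fact k * exp (1 * norm z)" .
qed

definition taylor_proj :: "nat \<Rightarrow> (complex ^ 'n \<Rightarrow> complex) \<Rightarrow> complex ^ 'n \<Rightarrow> complex" where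
  "taylor_proj N H z = (\<integral>w. (\<Sum>k\<le>N. (of_real \<alpha> * hermitian z w) ^ k / fact k) * H w \<partial>gaussian \<alpha>)"

lemma integrable_hmonomial:
  fixes H :: "complex ^ 'n \<Rightarrow> complex"
  assumes [measurable]: "H \<in> borel_measurable borel" and "energy \<alpha> p H < \<infinity>"
  shows "integrable (gaussian \<alpha>) (\<lambda>w. cnj (hmonomial k s w) * H w)"
proof (rule integrable_gaussianI[OF _ assms, of _ "fact k" 1])
  fix w :: "complex ^ 'n"
  have "norm w ^ k \<le> fact k * exp (norm w)"
    using power_over_fact_le_exp[of "norm w" k] by (simp add: field_simps)
  with norm_hmonomial[of k s w] have "norm (hmonomial k s w) \<le> fact k * exp (norm w)" by linarith
  then show "norm (cnj (hmonomial k s w) * H w) \<le> fact k * exp (1 * norm w) * norm (H w)"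
    by (simp add: norm_mult mult_right_mono)
qed auto

lemma integrable_hermitian_power:
  fixes H :: "complex ^ 'n \<Rightarrow> complex"
  assumes "H \<in> borel_measurable borel" and "energy \<alpha> p H < \<infinity>"
  shows "integrable (gaussian \<alpha>) (\<lambda>w. (of_real \<alpha> * hermitian z w) ^ k / fact k * H w)"
proof -
  have "(\<lambda>w. (of_real \<alpha> * hermitian z w) ^ k / fact k * H w)
    = (\<lambda>w. \<Sum>s\<in>{..<k} \<rightarrow>\<^sub>E UNIV. (of_real \<alpha> ^ k / fact k * hmonomial k s z) * (cnj (hmonomial k s w) * H w))"
    by (simp add: fun_eq_iff power_mult_distrib hermitian_power sum_distrib_left sum_distrib_right sum_divide_distrib mult_ac)
  then show ?thesis
    by (simp only:) (intro Bochner_Integration.integrable_sum integrable_mult_right integrable_hmonomial assms)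
qed

text \<open>\<open>hermitian_power\<close> separates \<open>z\<close> from \<open>w\<close>, so the
  integral over \<open>w\<close> produces only coefficients, the Gaussian moments of
  \<open>H\<close>.\<close>

lemma taylor_proj_span:
  fixes H :: "complex ^ 'n \<Rightarrow> complex"
  assumes "H \<in> borel_measurable borel" and "energy \<alpha> p H < \<infinity>"
  shows "taylor_proj N H \<in> cfun.span (\<Union>k\<le>N. hmonomial k ` ({..<k} \<rightarrow>\<^sub>E UNIV))"
proof -
  let ?c = "\<lambda>k s. of_real \<alpha> ^ k / fact k * (\<integral>w. cnj (hmonomial k s w) * H w \<partial>gaussian \<alpha>)"
  have "taylor_proj N H = (\<Sum>k\<le>N. \<Sum>s\<in>{..<k} \<rightarrow>\<^sub>E UNIV. fscale (?c k s) (hmonomial k s))"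
  proof
    fix z
    have "taylor_proj N H z = (\<Sum>k\<le>N. \<integral>w. (of_real \<alpha> * hermitian z w) ^ k / fact k * H w \<partial>gaussian \<alpha>)"
      unfolding taylor_proj_def sum_distrib_right
      by (intro Bochner_Integration.integral_sum integrable_hermitian_power assms)
    also have "\<dots> = (\<Sum>k\<le>N. \<Sum>s\<in>{..<k} \<rightarrow>\<^sub>E UNIV. ?c k s * hmonomial k s z)"
    proof (rule sum.cong[OF refl])
      fix k
      have "(\<integral>w. (of_real \<alpha> * hermitian z w) ^ k / fact k * H w \<partial>gaussian \<alpha>)
        = (\<integral>w. (\<Sum>s\<in>{..<k} \<rightarrow>\<^sub>E UNIV. (of_real \<alpha> ^ k / fact k * hmonomial k s z) * (cnj (hmonomial k s w) * H w)) \<partial>gaussian \<alpha>)"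
        by (simp add: power_mult_distrib hermitian_power sum_distrib_left sum_distrib_right sum_divide_distrib mult_ac)
      also have "\<dots> = (\<Sum>s\<in>{..<k} \<rightarrow>\<^sub>E UNIV. (of_real \<alpha> ^ k / fact k * hmonomial k s z) * (\<integral>w. cnj (hmonomial k s w) * H w \<partial>gaussian \<alpha>))"
        by (subst Bochner_Integration.integral_sum)
          (rule integrable_mult_right, rule integrable_hmonomial[OF assms], simp only: integral_mult_right_zero)
      finally show "(\<integral>w. (of_real \<alpha> * hermitian z w) ^ k / fact k * H w \<partial>gaussian \<alpha>)
        = (\<Sum>s\<in>{..<k} \<rightarrow>\<^sub>E UNIV. ?c k s * hmonomial k s z)"
        by (simp add: mult_ac)
    qed
    finally show "taylor_proj N H z = (\<Sum>k\<le>N. \<Sum>s\<in>{..<k} \<rightarrow>\<^sub>E UNIV. fscale (?c k s) (hmonomial k s)) z"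
      by (simp add: sum_fun_apply fscale_def)
  qed
  also have "\<dots> \<in> cfun.span (\<Union>k\<le>N. hmonomial k ` ({..<k} \<rightarrow>\<^sub>E UNIV))"
    by (intro cfun.span_sum cfun.span_scale cfun.span_base) auto
  finally show ?thesis .
qed

lemma integrable_taylor_proj:
  fixes H :: "complex ^ 'n \<Rightarrow> complex"
  assumes "H \<in> borel_measurable borel" "energy \<alpha> p H < \<infinity>"
  shows "integrable (gaussian \<alpha>) (\<lambda>w. (\<Sum>k\<le>N. (of_real \<alpha> * hermitian z w) ^ k / fact k) * H w)"
  unfolding sum_distrib_right by (intro Bochner_Integration.integrable_sum integrable_hermitian_power assms)

lemma taylor_proj_add:
  fixes G H :: "complex ^ 'n \<Rightarrow> complex"
  assumes "G \<in> borel_measurable borel" "energy \<alpha> p G < \<infinity>" "H \<in> borel_measurable borel" "energy \<alpha> p H < \<infinity>"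
  shows "taylor_proj N (\<lambda>w. G w + H w) z = taylor_proj N G z + taylor_proj N H z"
  unfolding taylor_proj_def distrib_left by (intro Bochner_Integration.integral_add integrable_taylor_proj assms)

lemma taylor_proj_scale: "taylor_proj N (\<lambda>w. c * H w) z = c * taylor_proj N H z"
  unfolding taylor_proj_def by (subst integral_mult_right_zero[symmetric]) (simp add: mult.left_commute)

text \<open>On the ball, \<open>hermitian z w\<close> is at most \<open>|R| |z|\<close> in modulus,
  so the error is \<open>(1 / 2) ^ N\<close> times a function of \<open>z\<close> of finite energy
  times the \<open>L\<^sup>1\<close> norm of \<open>H\<close>. As \<open>N\<close> is fixed before
  \<open>H\<close>, one finite-rank operator serves all \<open>H\<close>.\<close>

lemma taylor_proj_approx:
  assumes "\<epsilon> > 0"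
  shows "\<exists>N. \<forall>H :: complex ^ 'n \<Rightarrow> complex. H \<in> borel_measurable borel \<longrightarrow> energy \<alpha> p H < \<infinity> \<longrightarrow>
    (\<forall>w. norm w > R \<longrightarrow> H w = 0) \<longrightarrow>
    energy \<alpha> p (\<lambda>z. fock_proj \<alpha> H z - taylor_proj N H z) \<le> ennreal \<epsilon> * energy \<alpha> p H"
proof -
  let ?E = "\<lambda>z::complex ^ 'n. complex_of_real (exp (4 * \<alpha> * \<bar>R\<bar> * norm z))"
  obtain C where C: "C > 0" and bnd: "\<And>G::complex ^ 'n \<Rightarrow> complex. G \<in> borel_measurable borel \<Longrightarrow>
     (\<forall>z. ennreal (wt \<alpha> (fock_proj \<alpha> G) z powr p) \<le> ennreal C * energy \<alpha> p G)"
    using fock_proj_bounds by blast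
  have "energy \<alpha> p ?E < \<infinity>" by (rule energy_exp_growth[of _ 1 "4 * \<alpha> * \<bar>R\<bar>"]) simp
  then obtain e where e: "e \<ge> 0" "energy \<alpha> p ?E = ennreal e" by (cases "energy \<alpha> p ?E") auto
  have "(\<lambda>N. (2 powr - p) ^ N * (C * e)) \<longlonglongrightarrow> 0 * (C * e)"
    using p_gt1 powr_less_one[of 2 "- p"] by (intro tendsto_intros LIMSEQ_power_zero) auto
  then have "\<forall>\<^sub>F N in sequentially. (2 powr - p) ^ N * (C * e) < \<epsilon>"
    using assms by (intro order_tendstoD) auto
  then obtain N where N: "(2 powr - p) ^ N * (C * e) < \<epsilon>" unfolding eventually_sequentially by blast
  show ?thesis
  proof (intro exI[of _ N] allI impI)
    fix H :: "complex ^ 'n \<Rightarrow> complex"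
    assume Hm [measurable]: "H \<in> borel_measurable borel" and fin: "energy \<alpha> p H < \<infinity>"
      and supp: "\<forall>w. norm w > R \<longrightarrow> H w = 0"
    let ?H = "\<lambda>w. complex_of_real (norm (H w))"
    have iH: "integrable (gaussian \<alpha>) ?H"
      by (rule integrable_gaussianI[OF _ Hm fin, of _ 1 0]) auto
    \<comment> \<open>At \<open>z = 0\<close> kernel and weight are 1, so \<open>J\<close> is the
      projection of \<open>|H|\<close> evaluated there, and the pointwise bound estimates this
      \<open>L\<^sup>1\<close> norm by the energy.\<close>
    define J where "J = (\<integral>w. norm (H w) \<partial>gaussian \<alpha>)"
    have J: "J \<ge> 0" unfolding J_def by simp
    have "fock_proj \<alpha> ?H 0 = of_real J"
      unfolding fock_proj_def J_def by (simp add: hermitian_def)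
    then have "wt \<alpha> (fock_proj \<alpha> ?H) 0 = J" using J by (simp add: wt_def)
    moreover have "ennreal (wt \<alpha> (fock_proj \<alpha> ?H) 0 powr p) \<le> ennreal C * energy \<alpha> p ?H"
      using bnd[of ?H] by simp
    moreover have "energy \<alpha> p ?H = energy \<alpha> p H" by (simp add: energy_def wt_def)
    ultimately have JC: "ennreal (J powr p) \<le> ennreal C * energy \<alpha> p H" by simp
    have "energy \<alpha> p (\<lambda>z. fock_proj \<alpha> H z - taylor_proj N H z)
      \<le> ennreal (((1 / 2) ^ N * J) powr p) * energy \<alpha> p ?E"
    proof (rule energy_mono)
      fix z :: "complex ^ 'n"
      let ?T = "\<lambda>w. \<Sum>k\<le>N. (of_real \<alpha> * hermitian z w) ^ k / fact k :: complex"
      have "fock_proj \<alpha> H z - taylor_proj N H z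
        = (\<integral>w. exp (of_real \<alpha> * hermitian z w) * H w - ?T w * H w \<partial>gaussian \<alpha>)"
        unfolding fock_proj_def taylor_proj_def
        by (intro Bochner_Integration.integral_diff[symmetric] integrable_fock_kernel integrable_taylor_proj Hm fin)
      also have "norm \<dots> \<le> (\<integral>w. (1 / 2) ^ N * norm (?E z) * norm (H w) \<partial>gaussian \<alpha>)"
      proof (rule Bochner_Integration.integral_norm_bound_integral)
        show "integrable (gaussian \<alpha>) (\<lambda>w. exp (of_real \<alpha> * hermitian z w) * H w - ?T w * H w)"
          by (intro Bochner_Integration.integrable_diff integrable_fock_kernel integrable_taylor_proj Hm fin)
        show "integrable (gaussian \<alpha>) (\<lambda>w. (1 / 2) ^ N * norm (?E z) * norm (H w))"
          using integrable_norm[OF iH] by simp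
        fix w
        show "norm (exp (of_real \<alpha> * hermitian z w) * H w - ?T w * H w) \<le> (1 / 2) ^ N * norm (?E z) * norm (H w)"
        proof (cases "norm w > R")
          case False
          have "norm (of_real \<alpha> * hermitian z w) \<le> \<alpha> * (norm z * norm w)"
            using alpha_pos norm_hermitian_le[of z w] by (simp add: norm_mult mult_left_mono)
          also have "\<dots> \<le> \<alpha> * (norm z * \<bar>R\<bar>)"
            using alpha_pos False by (intro mult_left_mono) auto
          finally have x: "norm (of_real \<alpha> * hermitian z w) \<le> \<alpha> * \<bar>R\<bar> * norm z" by (simp add: mult_ac)
          have "norm (exp (of_real \<alpha> * hermitian z w) - ?T w) \<le> (1 / 2) ^ N * exp (4 * norm (of_real \<alpha> * hermitian z w))"
            by (rule exp_Taylor_geometric)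
          also have "\<dots> \<le> (1 / 2) ^ N * norm (?E z)"
            using x by (intro mult_left_mono) auto
          finally have "norm (exp (of_real \<alpha> * hermitian z w) - ?T w) * norm (H w) \<le> (1 / 2) ^ N * norm (?E z) * norm (H w)"
            by (rule mult_right_mono) simp
          then show ?thesis by (simp only: left_diff_distrib[symmetric] norm_mult)
        qed (simp add: supp)
      qed
      also have "\<dots> = (1 / 2) ^ N * J * norm (?E z)"
        unfolding J_def by (simp add: mult_ac)
      finally show "norm (fock_proj \<alpha> H z - taylor_proj N H z) \<le> (1 / 2) ^ N * J * norm (?E z)" .
    qed (use J p_gt1 in auto)
    also have "((1 / 2) ^ N * J) powr p = (2 powr - p) ^ N * J powr p"
    proof -
      have "((1 / 2 :: real) ^ N) powr p = (2 powr - p) ^ N"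
        by (simp add: powr_realpow[symmetric] powr_powr powr_minus powr_divide power_one_over[symmetric] inverse_eq_divide mult.commute)
      then show ?thesis by (simp add: powr_mult)
    qed
    also have "ennreal ((2 powr - p) ^ N * J powr p) * energy \<alpha> p ?E = ennreal ((2 powr - p) ^ N * e) * ennreal (J powr p)"
      unfolding e(2) using e(1) by (simp add: ennreal_mult[symmetric] mult_ac)
    also have "\<dots> \<le> ennreal ((2 powr - p) ^ N * e) * (ennreal C * energy \<alpha> p H)"
      by (intro mult_left_mono JC) simp
    also have "\<dots> = ennreal ((2 powr - p) ^ N * (C * e)) * energy \<alpha> p H"
      using C e(1) by (simp add: ennreal_mult mult_ac)
    also have "\<dots> \<le> ennreal \<epsilon> * energy \<alpha> p H"
      using N by (intro mult_right_mono ennreal_leI) auto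
    finally show "energy \<alpha> p (\<lambda>z. fock_proj \<alpha> H z - taylor_proj N H z) \<le> ennreal \<epsilon> * energy \<alpha> p H" .
  qed
qed

section \<open>Localisation of the kernel\<close>

text \<open>The kernel is a product of two copies of
  \<open>exp (- (\<alpha> / 4) d\<^sup>2)\<close>, \<open>d\<close> being the distance of
  \<open>z\<close> and \<open>w\<close>. One copy brings the global bound \<open>M\<close> below
  \<open>\<eta>\<close> beyond distance \<open>L\<close>; the other survives as convolution kernel.
  Since \<open>z\<close> is fixed, \<open>G\<close> may depend on \<open>z\<close>.\<close>

lemma wt_proj_local:
  fixes G u :: "complex ^ 'n \<Rightarrow> complex"
  assumes Gm [measurable]: "G \<in> borel_measurable borel" and um [measurable]: "u \<in> borel_measurable borel"
    and near: "\<And>w. norm (z - w) \<le> L \<Longrightarrow> norm (G w) \<le> \<eta> * norm (u w)"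
    and far: "\<And>w. norm (G w) \<le> M * norm (u w)"
    and L: "L \<ge> 0" "M * exp (- (\<alpha> / 4) * L\<^sup>2) \<le> \<eta>" and "\<eta> \<ge> 0"
  shows "ennreal (wt \<alpha> (fock_proj \<alpha> G) z) \<le> ennreal ((\<alpha> / pi) ^ CARD('n) * \<eta>) *
    (\<integral>\<^sup>+w. ennreal (exp (- (\<alpha> / 4) * (norm (z - w))\<^sup>2) * wt \<alpha> u w) \<partial>lborel)"
proof -
  have "exp (- (\<alpha> / 2) * (norm (z - w))\<^sup>2) * wt \<alpha> G w \<le> \<eta> * (exp (- (\<alpha> / 4) * (norm (z - w))\<^sup>2) * wt \<alpha> u w)" for w
  proof -
    let ?d = "norm (z - w)"
    have half: "exp (- (\<alpha> / 2) * ?d\<^sup>2) = exp (- (\<alpha> / 4) * ?d\<^sup>2) * exp (- (\<alpha> / 4) * ?d\<^sup>2)"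
      unfolding exp_add[symmetric] by simp
    have "exp (- (\<alpha> / 4) * ?d\<^sup>2) * norm (G w) \<le> \<eta> * norm (u w)"
    proof (cases "?d \<le> L")
      case True
      have "exp (- (\<alpha> / 4) * ?d\<^sup>2) * norm (G w) \<le> norm (G w)"
        using alpha_pos by (intro mult_left_le_one_le) auto
      with near[OF True] show ?thesis by simp
    next
      case False
      then have "L\<^sup>2 \<le> ?d\<^sup>2" using L by (intro power_mono) auto
      then have ex: "exp (- (\<alpha> / 4) * ?d\<^sup>2) \<le> exp (- (\<alpha> / 4) * L\<^sup>2)" using alpha_pos by simp
      have "exp (- (\<alpha> / 4) * ?d\<^sup>2) * norm (G w) \<le> exp (- (\<alpha> / 4) * L\<^sup>2) * (M * norm (u w))"
        using ex far[of w] by (intro mult_mono) auto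
      also have "\<dots> = (M * exp (- (\<alpha> / 4) * L\<^sup>2)) * norm (u w)" by (simp only: mult_ac)
      also have "\<dots> \<le> \<eta> * norm (u w)" by (intro mult_right_mono L) auto
      finally show ?thesis .
    qed
    then have "exp (- (\<alpha> / 4) * ?d\<^sup>2) * exp (- (\<alpha> / 2) * (norm w)\<^sup>2) * (exp (- (\<alpha> / 4) * ?d\<^sup>2) * norm (G w))
      \<le> exp (- (\<alpha> / 4) * ?d\<^sup>2) * exp (- (\<alpha> / 2) * (norm w)\<^sup>2) * (\<eta> * norm (u w))"
      by (rule mult_left_mono) simp
    then show ?thesis unfolding wt_def half by (simp only: mult_ac)
  qed
  note le = this
  have "ennreal (wt \<alpha> (fock_proj \<alpha> G) z) \<le> ennreal ((\<alpha> / pi) ^ CARD('n)) *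
    (\<integral>\<^sup>+w. ennreal (exp (- (\<alpha> / 2) * (norm (z - w))\<^sup>2) * wt \<alpha> G w) \<partial>lborel)"
    by (rule wt_fock_proj_le[OF Gm alpha_pos])
  also have "\<dots> \<le> ennreal ((\<alpha> / pi) ^ CARD('n)) *
    (\<integral>\<^sup>+w. ennreal \<eta> * ennreal (exp (- (\<alpha> / 4) * (norm (z - w))\<^sup>2) * wt \<alpha> u w) \<partial>lborel)"
    using le \<open>\<eta> \<ge> 0\<close> by (intro mult_left_mono nn_integral_mono) (simp_all only: ennreal_mult[symmetric] ennreal_leI mult_nonneg_nonneg exp_ge_zero wt_nonneg zero_le)
  also have "\<dots> = ennreal ((\<alpha> / pi) ^ CARD('n)) * (ennreal \<eta> *
    (\<integral>\<^sup>+w. ennreal (exp (- (\<alpha> / 4) * (norm (z - w))\<^sup>2) * wt \<alpha> u w) \<partial>lborel))"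
    by (subst nn_integral_cmult, measurable)
  also have "\<dots> = ennreal ((\<alpha> / pi) ^ CARD('n) * \<eta>) *
    (\<integral>\<^sup>+w. ennreal (exp (- (\<alpha> / 4) * (norm (z - w))\<^sup>2) * wt \<alpha> u w) \<partial>lborel)"
    using \<open>\<eta> \<ge> 0\<close> alpha_pos by (simp add: ennreal_mult mult.assoc)
  finally show ?thesis .
qed

text \<open>This is \<open>x exp (- x) \<le> 1\<close> at \<open>x = M / \<eta>\<close>, with
  \<open>L\<close> solving \<open>(\<alpha> / 4) L\<^sup>2 = x\<close>.\<close>

lemma gaussian_tail_small:
  assumes "\<eta> > 0" "M \<ge> 0"
  obtains L where "L \<ge> 0" "M * exp (- (\<alpha> / 4) * L\<^sup>2) \<le> \<eta>"
proof -
  define x where "x = M / \<eta>"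
  define L where "L = sqrt (4 / \<alpha> * x)"
  have x: "x \<ge> 0" using assms by (simp add: x_def)
  have L: "L \<ge> 0" "(\<alpha> / 4) * L\<^sup>2 = x" using x alpha_pos by (auto simp: L_def)
  have "x \<le> exp x" using exp_ge_add_one_self[of x] by linarith
  then have "x * exp (- x) \<le> 1" by (simp add: exp_minus field_simps)
  then have "\<eta> * (x * exp (- x)) \<le> \<eta> * 1" using assms by (intro mult_left_mono) auto
  then have "M * exp (- x) \<le> \<eta>" using assms by (simp add: x_def)
  with L that show thesis by (metis mult_minus_left)
qed

end

section \<open>Toeplitz operators with slowly oscillating symbols\<close>

definition slowly_oscillating :: "(complex ^ 'n \<Rightarrow> complex) \<Rightarrow> bool" where
  "slowly_oscillating h \<longleftrightarrow>
    (\<forall>\<epsilon>>0. \<forall>L. \<exists>R. \<forall>z w. norm z > R \<longrightarrow> norm (z - w) \<le> L \<longrightarrow> norm (h z - h w) \<le> \<epsilon>)"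

definition bounded_symbol :: "real \<Rightarrow> (complex ^ 'n \<Rightarrow> complex) \<Rightarrow> bool" where
  "bounded_symbol M h \<longleftrightarrow> h \<in> borel_measurable borel \<and> M \<ge> 0 \<and> (\<forall>w. norm (h w) \<le> M)"

context fock_setting
begin

lemma symbol_mult:
  assumes h: "bounded_symbol M h" and u: "u \<in> fock \<alpha> p"
  shows "(\<lambda>w. h w * u w) \<in> borel_measurable borel"
    and "energy \<alpha> p (\<lambda>w. h w * u w) \<le> ennreal (M powr p) * energy \<alpha> p u"
    and "energy \<alpha> p (\<lambda>w. h w * u w) < \<infinity>"
proof -
  have [measurable]: "h \<in> borel_measurable borel" "u \<in> borel_measurable borel"
    using h u by (auto simp: bounded_symbol_def dest: fockD(3))
  show "(\<lambda>w. h w * u w) \<in> borel_measurable borel" by measurable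
  have le: "norm (h w * u w) \<le> M * norm (u w)" for w
    using h by (simp add: norm_mult bounded_symbol_def mult_right_mono)
  have M: "M \<ge> 0" using h by (simp add: bounded_symbol_def)
  show "energy \<alpha> p (\<lambda>w. h w * u w) \<le> ennreal (M powr p) * energy \<alpha> p u"
    by (rule energy_mono) (use le M p_gt1 in auto)
  show "energy \<alpha> p (\<lambda>w. h w * u w) < \<infinity>"
    by (rule energy_scale_finite[OF fockD(3,2)[OF u] le M])
qed

lemma toeplitz_in_fock: "bounded_symbol M h \<Longrightarrow> u \<in> fock \<alpha> p \<Longrightarrow> toeplitz \<alpha> h u \<in> fock \<alpha> p"
  unfolding toeplitz_def by (rule fock_proj_in_fock[OF symbol_mult(1,3)])

lemma toeplitz_add:
  assumes "bounded_symbol M h" "u \<in> fock \<alpha> p" "v \<in> fock \<alpha> p"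
  shows "toeplitz \<alpha> h (\<lambda>z. u z + v z) z = toeplitz \<alpha> h u z + toeplitz \<alpha> h v z"
  unfolding toeplitz_def distrib_left
  by (rule fock_proj_add[OF symbol_mult(1,3)[OF assms(1,2)] symbol_mult(1,3)[OF assms(1,3)]])

lemma toeplitz_scale: "toeplitz \<alpha> h (\<lambda>z. c * u z) z = c * toeplitz \<alpha> h u z"
  unfolding toeplitz_def using fock_proj_scale[of c "\<lambda>w. h w * u w" z] by (simp add: mult.left_commute)

lemma toeplitz_energy:
  fixes h :: "complex ^ 'n \<Rightarrow> complex"
  assumes "bounded_symbol M h"
  shows "\<exists>C>0. \<forall>u\<in>fock \<alpha> p. energy \<alpha> p (toeplitz \<alpha> h u) \<le> ennreal C * energy \<alpha> p u"
proof -
  obtain C where C: "C > 0" and bnd: "\<And>G::complex ^ 'n \<Rightarrow> complex. G \<in> borel_measurable borel \<Longrightarrow>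
     energy \<alpha> p (fock_proj \<alpha> G) \<le> ennreal C * energy \<alpha> p G"
    using fock_proj_bounds by blast
  show ?thesis
  proof (intro exI[of _ "C * (M powr p + 1)"] conjI ballI)
    show "C * (M powr p + 1) > 0" using C by (intro mult_pos_pos add_nonneg_pos) auto
    fix u :: "complex ^ 'n \<Rightarrow> complex" assume u: "u \<in> fock \<alpha> p"
    have "energy \<alpha> p (toeplitz \<alpha> h u) \<le> ennreal C * energy \<alpha> p (\<lambda>w. h w * u w)"
      unfolding toeplitz_def by (rule bnd[OF symbol_mult(1)[OF assms u]])
    also have "\<dots> \<le> ennreal C * (ennreal (M powr p) * energy \<alpha> p u)"
      by (intro mult_left_mono symbol_mult(2)[OF assms u]) simp
    also have "\<dots> = ennreal (C * M powr p) * energy \<alpha> p u"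
      using C by (simp add: ennreal_mult mult.assoc)
    also have "\<dots> \<le> ennreal (C * (M powr p + 1)) * energy \<alpha> p u"
      using C by (intro mult_right_mono ennreal_leI) auto
    finally show "energy \<alpha> p (toeplitz \<alpha> h u) \<le> ennreal (C * (M powr p + 1)) * energy \<alpha> p u" .
  qed
qed

text \<open>For the projection evaluated at \<open>z\<close> the number \<open>h z\<close> is a
  constant, and \<open>P u = u\<close>; so the commutator at \<open>z\<close> is the value there of
  the projection of \<open>(h - h z) u\<close>. This symbol is small near \<open>z\<close> and at
  most \<open>2 * M\<close> elsewhere. The lower bound \<open>R0\<close> allows the radius to exceed
  one beyond which \<open>g h = 1\<close>.\<close>

lemma commutator_small:
  fixes h :: "complex ^ 'n \<Rightarrow> complex"
  assumes h: "bounded_symbol M h" and osc: "slowly_oscillating h" and "\<epsilon> > 0"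
  shows "\<exists>R\<ge>R0. \<forall>u\<in>fock \<alpha> p.
    energy \<alpha> p (\<lambda>z. if norm z > R then toeplitz \<alpha> h u z - h z * u z else 0) \<le> ennreal \<epsilon> * energy \<alpha> p u"
proof -
  let ?m = "gauss_mass TYPE(complex ^ 'n) (\<alpha> / 4)"
  let ?a = "(\<alpha> / pi) ^ CARD('n)"
  have [measurable]: "h \<in> borel_measurable borel" and M: "M \<ge> 0" "\<And>w. norm (h w) \<le> M"
    using h by (auto simp: bounded_symbol_def)
  have m: "?m \<ge> 0" using alpha_pos by (intro gauss_mass_nonneg) simp
  have a: "?a > 0" using alpha_pos by simp
  \<comment> \<open>Solves \<open>(c * (?m + 1)) powr p = \<epsilon> / (?m + 1)\<close>, so that
    even with the factor \<open>?m\<close> from \<open>gauss_schur\<close> the bound stays below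
    \<open>\<epsilon>\<close>.\<close>
  define c where "c = (\<epsilon> / (?m + 1)) powr (1 / p) / (?m + 1)"
  have "\<epsilon> / (?m + 1) > 0" using m \<open>\<epsilon> > 0\<close> by simp
  then have c: "c > 0" using m unfolding c_def by (intro divide_pos_pos) (auto simp del: divide_eq_0_iff)
  have cm: "(c * (?m + 1)) powr p * ?m \<le> \<epsilon>"
  proof -
    have "c * (?m + 1) = (\<epsilon> / (?m + 1)) powr (1 / p)" using m by (simp add: c_def)
    then have "(c * (?m + 1)) powr p = \<epsilon> / (?m + 1)"
      using p_gt1 m \<open>\<epsilon> > 0\<close> by (simp add: powr_powr)
    then have "(c * (?m + 1)) powr p * ?m = \<epsilon> * (?m / (?m + 1))" by simp
    also have "\<dots> \<le> \<epsilon> * 1" using m \<open>\<epsilon> > 0\<close> by (intro mult_left_mono) (auto simp: divide_le_eq)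
    finally show ?thesis by simp
  qed
  define \<eta> where "\<eta> = c / ?a"
  have \<eta>: "\<eta> > 0" using c a by (simp add: \<eta>_def)
  have aeta: "?a * \<eta> = c" using a alpha_pos by (simp add: \<eta>_def)
  obtain L where L: "L \<ge> 0" "2 * M * exp (- (\<alpha> / 4) * L\<^sup>2) \<le> \<eta>"
    using gaussian_tail_small[OF \<eta>, of "2 * M"] M(1) by auto
  obtain R1 where R1: "\<And>z w. norm z > R1 \<Longrightarrow> norm (z - w) \<le> L \<Longrightarrow> norm (h z - h w) \<le> \<eta>"
    using osc \<eta> unfolding slowly_oscillating_def by metis
  show ?thesis
  proof (intro exI[of _ "max R0 R1"] conjI ballI)
    fix u :: "complex ^ 'n \<Rightarrow> complex" assume u: "u \<in> fock \<alpha> p"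
    have um [measurable]: "u \<in> borel_measurable borel" using fockD(3)[OF u] .
    let ?K = "\<lambda>z. if norm z > max R0 R1 then toeplitz \<alpha> h u z - h z * u z else 0"
    have loc: "ennreal (wt \<alpha> ?K z) \<le> ennreal c *
        (\<integral>\<^sup>+w. ennreal (exp (- (\<alpha> / 4) * (norm (z - w))\<^sup>2) * wt \<alpha> u w) \<partial>lborel)" for z
    proof (cases "norm z > max R0 R1")
      case True
      let ?G = "\<lambda>w. (h w - h z) * u w"
      have zfin: "(\<lambda>w. h z * u w) \<in> borel_measurable borel" "energy \<alpha> p (\<lambda>w. h z * u w) < \<infinity>"
        using fockD(3,2)[OF fock_scale[OF u, of "h z"]] by auto
      have "fock_proj \<alpha> ?G z = fock_proj \<alpha> (\<lambda>w. h w * u w) z - fock_proj \<alpha> (\<lambda>w. h z * u w) z"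
        unfolding left_diff_distrib by (rule fock_proj_diff[OF symbol_mult(1,3)[OF h u] zfin])
      also have "\<dots> = ?K z"
        using True fockD(4)[OF u] by (simp add: fock_proj_scale toeplitz_def)
      finally have "wt \<alpha> ?K z = wt \<alpha> (fock_proj \<alpha> ?G) z" by (simp only: wt_def)
      moreover have "ennreal (wt \<alpha> (fock_proj \<alpha> ?G) z) \<le> ennreal (?a * \<eta>) *
        (\<integral>\<^sup>+w. ennreal (exp (- (\<alpha> / 4) * (norm (z - w))\<^sup>2) * wt \<alpha> u w) \<partial>lborel)"
      proof (rule wt_proj_local[OF _ _ _ _ L])
        show "norm (?G w) \<le> \<eta> * norm (u w)" if "norm (z - w) \<le> L" for w
          using R1[OF _ that] True by (simp add: norm_mult norm_minus_commute mult_right_mono)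
        show "norm (?G w) \<le> 2 * M * norm (u w)" for w
          unfolding norm_mult using norm_triangle_ineq4[of "h w" "h z"] M(2)[of w] M(2)[of z]
          by (intro mult_right_mono) auto
      qed (use \<eta> in auto)
      ultimately show ?thesis unfolding aeta by (simp only:)
    qed (auto simp: wt_def)
    have "energy \<alpha> p ?K \<le> ennreal ((c * (?m + 1)) powr p * ?m) * energy \<alpha> p u"
      unfolding energy_def using alpha_pos p_gt1 c loc by (intro gauss_schur) auto
    also have "\<dots> \<le> ennreal \<epsilon> * energy \<alpha> p u"
      using cm by (intro mult_right_mono ennreal_leI) auto
    finally show "energy \<alpha> p ?K \<le> ennreal \<epsilon> * energy \<alpha> p u" .
  qed simp
qed

lemma energy_add_le:
  assumes "u \<in> borel_measurable borel" "v \<in> borel_measurable borel"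
    and "energy \<alpha> p u \<le> ennreal a * e" "energy \<alpha> p v \<le> ennreal b * e" "a \<ge> 0" "b \<ge> 0"
  shows "energy \<alpha> p (\<lambda>z. u z + v z) \<le> ennreal (2 powr p * (a + b)) * e"
proof -
  have "energy \<alpha> p (\<lambda>z. u z + v z) \<le> ennreal (2 powr p) * (energy \<alpha> p u + energy \<alpha> p v)"
    using assms p_gt1 by (intro energy_add) auto
  also have "\<dots> \<le> ennreal (2 powr p) * (ennreal a * e + ennreal b * e)"
    by (intro mult_left_mono add_mono assms) simp
  also have "\<dots> = ennreal (2 powr p * (a + b)) * e"
    using assms(5,6) by (simp add: ennreal_mult ennreal_plus distrib_right mult.assoc distrib_left)
  finally show ?thesis .
qed

text \<open>\<open>T\<^sub>g T\<^sub>h u - u\<close> is the projection of \<open>g T\<^sub>h u - u\<close>, which equals \<open>g (T\<^sub>h u - h u)\<close> where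
  \<open>g h = 1\<close>.\<close>

lemma toeplitz_parametrix:
  fixes g h :: "complex ^ 'n \<Rightarrow> complex"
  assumes g: "bounded_symbol Mg g" and h: "bounded_symbol M h" and osc: "slowly_oscillating h"
    and inv: "\<forall>z. norm z > R0 \<longrightarrow> g z * h z = 1" and "\<epsilon> > 0"
  shows "\<exists>F B. finite B \<and> B \<subseteq> fock \<alpha> p \<and> (\<forall>u\<in>fock \<alpha> p. F u \<in> cfun.span B) \<and>
    (\<forall>u\<in>fock \<alpha> p. \<forall>v\<in>fock \<alpha> p. F (u + v) = F u + F v) \<and>
    (\<forall>c. \<forall>u\<in>fock \<alpha> p. F (fscale c u) = fscale c (F u)) \<and>
    (\<forall>u\<in>fock \<alpha> p. energy \<alpha> p (\<lambda>z. toeplitz \<alpha> g (toeplitz \<alpha> h u) z - u z - F u z) \<le> ennreal \<epsilon> * energy \<alpha> p u)"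
proof -
  have gm [measurable]: "g \<in> borel_measurable borel" and Mg: "Mg \<ge> 0" "\<And>w. norm (g w) \<le> Mg"
    using g by (auto simp: bounded_symbol_def)
  obtain C where C: "C > 0" and bnd: "\<And>G::complex ^ 'n \<Rightarrow> complex. G \<in> borel_measurable borel \<Longrightarrow>
     energy \<alpha> p (fock_proj \<alpha> G) \<le> ennreal C * energy \<alpha> p G"
    using fock_proj_bounds by blast
  obtain CT where CT: "CT > 0" "\<And>u. u \<in> fock \<alpha> p \<Longrightarrow> energy \<alpha> p (toeplitz \<alpha> h u) \<le> ennreal CT * energy \<alpha> p u"
    using toeplitz_energy[OF h] by blast
  define C1 where "C1 = 2 powr p * (Mg powr p * CT + 1)"
  have C1: "C1 > 0" unfolding C1_def using CT(1) by (intro mult_pos_pos add_nonneg_pos) auto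
  \<comment> \<open>The final error consists of two parts of size \<open>\<delta>\<close>, which
    \<open>energy_add_le\<close> combines to
    \<open>2 powr p * (\<delta> + \<delta>)\<close>.\<close>
  define \<delta> where "\<delta> = \<epsilon> / (2 powr p * 2)"
  have \<delta>: "\<delta> > 0" using \<open>\<epsilon> > 0\<close> by (simp add: \<delta>_def)
  \<comment> \<open>Outside the ball the commutator is multiplied by \<open>g\<close> and then
    projected, which costs \<open>Mg powr p\<close> and \<open>C\<close>; the summand 1 keeps the
    divisor positive.\<close>
  define \<epsilon>1 where "\<epsilon>1 = \<delta> / (C * (Mg powr p + 1))"
  have pos: "C * (Mg powr p + 1) > 0" using C by (intro mult_pos_pos add_nonneg_pos) auto
  have \<epsilon>1: "\<epsilon>1 > 0" using pos \<delta> by (simp add: \<epsilon>1_def)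
  obtain R where R: "R \<ge> R0" and com: "\<And>u. u \<in> fock \<alpha> p \<Longrightarrow>
    energy \<alpha> p (\<lambda>z. if norm z > R then toeplitz \<alpha> h u z - h z * u z else 0) \<le> ennreal \<epsilon>1 * energy \<alpha> p u"
    using commutator_small[OF h osc \<epsilon>1] by blast
  have "\<delta> / C1 > 0" using \<delta> C1 by simp
  \<comment> \<open>The tolerance is divided by \<open>C1\<close> because the function to be
    projected has up to \<open>C1\<close> times the energy of \<open>u\<close>.\<close>
  from taylor_proj_approx[OF this, where 'n='n, of R] obtain N where
    approx: "\<And>H :: complex ^ 'n \<Rightarrow> complex. H \<in> borel_measurable borel \<Longrightarrow> energy \<alpha> p H < \<infinity> \<Longrightarrow>
      (\<forall>w. norm w > R \<longrightarrow> H w = 0) \<Longrightarrow>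
      energy \<alpha> p (\<lambda>z. fock_proj \<alpha> H z - taylor_proj N H z) \<le> ennreal (\<delta> / C1) * energy \<alpha> p H"
    by blast
  \<comment> \<open>A sharp cut-off splits \<open>H u\<close>: the projection of the inner part is
    replaced by the Taylor projection \<open>F u\<close>, the outer part is controlled by the
    commutator.\<close>
  define cut where "cut w = (if norm w \<le> R then 1 else (0 :: complex))" for w :: "complex ^ 'n"
  have [measurable]: "cut \<in> borel_measurable borel" unfolding cut_def[abs_def] by measurable
  define H where "H u w = g w * toeplitz \<alpha> h u w - u w" for u w
  define F where "F u = taylor_proj N (\<lambda>w. cut w * H u w)" for u
  define B where "B = (\<Union>k\<le>N. hmonomial k ` ({..<k} \<rightarrow>\<^sub>E (UNIV :: 'n set)))"
  have B: "finite B" "B \<subseteq> fock \<alpha> p"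
    unfolding B_def by (auto intro!: finite_PiE hmonomial_in_fock)
  have Hm [measurable]: "H u \<in> borel_measurable borel" if "u \<in> fock \<alpha> p" for u
  proof -
    have [measurable]: "u \<in> borel_measurable borel" "toeplitz \<alpha> h u \<in> borel_measurable borel"
      using that fockD(3) toeplitz_in_fock[OF h] by blast+
    show ?thesis unfolding H_def[abs_def] by measurable
  qed
  have He: "energy \<alpha> p (H u) \<le> ennreal C1 * energy \<alpha> p u" if u: "u \<in> fock \<alpha> p" for u
  proof -
    note T = toeplitz_in_fock[OF h u]
    have "energy \<alpha> p (\<lambda>w. g w * toeplitz \<alpha> h u w) \<le> ennreal (Mg powr p) * energy \<alpha> p (toeplitz \<alpha> h u)"
      by (rule symbol_mult(2)[OF g T])
    also have "\<dots> \<le> ennreal (Mg powr p) * (ennreal CT * energy \<alpha> p u)"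
      by (intro mult_left_mono CT u) simp
    finally have 1: "energy \<alpha> p (\<lambda>w. g w * toeplitz \<alpha> h u w) \<le> ennreal (Mg powr p * CT) * energy \<alpha> p u"
      using CT(1) by (simp add: ennreal_mult mult.assoc)
    have 2: "energy \<alpha> p (\<lambda>w. - u w) \<le> ennreal 1 * energy \<alpha> p u"
      by (simp add: energy_def wt_def)
    have "energy \<alpha> p (\<lambda>w. g w * toeplitz \<alpha> h u w + - u w) \<le> ennreal C1 * energy \<alpha> p u"
      unfolding C1_def using symbol_mult(1)[OF g T] fockD(3)[OF u] 1 2 CT(1) by (intro energy_add_le) auto
    then show ?thesis by (simp add: H_def[abs_def])
  qed
  have Hfin: "energy \<alpha> p (H u) < \<infinity>" if u: "u \<in> fock \<alpha> p" for u
    using He[OF u] fockD(2)[OF u] by (auto simp: ennreal_mult_less_top intro: le_less_trans)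
  have cutH: "(\<lambda>w. cut w * H u w) \<in> borel_measurable borel" "energy \<alpha> p (\<lambda>w. cut w * H u w) < \<infinity>"
    "energy \<alpha> p (\<lambda>w. cut w * H u w) \<le> ennreal C1 * energy \<alpha> p u" if u: "u \<in> fock \<alpha> p" for u
  proof -
    show "(\<lambda>w. cut w * H u w) \<in> borel_measurable borel" using Hm[OF u] by measurable
    have le: "norm (cut w * H u w) \<le> 1 * norm (H u w)" for w by (simp add: cut_def norm_mult)
    show "energy \<alpha> p (\<lambda>w. cut w * H u w) < \<infinity>" by (rule energy_scale_finite[OF Hm[OF u] Hfin[OF u] le]) simp
    have "energy \<alpha> p (\<lambda>w. cut w * H u w) \<le> ennreal (1 powr p) * energy \<alpha> p (H u)"
      by (rule energy_mono[OF Hm[OF u] le]) (use p_gt1 in auto)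
    with He[OF u] show "energy \<alpha> p (\<lambda>w. cut w * H u w) \<le> ennreal C1 * energy \<alpha> p u" by simp
  qed
  have outer: "(\<lambda>w. (1 - cut w) * H u w) \<in> borel_measurable borel" "energy \<alpha> p (\<lambda>w. (1 - cut w) * H u w) < \<infinity>"
    "energy \<alpha> p (\<lambda>w. (1 - cut w) * H u w) \<le> ennreal (Mg powr p * \<epsilon>1) * energy \<alpha> p u" if u: "u \<in> fock \<alpha> p" for u
  proof -
    let ?K = "\<lambda>z. if norm z > R then toeplitz \<alpha> h u z - h z * u z else 0"
    have [measurable]: "h \<in> borel_measurable borel" "u \<in> borel_measurable borel" "toeplitz \<alpha> h u \<in> borel_measurable borel"
      using h fockD(3)[OF u] fockD(3)[OF toeplitz_in_fock[OF h u]] by (auto simp: bounded_symbol_def)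
    have Km: "?K \<in> borel_measurable borel" by measurable
    show "(\<lambda>w. (1 - cut w) * H u w) \<in> borel_measurable borel" using Hm[OF u] by measurable
    have le1: "norm ((1 - cut w) * H u w) \<le> 1 * norm (H u w)" for w by (simp add: cut_def norm_mult)
    show "energy \<alpha> p (\<lambda>w. (1 - cut w) * H u w) < \<infinity>" by (rule energy_scale_finite[OF Hm[OF u] Hfin[OF u] le1]) simp
    have le: "norm ((1 - cut w) * H u w) \<le> Mg * norm (?K w)" for w
    proof (cases "norm w > R")
      case True
      then have "g w * h w = 1" using inv R by auto
      then have "H u w = g w * ?K w"
        using True by (simp add: H_def right_diff_distrib mult.assoc[symmetric])
      then show ?thesis using True Mg(2)[of w] by (simp add: cut_def norm_mult mult_right_mono)
    qed (simp add: cut_def)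
    have "energy \<alpha> p (\<lambda>w. (1 - cut w) * H u w) \<le> ennreal (Mg powr p) * energy \<alpha> p ?K"
      by (rule energy_mono[OF Km le]) (use p_gt1 Mg in auto)
    also have "\<dots> \<le> ennreal (Mg powr p) * (ennreal \<epsilon>1 * energy \<alpha> p u)"
      by (intro mult_left_mono com u) simp
    finally show "energy \<alpha> p (\<lambda>w. (1 - cut w) * H u w) \<le> ennreal (Mg powr p * \<epsilon>1) * energy \<alpha> p u"
      using \<epsilon>1 by (simp add: ennreal_mult mult.assoc)
  qed
  show ?thesis
  proof (intro exI[of _ F] exI[of _ B] conjI ballI allI B)
    fix u :: "complex ^ 'n \<Rightarrow> complex" assume u: "u \<in> fock \<alpha> p"
    show "F u \<in> cfun.span B" unfolding F_def B_def by (rule taylor_proj_span[OF cutH(1,2)[OF u]])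
    { fix v :: "complex ^ 'n \<Rightarrow> complex" assume v: "v \<in> fock \<alpha> p"
      have "H (u + v) w = H u w + H v w" for w
        using toeplitz_add[OF h u v, of w] by (simp add: H_def plus_fun_def algebra_simps)
      then have "(\<lambda>w. cut w * H (u + v) w) = (\<lambda>w. cut w * H u w + cut w * H v w)" by (simp add: distrib_left)
      then show "F (u + v) = F u + F v"
        unfolding F_def by (simp add: fun_eq_iff taylor_proj_add[OF cutH(1,2)[OF u] cutH(1,2)[OF v]]) }
    { fix c
      have "H (fscale c u) w = c * H u w" for w
        using toeplitz_scale[of h c u w] by (simp add: H_def fscale_def algebra_simps)
      then have "(\<lambda>w. cut w * H (fscale c u) w) = (\<lambda>w. c * (cut w * H u w))" by (simp add: mult.left_commute)
      then have "F (fscale c u) = taylor_proj N (\<lambda>w. c * (cut w * H u w))" by (simp only: F_def)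
      then show "F (fscale c u) = fscale c (F u)"
        unfolding F_def by (simp add: taylor_proj_scale fscale_def fun_eq_iff del: mult_cancel_left) }
    let ?A = "\<lambda>z. fock_proj \<alpha> (\<lambda>w. cut w * H u w) z - F u z"
    let ?D = "fock_proj \<alpha> (\<lambda>w. (1 - cut w) * H u w)"
    have eq: "toeplitz \<alpha> g (toeplitz \<alpha> h u) z - u z - F u z = ?A z + ?D z" for z
    proof -
      note T = toeplitz_in_fock[OF h u]
      have "fock_proj \<alpha> (H u) z = toeplitz \<alpha> g (toeplitz \<alpha> h u) z - u z"
        unfolding H_def[abs_def]
        using fock_proj_diff[OF symbol_mult(1,3)[OF g T] fockD(3,2)[OF u], of z] fockD(4)[OF u]
        by (simp add: toeplitz_def)
      moreover have "fock_proj \<alpha> (\<lambda>w. cut w * H u w + (1 - cut w) * H u w) z = fock_proj \<alpha> (\<lambda>w. cut w * H u w) z + ?D z"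
        by (rule fock_proj_add[OF cutH(1,2)[OF u] outer(1,2)[OF u]])
      moreover have "(\<lambda>w. cut w * H u w + (1 - cut w) * H u w) = H u" by (simp add: fun_eq_iff algebra_simps)
      ultimately show ?thesis by simp
    qed
    have A: "energy \<alpha> p ?A \<le> ennreal \<delta> * energy \<alpha> p u"
    proof -
      have "energy \<alpha> p ?A \<le> ennreal (\<delta> / C1) * energy \<alpha> p (\<lambda>w. cut w * H u w)"
        unfolding F_def by (rule approx[OF cutH(1,2)[OF u]]) (simp add: cut_def)
      also have "\<dots> \<le> ennreal (\<delta> / C1) * (ennreal C1 * energy \<alpha> p u)"
        by (intro mult_left_mono cutH(3) u) simp
      also have "\<dots> = ennreal \<delta> * energy \<alpha> p u"
        using C1 \<delta> by (simp add: mult.assoc[symmetric] ennreal_mult[symmetric])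
      finally show ?thesis .
    qed
    have D: "energy \<alpha> p ?D \<le> ennreal \<delta> * energy \<alpha> p u"
    proof -
      have "energy \<alpha> p ?D \<le> ennreal C * energy \<alpha> p (\<lambda>w. (1 - cut w) * H u w)" by (rule bnd[OF outer(1)[OF u]])
      also have "\<dots> \<le> ennreal C * (ennreal (Mg powr p * \<epsilon>1) * energy \<alpha> p u)"
        by (intro mult_left_mono outer(3) u) simp
      also have "\<dots> = ennreal (C * (Mg powr p * \<epsilon>1)) * energy \<alpha> p u"
        using C \<epsilon>1 by (simp add: mult.assoc[symmetric] ennreal_mult[symmetric])
      also have "C * (Mg powr p * \<epsilon>1) \<le> \<delta>"
      proof -
        have "C * (Mg powr p * \<epsilon>1) \<le> C * (Mg powr p + 1) * \<epsilon>1" using C \<epsilon>1 by (simp add: algebra_simps)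
        also have "\<dots> = \<delta>" unfolding \<epsilon>1_def using pos
          by (metis less_irrefl nonzero_mult_div_cancel_left times_divide_eq_right)
        finally show ?thesis .
      qed
      finally show ?thesis by (simp add: mult_right_mono ennreal_leI)
    qed
    have Fm: "F u \<in> borel_measurable borel"
    proof -
      have "cfun.span B \<subseteq> fock \<alpha> p" using B(2) subspace_fock by (rule cfun.span_minimal)
      then have "F u \<in> fock \<alpha> p" using \<open>F u \<in> cfun.span B\<close> by blast
      then show ?thesis by (rule fockD(3))
    qed
    have "energy \<alpha> p (\<lambda>z. ?A z + ?D z) \<le> ennreal (2 powr p * (\<delta> + \<delta>)) * energy \<alpha> p u"
    proof (rule energy_add_le[OF _ _ A D])
      have P1: "fock_proj \<alpha> (\<lambda>w. cut w * H u w) \<in> borel_measurable borel"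
        by (rule fockD(3)[OF fock_proj_in_fock[OF cutH(1,2)[OF u]]])
      show "?A \<in> borel_measurable borel" using P1 Fm by measurable
      show "?D \<in> borel_measurable borel" by (rule fockD(3)[OF fock_proj_in_fock[OF outer(1,2)[OF u]]])
    qed (use \<delta> in auto)
    also have "2 powr p * (\<delta> + \<delta>) = \<epsilon>" by (simp add: \<delta>_def)
    finally show "energy \<alpha> p (\<lambda>z. toeplitz \<alpha> g (toeplitz \<alpha> h u) z - u z - F u z) \<le> ennreal \<epsilon> * energy \<alpha> p u"
      unfolding eq .
  qed
qed

end

section \<open>Symbols bounded away from zero at infinity\<close>

lemma VO_bounded_symbol:
  assumes "f \<in> VO" shows "\<exists>M. bounded_symbol M f"
proof -
  obtain M where "\<forall>x\<in>range f. norm x \<le> M" using assms unfolding VO_def bounded_iff by blast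
  then have M: "norm (f w) \<le> M" for w by blast
  have "0 \<le> M" using order_trans[OF norm_ge_zero M] .
  moreover have "f \<in> borel_measurable borel"
    using assms unfolding VO_def by (auto intro: borel_measurable_continuous_onI)
  ultimately show ?thesis using M unfolding bounded_symbol_def by blast
qed

text \<open>The supremum in \<open>Osc\<close> is an upper bound only for a bounded family;
  boundedness of the symbol provides that.\<close>

lemma norm_diff_le_Osc:
  assumes "bounded_symbol M f" "norm (z - w) \<le> r"
  shows "norm (f z - f w) \<le> Osc r f z"
proof -
  have le: "norm (f x - f y) \<le> 2 * M" for x y
  proof -
    have "norm (f x) \<le> M" "norm (f y) \<le> M" using assms(1) by (auto simp: bounded_symbol_def)
    then show ?thesis using norm_triangle_ineq4[of "f x" "f y"] by linarith
  qed
  show ?thesis unfolding Osc_def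
    by (rule cSUP_upper) (use assms(2) le in \<open>auto intro!: bdd_aboveI[of _ "2 * M"]\<close>)
qed

text \<open>Distance \<open>L\<close> is covered by boundedly many steps of length at most 1, all of
  them far from the origin.\<close>

lemma VO_slowly_oscillating:
  fixes f :: "complex ^ 'n \<Rightarrow> complex"
  assumes "f \<in> VO" shows "slowly_oscillating f"
proof -
  obtain M where M: "bounded_symbol M f" using VO_bounded_symbol[OF assms] by blast
  have step: "\<exists>b. \<forall>z w. norm z \<ge> b \<longrightarrow> norm (z - w) \<le> 1 \<longrightarrow> norm (f z - f w) \<le> \<epsilon>" if "\<epsilon> > 0" for \<epsilon>
  proof -
    have "\<forall>\<^sub>F z in at_infinity. dist (Osc 1 f z) 0 < \<epsilon>"
      using assms that unfolding VO_def by (intro tendstoD) auto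
    then obtain b where "\<And>z. norm z \<ge> b \<Longrightarrow> dist (Osc 1 f z) 0 < \<epsilon>"
      unfolding eventually_at_infinity by blast
    then show ?thesis using norm_diff_le_Osc[OF M, of _ _ 1]
      by (intro exI[of _ b]) (force simp: dist_real_def)
  qed
  have "\<forall>\<epsilon>>0. \<exists>R. \<forall>z w. norm z > R \<longrightarrow> norm (z - w) \<le> real N \<longrightarrow> norm (f z - f w) \<le> \<epsilon>" for N
  proof (induction N)
    case (Suc N)
    show ?case
    proof (intro allI impI)
      fix \<epsilon> :: real assume "\<epsilon> > 0"
      then have e2: "\<epsilon> / 2 > 0" by simp
      obtain R where R: "\<And>z w. norm z > R \<Longrightarrow> norm (z - w) \<le> real N \<Longrightarrow> norm (f z - f w) \<le> \<epsilon> / 2"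
        using Suc.IH e2 by blast
      obtain b where b: "\<And>z w. norm z \<ge> b \<Longrightarrow> norm (z - w) \<le> 1 \<Longrightarrow> norm (f z - f w) \<le> \<epsilon> / 2"
        using step[OF e2] by blast
      show "\<exists>R. \<forall>z w. norm z > R \<longrightarrow> norm (z - w) \<le> real (Suc N) \<longrightarrow> norm (f z - f w) \<le> \<epsilon>"
      proof (intro exI[of _ "max R (b + real N)"] allI impI)
        fix z w :: "complex ^ 'n"
        assume z: "norm z > max R (b + real N)" and zw: "norm (z - w) \<le> real (Suc N)"
        \<comment> \<open>\<open>v\<close> divides the segment from \<open>z\<close> to
          \<open>w\<close> in the ratio \<open>N : 1\<close>: the induction hypothesis reaches
          \<open>v\<close>, and a step of length at most 1 remains. The summand
          \<open>real N\<close> in the radius ensures \<open>norm v \<ge> b\<close>.\<close>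
        define v where "v = z + (real N / real (Suc N)) *\<^sub>R (w - z)"
        have "norm (z - v) = (real N / real (Suc N)) * norm (z - w)"
          unfolding v_def by (simp add: norm_minus_commute)
        also have "\<dots> \<le> (real N / real (Suc N)) * real (Suc N)" by (intro mult_left_mono zw) simp
        also have "\<dots> = real N" by simp
        finally have zv: "norm (z - v) \<le> real N" .
        have "v - w = (1 - real N / real (Suc N)) *\<^sub>R (z - w)" unfolding v_def by (simp add: algebra_simps)
        also have "1 - real N / real (Suc N) = 1 / real (Suc N)" by (simp add: field_simps)
        finally have "norm (v - w) = norm (z - w) / real (Suc N)" by simp
        then have vw: "norm (v - w) \<le> 1" using zw by (simp add: divide_le_eq)
        have "norm z \<le> norm v + norm (z - v)" by (metis norm_triangle_sub add.commute norm_minus_commute)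
        then have "norm v \<ge> b" using zv z by linarith
        from b[OF this vw] R[OF _ zv] z norm_triangle_ineq[of "f z - f v" "f v - f w"]
        show "norm (f z - f w) \<le> \<epsilon>" by simp
      qed
    qed
  qed (auto intro: exI[of _ 0])
  note osc = this
  show ?thesis unfolding slowly_oscillating_def
  proof (intro allI impI)
    fix \<epsilon> L :: real assume "\<epsilon> > 0"
    obtain N where N: "L \<le> real N" using real_arch_simple by blast
    obtain R where "\<forall>z w. norm z > R \<longrightarrow> norm (z - w) \<le> real N \<longrightarrow> norm (f z - f w) \<le> \<epsilon>"
      using osc[of N] \<open>\<epsilon> > 0\<close> by blast
    with N show "\<exists>R. \<forall>z w. norm z > R \<longrightarrow> norm (z - w) \<le> L \<longrightarrow> norm (f z - f w) \<le> \<epsilon>"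
      by (intro exI[of _ R]) (blast intro: order_trans)
  qed
qed

lemma slowly_oscillating_diff_const:
  "slowly_oscillating f \<Longrightarrow> slowly_oscillating (\<lambda>z. f z - c)"
  unfolding slowly_oscillating_def by simp

lemma bounded_symbol_diff_const:
  assumes "bounded_symbol M f" shows "bounded_symbol (M + norm c) (\<lambda>z. f z - c)"
  using assms unfolding bounded_symbol_def
  by (auto intro: order_trans[OF norm_triangle_ineq4] add_right_mono)

text \<open>The inverses differ by \<open>(h w - h z) / (h z * h w)\<close>, whence the factor
  \<open>\<delta>\<^sup>2\<close>; the summand \<open>|L|\<close> in the radius keeps
  \<open>w\<close> outside the ball of truncation too.\<close>

lemma slowly_oscillating_inverse:
  fixes h :: "complex ^ 'n \<Rightarrow> complex"
  assumes osc: "slowly_oscillating h" and low: "\<And>z. norm z > R0 \<Longrightarrow> norm (h z) \<ge> \<delta>" and "\<delta> > 0"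
  shows "slowly_oscillating (\<lambda>z. if norm z > R0 then inverse (h z) else 0)"
  unfolding slowly_oscillating_def
proof (intro allI impI)
  fix \<epsilon> L :: real assume "\<epsilon> > 0"
  then have "\<epsilon> * \<delta>\<^sup>2 > 0" using \<open>\<delta> > 0\<close> by simp
  then obtain R where R: "\<And>z w. norm z > R \<Longrightarrow> norm (z - w) \<le> L \<Longrightarrow> norm (h z - h w) \<le> \<epsilon> * \<delta>\<^sup>2"
    using osc unfolding slowly_oscillating_def by metis
  show "\<exists>R. \<forall>z w. norm z > R \<longrightarrow> norm (z - w) \<le> L \<longrightarrow>
    norm ((if norm z > R0 then inverse (h z) else 0) - (if norm w > R0 then inverse (h w) else 0)) \<le> \<epsilon>"
  proof (intro exI[of _ "max R (R0 + \<bar>L\<bar>)"] allI impI)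
    fix z w :: "complex ^ 'n" assume z: "norm z > max R (R0 + \<bar>L\<bar>)" and zw: "norm (z - w) \<le> L"
    have "norm z \<le> norm w + norm (z - w)" by (metis norm_triangle_sub add.commute)
    then have w: "norm w > R0" using z zw by linarith
    have z': "norm z > R0" using z by linarith
    have nz: "norm (h z) \<ge> \<delta>" "norm (h w) \<ge> \<delta>" using low w z' by auto
    then have ne: "h z \<noteq> 0" "h w \<noteq> 0" using \<open>\<delta> > 0\<close> by auto
    have "inverse (h z) - inverse (h w) = (h w - h z) / (h z * h w)"
      using ne by (simp add: field_simps)
    then have "norm (inverse (h z) - inverse (h w)) = norm (h z - h w) / (norm (h z) * norm (h w))"
      by (simp add: norm_divide norm_mult norm_minus_commute)
    also have "\<dots> \<le> (\<epsilon> * \<delta>\<^sup>2) / (\<delta> * \<delta>)"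
      using R[OF _ zw] z nz \<open>\<delta> > 0\<close> \<open>\<epsilon> > 0\<close> by (intro frac_le mult_mono mult_pos_pos) auto
    also have "\<dots> = \<epsilon>" using \<open>\<delta> > 0\<close> by (simp add: power2_eq_square)
    finally show "norm ((if norm z > R0 then inverse (h z) else 0) - (if norm w > R0 then inverse (h w) else 0)) \<le> \<epsilon>"
      using w z' by simp
  qed
qed

text \<open>Operators here are functions on all arguments, whereas \<open>T\<^sub>f - c\<close> and
  the Toeplitz operator of \<open>f - c\<close> are compared on the Fock space only.\<close>

lemma fredholm_on_cong:
  assumes eq: "\<And>u. u \<in> X \<Longrightarrow> A u = A' u" and X: "cfun.subspace X"
  shows "fredholm_on X N A \<longleftrightarrow> fredholm_on X N A'"
proof -
  have 1: "A ` X = A' ` X" using eq by auto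
  have 2: "{g \<in> X. A g = 0} = {g \<in> X. A' g = 0}" using eq by auto
  have 3: "A (g + h) = A' (g + h)" "A (fscale c g) = A' (fscale c g)" if "g \<in> X" "h \<in> X" for g h c
    using that X by (auto intro!: eq cfun.subspace_add cfun.subspace_scale)
  show ?thesis unfolding fredholm_on_def bounded_operator_on_def 1 2 using eq 3
    by (simp cong: ball_cong conj_cong)
qed

section \<open>Neumann series and the Fredholm property\<close>

context fock_setting
begin

text \<open>Point evaluations are dominated by the energy.\<close>

lemma fock_energy_zero:
  fixes d :: "complex ^ 'n \<Rightarrow> complex"
  assumes d: "d \<in> fock \<alpha> p" and "energy \<alpha> p d = 0"
  shows "d = 0"
proof
  fix z
  obtain C where "ennreal (wt \<alpha> (fock_proj \<alpha> d) z powr p) \<le> ennreal C * energy \<alpha> p d"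
    using fock_proj_bounds fockD(3)[OF d] by blast
  then have "wt \<alpha> d z powr p \<le> 0" using assms fockD(4)[OF d] by (simp add: ennreal_eq_0_iff)
  then have "wt \<alpha> d z = 0" using powr_gt_zero[of "wt \<alpha> d z" p] by (metis not_less)
  then show "d z = 0 z" by (simp add: wt_def)
qed

lemma energy_uminus: "energy \<alpha> p (- u) = energy \<alpha> p u"
  by (simp only: energy_def wt_def uminus_apply norm_minus_cancel)

text \<open>Neumann series: a perturbation that contracts the \<open>p\<close>-energy by \<open>4\<^sup>-\<^sup>p\<close>, hence the norm by
  \<open>1/4\<close>, keeps the identity onto.\<close>

lemma identity_plus_small_onto:
  fixes S :: "(complex ^ 'n \<Rightarrow> complex) \<Rightarrow> complex ^ 'n \<Rightarrow> complex"
  assumes SX: "\<And>u. u \<in> fock \<alpha> p \<Longrightarrow> S u \<in> fock \<alpha> p"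
    and Sadd: "\<And>u v. u \<in> fock \<alpha> p \<Longrightarrow> v \<in> fock \<alpha> p \<Longrightarrow> S (u + v) = S u + S v"
    and Sscale: "\<And>c u. u \<in> fock \<alpha> p \<Longrightarrow> S (fscale c u) = fscale c (S u)"
    and small: "\<And>u. u \<in> fock \<alpha> p \<Longrightarrow> energy \<alpha> p (S u) \<le> ennreal (4 powr - p) * energy \<alpha> p u"
    and v: "v \<in> fock \<alpha> p"
  shows "\<exists>u\<in>fock \<alpha> p. u + S u = v"
proof -
  note sub = cfun.subspace_add[OF subspace_fock] cfun.subspace_diff[OF subspace_fock] cfun.subspace_neg[OF subspace_fock]
    cfun.subspace_sum[OF subspace_fock] cfun.subspace_0[OF subspace_fock]
  define q where "q = 4 powr - p"
  have q: "0 \<le> q" "q < 1" using p_gt1 powr_less_one[of 4 "- p"] by (auto simp: q_def)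
  have small': "energy \<alpha> p (S u) \<le> ennreal q * energy \<alpha> p u" if "u \<in> fock \<alpha> p" for u
    unfolding q_def using that by (rule small)
  have Sneg: "S (- u) = - S u" if "u \<in> fock \<alpha> p" for u
    using Sscale[OF that, of "-1"] by (simp add: fscale_def fun_Compl_def)
  have Sdiff: "S (u - v) = S u - S v" if "u \<in> fock \<alpha> p" "v \<in> fock \<alpha> p" for u v
    using Sadd[OF that(1) sub(3)[OF that(2)]] Sneg[OF that(2)] by simp
  \<comment> \<open>\<open>u k\<close> is \<open>(- S)\<^sup>k v\<close>, the general term of the
    Neumann series.\<close>
  define u where "u = rec_nat v (\<lambda>_ x. - S x)"
  have u0: "u 0 = v" and uS: "\<And>k. u (Suc k) = - S (u k)" by (simp_all add: u_def)
  have uX: "u k \<in> fock \<alpha> p" for k 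
  proof (induction k)
    case (Suc k)
    show ?case unfolding uS by (rule sub(3)[OF SX[OF Suc]])
  qed (simp only: u0 v)
  obtain A where A: "A \<ge> 0" "energy \<alpha> p v = ennreal A"
    using fockD(2)[OF v] by (cases "energy \<alpha> p v") auto
  have ue: "energy \<alpha> p (u k) \<le> ennreal (A * q ^ k)" for k
  proof (induction k)
    case (Suc k)
    have "energy \<alpha> p (u (Suc k)) \<le> ennreal q * energy \<alpha> p (u k)"
      unfolding uS energy_uminus by (rule small'[OF uX])
    also have "\<dots> \<le> ennreal q * ennreal (A * q ^ k)" by (intro mult_left_mono Suc) simp
    also have "\<dots> = ennreal (A * q ^ Suc k)" using A q by (simp add: ennreal_mult[symmetric] mult_ac)
    finally show ?case .
  qed (simp add: u0 A)
  obtain w B where w: "w \<in> fock \<alpha> p" and B: "B \<ge> 0"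
    and tail: "\<And>N. energy \<alpha> p (\<lambda>z. w z - (\<Sum>k<N. u k z)) \<le> ennreal (B * q ^ N)"
    using fock_complete[OF uX ue[unfolded q_def] A(1)] unfolding q_def by metis
  define s where "s N = (\<Sum>k<N. u k)" for N :: nat
  have sX: "s N \<in> fock \<alpha> p" for N unfolding s_def by (intro sub uX)
  have tail': "energy \<alpha> p (w - s N) \<le> ennreal (B * q ^ N)" for N
    using tail[of N] by (simp add: s_def fun_diff_def sum_fun_apply)
  have sS: "s N + S (s N) = v - u N" for N
  proof (induction N)
    case 0
    have "S 0 = 0" using Sdiff[OF v v] by simp
    then show ?case by (simp only: s_def u0 lessThan_0 sum.empty add_0 diff_self)
  next
    case (Suc N)
    have "s (Suc N) = s N + u N" unfolding s_def by (rule sum.lessThan_Suc)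
    then have "s (Suc N) + S (s (Suc N)) = (s N + u N) + (S (s N) + S (u N))"
      by (simp only: Sadd[OF sX uX])
    also have "\<dots> = (s N + S (s N)) + u N + S (u N)" by (simp only: add_ac)
    also have "\<dots> = v - u (Suc N)" by (simp only: Suc uS diff_add_cancel diff_minus_eq_add)
    finally show ?case .
  qed
  define d where "d = w + S w - v"
  have dX: "d \<in> fock \<alpha> p" unfolding d_def by (rule sub(2)[OF sub(1)[OF w SX[OF w]] v])
  \<comment> \<open>Collects the constants of two uses of \<open>energy_add_le\<close>, for the
    three summands of \<open>d\<close> below, each with energy of order
    \<open>q ^ N\<close>.\<close>
  define K where "K = 2 powr p * (2 powr p * (B + q * B) + A)"
  have "energy \<alpha> p d \<le> ennreal (K * q ^ N)" for N
  proof -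
    let ?r = "w - s N"
    have rX: "?r \<in> fock \<alpha> p" by (rule sub(2)[OF w sX])
    \<comment> \<open>Because \<open>s N + S (s N) = v - u N\<close>, the defect is
      \<open>r + S r - u N\<close> with \<open>r = w - s N\<close>. It is the same for every
      \<open>N\<close>, while the bound tends to 0.\<close>
    have d: "d = (\<lambda>z. (\<lambda>z. ?r z + S ?r z) z + (- u N) z)"
    proof
      fix z
      show "d z = (\<lambda>z. ?r z + S ?r z) z + (- u N) z"
        using fun_cong[OF sS[of N], of z] fun_cong[OF Sdiff[OF w sX, of N], of z]
        unfolding d_def plus_fun_apply minus_apply uminus_apply by algebra
    qed
    have meas: "?r \<in> borel_measurable borel" "S ?r \<in> borel_measurable borel" "- u N \<in> borel_measurable borel"
      by (rule fockD(3)[OF rX], rule fockD(3)[OF SX[OF rX]], rule fockD(3)[OF sub(3)[OF uX]])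
    have "energy \<alpha> p (S ?r) \<le> ennreal q * energy \<alpha> p ?r" by (rule small'[OF rX])
    also have "\<dots> \<le> ennreal q * ennreal (B * q ^ N)" by (intro mult_left_mono tail') simp
    finally have e2: "energy \<alpha> p (S ?r) \<le> ennreal (q * B) * ennreal (q ^ N)"
      using q B by (simp add: ennreal_mult[symmetric] mult.assoc)
    have e1: "energy \<alpha> p ?r \<le> ennreal B * ennreal (q ^ N)" using tail'[of N] q B by (simp add: ennreal_mult[symmetric])
    have e3: "energy \<alpha> p (- u N) \<le> ennreal A * ennreal (q ^ N)" using ue[of N] q A by (simp add: energy_uminus ennreal_mult[symmetric] del: uminus_apply)
    have e12: "energy \<alpha> p (\<lambda>z. ?r z + S ?r z) \<le> ennreal (2 powr p * (B + q * B)) * ennreal (q ^ N)"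
      by (rule energy_add_le[OF meas(1,2) e1 e2]) (use q B in auto)
    have "energy \<alpha> p (\<lambda>z. (\<lambda>z. ?r z + S ?r z) z + (- u N) z) \<le> ennreal K * ennreal (q ^ N)"
      unfolding K_def by (rule energy_add_le[OF borel_measurable_add[OF meas(1,2)] meas(3) e12 e3]) (use q B A in auto)
    then show ?thesis unfolding d[symmetric] using q A B by (simp add: ennreal_mult[symmetric] K_def)
  qed
  note le = this
  have "norm q < 1" using q by simp
  then have "(\<lambda>N. ennreal (K * q ^ N)) \<longlonglongrightarrow> ennreal (K * 0)"
    by (intro tendsto_ennrealI tendsto_mult tendsto_const LIMSEQ_power_zero)
  then have "energy \<alpha> p d \<le> ennreal (K * 0)" by (rule LIMSEQ_le_const) (use le in blast)
  then have "d = 0" using fock_energy_zero[OF dX] by simp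
  then have "w + S w = v" unfolding d_def by (simp only: right_minus_eq)
  with w show ?thesis by blast
qed

text \<open>\<open>S = D - 1 - F\<close> is a contraction, so \<open>1 + S\<close> is bijective on
  the Fock space. If \<open>D u = 0\<close>, then \<open>u + S u = - F u\<close> lies in the span of
  \<open>B\<close>, which confines \<open>u\<close> to the preimage of that span. Every
  \<open>v = u + S u\<close> equals \<open>D u - F u\<close>, which gives the range.\<close>

lemma almost_identity_kernel_range:
  fixes D F :: "(complex ^ 'n \<Rightarrow> complex) \<Rightarrow> complex ^ 'n \<Rightarrow> complex"
  assumes DX: "\<And>u. u \<in> fock \<alpha> p \<Longrightarrow> D u \<in> fock \<alpha> p"
    and Dadd: "\<And>u v. u \<in> fock \<alpha> p \<Longrightarrow> v \<in> fock \<alpha> p \<Longrightarrow> D (u + v) = D u + D v"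
    and Dscale: "\<And>c u. u \<in> fock \<alpha> p \<Longrightarrow> D (fscale c u) = fscale c (D u)"
    and B: "finite B" "B \<subseteq> fock \<alpha> p" and FB: "\<And>u. u \<in> fock \<alpha> p \<Longrightarrow> F u \<in> cfun.span B"
    and Fadd: "\<And>u v. u \<in> fock \<alpha> p \<Longrightarrow> v \<in> fock \<alpha> p \<Longrightarrow> F (u + v) = F u + F v"
    and Fscale: "\<And>c u. u \<in> fock \<alpha> p \<Longrightarrow> F (fscale c u) = fscale c (F u)"
    and small: "\<And>u. u \<in> fock \<alpha> p \<Longrightarrow> energy \<alpha> p (\<lambda>z. D u z - u z - F u z) \<le> ennreal (4 powr - p) * energy \<alpha> p u"
  shows "\<exists>B'. finite B' \<and> {u \<in> fock \<alpha> p. D u = 0} \<subseteq> cfun.span B'"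
    and "fock \<alpha> p \<subseteq> cfun.span (D ` fock \<alpha> p \<union> B)"
proof -
  note sub = cfun.subspace_add[OF subspace_fock] cfun.subspace_diff[OF subspace_fock] cfun.subspace_scale[OF subspace_fock]
    cfun.subspace_0[OF subspace_fock]
  have spanB: "cfun.span B \<subseteq> fock \<alpha> p" using B(2) subspace_fock by (rule cfun.span_minimal)
  define S where "S u = D u - u - F u" for u
  have SX: "S u \<in> fock \<alpha> p" if "u \<in> fock \<alpha> p" for u
    unfolding S_def using spanB FB[OF that] DX[OF that] that by (auto intro!: sub)
  have Sadd: "S (u + v) = S u + S v" if "u \<in> fock \<alpha> p" "v \<in> fock \<alpha> p" for u v
    unfolding S_def using Dadd[OF that] Fadd[OF that] by simp
  have Sscale: "S (fscale c u) = fscale c (S u)" if "u \<in> fock \<alpha> p" for c u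
    unfolding S_def Dscale[OF that] Fscale[OF that] by (simp add: cfun.scale_right_diff_distrib)
  have Ssmall: "energy \<alpha> p (S u) \<le> ennreal (4 powr - p) * energy \<alpha> p u" if "u \<in> fock \<alpha> p" for u
    using small[OF that] by (simp add: S_def fun_diff_def)
  note onto = identity_plus_small_onto[OF SX Sadd Sscale Ssmall]
  have S0: "S 0 = 0" using Sscale[OF sub(4), of 0] by (simp only: cfun.scale_zero_left)
  have inj: "u = v" if u: "u \<in> fock \<alpha> p" and v: "v \<in> fock \<alpha> p" and eq: "u + S u = v + S v" for u v
  proof -
    let ?d = "u - v"
    have dX: "?d \<in> fock \<alpha> p" by (intro sub u v)
    have "v + ?d = u" by simp
    then have "S u = S v + S ?d" using Sadd[OF v dX] by simp
    then have "S ?d = - ?d" using eq by (simp add: algebra_simps)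
    then have le: "energy \<alpha> p ?d \<le> ennreal (4 powr - p) * energy \<alpha> p ?d"
      using Ssmall[OF dX] by (simp only: energy_uminus)
    obtain e where e: "e \<ge> 0" "energy \<alpha> p ?d = ennreal e"
      using fockD(2)[OF dX] by (cases "energy \<alpha> p ?d") auto
    have "e \<le> 4 powr - p * e" using le e by (simp add: ennreal_mult[symmetric])
    moreover have "4 powr - p < 1" using p_gt1 powr_less_one[of 4 "- p"] by auto
    ultimately have "e = 0" using e(1) by (metis mult_less_cancel_right2 not_le order.order_iff_strict)
    then have "?d = 0" using fock_energy_zero[OF dX] e by simp
    then show "u = v" by simp
  qed
  \<comment> \<open>Preimages of the elements of \<open>B\<close> under \<open>1 + S\<close>; by
    linearity they span the preimage of the span of \<open>B\<close>.\<close>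
  obtain j where j: "\<And>b. b \<in> B \<Longrightarrow> j b \<in> fock \<alpha> p \<and> j b + S (j b) = b"
    using onto B(2) by (metis subsetD)
  have lift: "\<exists>x. x \<in> fock \<alpha> p \<and> x \<in> cfun.span (j ` B) \<and> x + S x = y" if "y \<in> cfun.span B" for y
    using that
  proof (induction rule: cfun.span_induct_alt)
    case base
    show ?case by (intro exI[of _ 0] conjI sub(4) cfun.span_zero) (simp only: S0 add_0)
  next
    case (step c b y)
    then obtain x where x: "x \<in> fock \<alpha> p" "x \<in> cfun.span (j ` B)" "x + S x = y" by blast
    note jb = j[OF \<open>b \<in> B\<close>]
    have cX: "fscale c (j b) \<in> fock \<alpha> p" using jb by (intro sub) auto
    show ?case
    proof (intro exI[of _ "fscale c (j b) + x"] conjI)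
      show "fscale c (j b) + x \<in> fock \<alpha> p" by (intro sub(1) cX x)
      show "fscale c (j b) + x \<in> cfun.span (j ` B)"
        using \<open>b \<in> B\<close> by (intro cfun.span_add cfun.span_scale cfun.span_base x) auto
      have "fscale c (j b) + x + S (fscale c (j b) + x) = fscale c (j b + S (j b)) + (x + S x)"
        unfolding Sadd[OF cX x(1)] Sscale[OF conjunct1[OF jb]] cfun.scale_right_distrib by (simp only: add_ac)
      then show "fscale c (j b) + x + S (fscale c (j b) + x) = fscale c b + y" by (simp only: conjunct2[OF jb] x(3))
    qed
  qed
  show "\<exists>B'. finite B' \<and> {u \<in> fock \<alpha> p. D u = 0} \<subseteq> cfun.span B'"
  proof (intro exI[of _ "j ` B"] conjI subsetI)
    show "finite (j ` B)" using B(1) by simp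
    fix u assume "u \<in> {u \<in> fock \<alpha> p. D u = 0}"
    then have u: "u \<in> fock \<alpha> p" "D u = 0" by auto
    have "- F u \<in> cfun.span B" by (intro cfun.span_neg FB u)
    then obtain x where x: "x \<in> fock \<alpha> p" "x \<in> cfun.span (j ` B)" "x + S x = - F u" using lift by blast
    have "u + S u = - F u" using u(2) by (simp add: S_def)
    then have "u = x" by (intro inj[OF u(1) x(1)]) (simp only: x(3))
    with x(2) show "u \<in> cfun.span (j ` B)" by (simp only:)
  qed
  show "fock \<alpha> p \<subseteq> cfun.span (D ` fock \<alpha> p \<union> B)"
  proof
    fix v :: "complex ^ 'n \<Rightarrow> complex" assume "v \<in> fock \<alpha> p"
    then obtain u where u: "u \<in> fock \<alpha> p" "u + S u = v" using onto by blast
    have "v = D u - F u" using u(2) by (simp add: S_def algebra_simps)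
    have "D u \<in> cfun.span (D ` fock \<alpha> p \<union> B)" using u(1) by (intro cfun.span_base) blast
    moreover have "F u \<in> cfun.span (D ` fock \<alpha> p \<union> B)"
      using FB[OF u(1)] cfun.span_mono[of B "D ` fock \<alpha> p \<union> B"] by blast
    ultimately show "v \<in> cfun.span (D ` fock \<alpha> p \<union> B)"
      unfolding \<open>v = D u - F u\<close> by (rule cfun.span_diff)
  qed
qed

lemma toeplitz_plus:
  "bounded_symbol M h \<Longrightarrow> u \<in> fock \<alpha> p \<Longrightarrow> v \<in> fock \<alpha> p \<Longrightarrow> toeplitz \<alpha> h (u + v) = toeplitz \<alpha> h u + toeplitz \<alpha> h v"
  unfolding plus_fun_def by (rule ext) (rule toeplitz_add)

lemma toeplitz_fscale: "toeplitz \<alpha> h (fscale c u) = fscale c (toeplitz \<alpha> h u)"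
  unfolding fscale_def by (rule ext) (rule toeplitz_scale)

lemma bounded_operator_toeplitz:
  fixes h :: "complex ^ 'n \<Rightarrow> complex"
  assumes h: "bounded_symbol M h"
  shows "bounded_operator_on (fock \<alpha> p) (Lp_norm \<alpha> p) (toeplitz \<alpha> h)"
proof -
  obtain C where C: "C > 0" "\<And>u. u \<in> fock \<alpha> p \<Longrightarrow> energy \<alpha> p (toeplitz \<alpha> h u) \<le> ennreal C * energy \<alpha> p u"
    using toeplitz_energy[OF h] by blast
  have "Lp_norm \<alpha> p (toeplitz \<alpha> h u) \<le> C powr (1 / p) * Lp_norm \<alpha> p u" if u: "u \<in> fock \<alpha> p" for u
  proof -
    let ?k = "(p * \<alpha> / 2 / pi) ^ CARD('n)"
    have k: "?k \<ge> 0" using alpha_pos p_gt1 by simp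
    have "enn2real (energy \<alpha> p (toeplitz \<alpha> h u)) \<le> enn2real (ennreal C * energy \<alpha> p u)"
      using fockD(2)[OF u] by (intro enn2real_mono C u) (simp add: ennreal_mult_less_top)
    also have "\<dots> = C * enn2real (energy \<alpha> p u)" using C(1) by (simp add: enn2real_mult)
    finally have "?k * enn2real (energy \<alpha> p (toeplitz \<alpha> h u)) \<le> C * (?k * enn2real (energy \<alpha> p u))"
      using mult_left_mono[OF _ k] by (simp only: mult.left_commute[of C])
    then have "(?k * enn2real (energy \<alpha> p (toeplitz \<alpha> h u))) powr (1 / p) \<le> (C * (?k * enn2real (energy \<alpha> p u))) powr (1 / p)"
      using k p_gt1 by (intro powr_mono2) auto
    then show ?thesis
      unfolding Lp_norm_energy[OF fockD(3)[OF u]] Lp_norm_energy[OF fockD(3)[OF toeplitz_in_fock[OF h u]]]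
      by (simp only: powr_mult)
  qed
  then show ?thesis
    unfolding bounded_operator_on_def using toeplitz_in_fock[OF h] toeplitz_plus[OF h] toeplitz_fscale by blast
qed

lemma toeplitz_fredholm:
  fixes h :: "complex ^ 'n \<Rightarrow> complex"
  assumes h: "bounded_symbol M h" and osc: "slowly_oscillating h"
    and low: "\<And>z. norm z > R0 \<Longrightarrow> norm (h z) \<ge> \<delta>" and "\<delta> > 0"
  shows "fredholm_on (fock \<alpha> p) (Lp_norm \<alpha> p) (toeplitz \<alpha> h)"
proof -
  define g where "g z = (if norm z > R0 then inverse (h z) else 0)" for z
  have [measurable]: "h \<in> borel_measurable borel" using h by (simp add: bounded_symbol_def)
  have gosc: "slowly_oscillating g"
    using slowly_oscillating_inverse[OF osc low \<open>\<delta> > 0\<close>] by (simp add: g_def[abs_def])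
  have g: "bounded_symbol (inverse \<delta>) g"
    unfolding bounded_symbol_def
  proof (intro conjI allI)
    show "g \<in> borel_measurable borel" unfolding g_def[abs_def] by measurable
    fix w show "norm (g w) \<le> inverse \<delta>"
      using low[of w] \<open>\<delta> > 0\<close> by (auto simp: g_def norm_inverse intro!: le_imp_inverse_le)
  qed (use \<open>\<delta> > 0\<close> in auto)
  have ne: "h z \<noteq> 0" if "norm z > R0" for z using low[OF that] \<open>\<delta> > 0\<close> by auto
  have gh: "\<forall>z. norm z > R0 \<longrightarrow> g z * h z = 1" "\<forall>z. norm z > R0 \<longrightarrow> h z * g z = 1"
    using ne by (auto simp: g_def)
  have q: "4 powr - p > 0" by simp
  let ?Tg = "toeplitz \<alpha> g" and ?Th = "toeplitz \<alpha> h"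
  from toeplitz_parametrix[OF g h osc gh(1) q] obtain F B where F0: "finite B" "B \<subseteq> fock \<alpha> p" "\<forall>u\<in>fock \<alpha> p. F u \<in> cfun.span B"
    "\<forall>u\<in>fock \<alpha> p. \<forall>v\<in>fock \<alpha> p. F (u + v) = F u + F v"
    "\<forall>c. \<forall>u\<in>fock \<alpha> p. F (fscale c u) = fscale c (F u)"
    "\<forall>u\<in>fock \<alpha> p. energy \<alpha> p (\<lambda>z. ?Tg (?Th u) z - u z - F u z) \<le> ennreal (4 powr - p) * energy \<alpha> p u"
    by (elim exE conjE) (rule that; assumption)
  note F = F0(1,2) F0(3-)[rule_format]
  have "\<exists>B'. finite B' \<and> {u \<in> fock \<alpha> p. ?Tg (?Th u) = 0} \<subseteq> cfun.span B'"
    by (rule almost_identity_kernel_range(1)[where F=F and B=B])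
      (simp_all add: F toeplitz_in_fock[OF g] toeplitz_in_fock[OF h] toeplitz_plus[OF g] toeplitz_plus[OF h] toeplitz_fscale)
  moreover have "?Tg 0 = 0" using toeplitz_fscale[of g 0 0] by (simp only: cfun.scale_zero_left)
  then have "{u \<in> fock \<alpha> p. ?Th u = 0} \<subseteq> {u \<in> fock \<alpha> p. ?Tg (?Th u) = 0}" by auto
  ultimately have ker: "\<exists>B. finite B \<and> {u \<in> fock \<alpha> p. ?Th u = 0} \<subseteq> cfun.span B" by blast
  \<comment> \<open>With the roles exchanged the inner symbol is \<open>g\<close>, and its slow
    oscillation enters here. The range of \<open>T\<^sub>h T\<^sub>g\<close> lies in that of
    \<open>T\<^sub>h\<close>.\<close>
  from toeplitz_parametrix[OF h g gosc gh(2) q] obtain F' B' where F'0: "finite B'" "B' \<subseteq> fock \<alpha> p" "\<forall>u\<in>fock \<alpha> p. F' u \<in> cfun.span B'"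
    "\<forall>u\<in>fock \<alpha> p. \<forall>v\<in>fock \<alpha> p. F' (u + v) = F' u + F' v"
    "\<forall>c. \<forall>u\<in>fock \<alpha> p. F' (fscale c u) = fscale c (F' u)"
    "\<forall>u\<in>fock \<alpha> p. energy \<alpha> p (\<lambda>z. ?Th (?Tg u) z - u z - F' u z) \<le> ennreal (4 powr - p) * energy \<alpha> p u"
    by (elim exE conjE) (rule that; assumption)
  note F' = F'0(1,2) F'0(3-)[rule_format]
  have "fock \<alpha> p \<subseteq> cfun.span ((\<lambda>u. ?Th (?Tg u)) ` fock \<alpha> p \<union> B')"
    by (rule almost_identity_kernel_range(2)[where F=F' and B=B'])
      (simp_all add: F' toeplitz_in_fock[OF g] toeplitz_in_fock[OF h] toeplitz_plus[OF g] toeplitz_plus[OF h] toeplitz_fscale)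
  also have "\<dots> \<subseteq> cfun.span (?Th ` fock \<alpha> p \<union> B')"
    by (rule cfun.span_mono) (auto intro!: imageI toeplitz_in_fock[OF g])
  finally have "\<exists>B. finite B \<and> B \<subseteq> fock \<alpha> p \<and> fock \<alpha> p \<subseteq> cfun.span (?Th ` fock \<alpha> p \<union> B)"
    using F'(1,2) by blast
  with ker bounded_operator_toeplitz[OF h] show ?thesis unfolding fredholm_on_def by blast
qed

end

section \<open>Limit values belong to the essential spectrum\<close>

text \<open>Modulo \<open>Y\<close> the vectors lie in the span of \<open>card B\<close> elements,
  and there are \<open>card B + 1\<close> of them, since the index includes both 0 and
  \<open>card B\<close>.\<close>

lemma dependent_modulo_subspace:
  fixes v :: "nat \<Rightarrow> 'a \<Rightarrow> complex"
  assumes Y: "cfun.subspace Y" and B: "finite B" and v: "\<And>i. i \<le> card B \<Longrightarrow> v i \<in> cfun.span (Y \<union> B)"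
  shows "\<exists>x. (\<exists>i\<le>card B. x i \<noteq> 0) \<and> (\<Sum>i\<le>card B. fscale (x i) (v i)) \<in> Y"
proof -
  let ?I = "{..card B}"
  have "\<exists>y b. y \<in> Y \<and> b \<in> cfun.span B \<and> v i = y + b" if "i \<le> card B" for i
    using v[OF that] Y unfolding cfun.span_Un by (auto simp: cfun.span_eq_iff[THEN iffD2])
  then obtain y b where yb: "\<And>i. i \<le> card B \<Longrightarrow> y i \<in> Y \<and> b i \<in> cfun.span B \<and> v i = y i + b i"
    by metis
  have "\<exists>x. (\<exists>i\<le>card B. x i \<noteq> 0) \<and> (\<Sum>i\<in>?I. fscale (x i) (b i)) = 0"
  proof (cases "inj_on b ?I")
    case True
    have "card (b ` ?I) = Suc (card B)" using True by (simp add: card_image)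
    moreover have "b ` ?I \<subseteq> cfun.span B" using yb by auto
    ultimately have "cfun.dependent (b ` ?I)"
      using cfun.independent_span_bound[OF B, of "b ` ?I"] by auto
    then obtain u where u: "\<exists>w\<in>b ` ?I. u w \<noteq> 0" "(\<Sum>w\<in>b ` ?I. fscale (u w) w) = 0"
      using cfun.dependent_finite[of "b ` ?I"] by auto
    show ?thesis
    proof (intro exI[of _ "\<lambda>i. u (b i)"] conjI)
      show "\<exists>i\<le>card B. u (b i) \<noteq> 0" using u(1) by auto
      show "(\<Sum>i\<in>?I. fscale (u (b i)) (b i)) = 0" using u(2) unfolding sum.reindex[OF True] o_def .
    qed
  next
    case False
    then obtain i j where ij: "i \<in> ?I" "j \<in> ?I" "i \<noteq> j" "b i = b j" unfolding inj_on_def by blast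
    \<comment> \<open>\<open>cfun.dependent\<close> speaks of sets and does not see repetitions; an
      equality \<open>b i = b j\<close> is itself the required relation.\<close>
    let ?x = "\<lambda>k. (if k = i then 1 else 0) - (if k = j then 1 else 0) :: complex"
    have "(\<Sum>k\<in>?I. fscale (?x k) (b k)) = (\<Sum>k\<in>?I. (if k = i then b k else 0) - (if k = j then b k else 0))"
      using ij(3) by (intro sum.cong) (auto simp: fscale_def fun_eq_iff)
    also have "\<dots> = b i - b j" unfolding sum_subtractf using ij(1,2) by (simp only: sum.delta finite_atMost if_True)
    finally have "(\<Sum>k\<in>?I. fscale (?x k) (b k)) = 0" using ij(4) by (simp only: diff_self)
    then show ?thesis using ij by (intro exI[of _ ?x]) (auto intro!: exI[of _ i])
  qed
  then obtain x where x: "\<exists>i\<le>card B. x i \<noteq> 0" "(\<Sum>i\<in>?I. fscale (x i) (b i)) = 0" by blast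
  have "(\<Sum>i\<in>?I. fscale (x i) (v i)) = (\<Sum>i\<in>?I. fscale (x i) (y i) + fscale (x i) (b i))"
    using yb by (intro sum.cong) (simp_all only: cfun.scale_right_distrib atMost_iff)
  also have "\<dots> = (\<Sum>i\<in>?I. fscale (x i) (y i))" unfolding sum.distrib x(2) by (simp only: add_0_right)
  also have "\<dots> \<in> Y" using yb by (intro cfun.subspace_sum[OF Y] cfun.subspace_scale[OF Y]) auto
  finally show ?thesis using x(1) by blast
qed

context fock_setting
begin

text \<open>In the ball of radius \<open>L\<close> about \<open>z\<close> the symbol is small, one
  half of the allowance being for its value at \<open>z\<close> and one for its oscillation; further
  away the kernel decays. The bound is uniform in \<open>u\<close>, so it constrains the whole range
  of the operator.\<close>

lemma toeplitz_point_small: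
  fixes h :: "complex ^ 'n \<Rightarrow> complex"
  assumes h: "bounded_symbol M h" and osc: "slowly_oscillating h" and "\<epsilon> > 0"
  shows "\<exists>R. \<exists>\<eta>>0. \<forall>z. norm z > R \<longrightarrow> norm (h z) \<le> \<eta> \<longrightarrow>
    (\<forall>u\<in>fock \<alpha> p. ennreal (wt \<alpha> (toeplitz \<alpha> h u) z powr p) \<le> ennreal (\<epsilon> powr p) * energy \<alpha> p u)"
proof -
  let ?m = "gauss_mass TYPE(complex ^ 'n) (\<alpha> / 4)"
  let ?a = "(\<alpha> / pi) ^ CARD('n)"
  have [measurable]: "h \<in> borel_measurable borel" and M: "M \<ge> 0" "\<And>w. norm (h w) \<le> M"
    using h by (auto simp: bounded_symbol_def)
  have m: "?m \<ge> 0" using alpha_pos by (intro gauss_mass_nonneg) simp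
  have a: "?a > 0" using alpha_pos by simp
  \<comment> \<open>Makes the constant of \<open>gauss_schur_point\<close> exactly
    \<open>\<epsilon> powr p\<close>.\<close>
  define c where "c = \<epsilon> / (?m + 1)"
  have c: "c > 0" "c * (?m + 1) = \<epsilon>" using m \<open>\<epsilon> > 0\<close> by (auto simp: c_def)
  define \<eta> where "\<eta> = c / ?a"
  have \<eta>: "\<eta> > 0" using c a by (simp add: \<eta>_def)
  have aeta: "?a * \<eta> = c" using a alpha_pos by (simp add: \<eta>_def)
  obtain L where L: "L \<ge> 0" "M * exp (- (\<alpha> / 4) * L\<^sup>2) \<le> \<eta>"
    using gaussian_tail_small[OF \<eta> M(1)] by auto
  have "\<eta> / 2 > 0" using \<eta> by simp
  then obtain R where R: "\<And>z w. norm z > R \<Longrightarrow> norm (z - w) \<le> L \<Longrightarrow> norm (h z - h w) \<le> \<eta> / 2"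
    using osc unfolding slowly_oscillating_def by metis
  show ?thesis
  proof (rule exI[of _ R], rule exI[of _ "\<eta> / 2"], intro conjI allI impI ballI \<open>\<eta> / 2 > 0\<close>)
    fix z :: "complex ^ 'n" and u :: "complex ^ 'n \<Rightarrow> complex"
    assume z: "norm z > R" "norm (h z) \<le> \<eta> / 2" and u: "u \<in> fock \<alpha> p"
    have um [measurable]: "u \<in> borel_measurable borel" using fockD(3)[OF u] .
    have "ennreal (wt \<alpha> (toeplitz \<alpha> h u) z) \<le> ennreal (?a * \<eta>) *
      (\<integral>\<^sup>+w. ennreal (exp (- (\<alpha> / 4) * (norm (z - w))\<^sup>2) * wt \<alpha> u w) \<partial>lborel)"
      unfolding toeplitz_def
    proof (rule wt_proj_local[OF _ _ _ _ L])
      show "norm (h w * u w) \<le> \<eta> * norm (u w)" if "norm (z - w) \<le> L" for w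
      proof -
        have "norm (h w) \<le> norm (h z) + norm (h z - h w)" by (metis norm_triangle_sub norm_minus_commute)
        then have "norm (h w) \<le> \<eta>" using R[OF z(1) that] z(2) by simp
        then show ?thesis by (simp add: norm_mult mult_right_mono)
      qed
      show "norm (h w * u w) \<le> M * norm (u w)" for w
        using M(2)[of w] by (simp add: norm_mult mult_right_mono)
    qed (use \<eta> in auto)
    then have *: "ennreal (wt \<alpha> (toeplitz \<alpha> h u) z) \<le> ennreal c *
      (\<integral>\<^sup>+w. ennreal (exp (- (\<alpha> / 4) * (norm (z - w))\<^sup>2) * wt \<alpha> u w) \<partial>lborel)"
      unfolding aeta .
    have "ennreal (wt \<alpha> (toeplitz \<alpha> h u) z powr p)
      \<le> ennreal ((c * (?m + 1)) powr p) * (\<integral>\<^sup>+w. ennreal (wt \<alpha> u w powr p) \<partial>lborel)"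
      by (rule gauss_schur_point[OF _ _ _ _ _ _ *]) (use alpha_pos p_gt1 c in auto)
    then show "ennreal (wt \<alpha> (toeplitz \<alpha> h u) z powr p) \<le> ennreal (\<epsilon> powr p) * energy \<alpha> p u"
      unfolding energy_def c(2) .
  qed
qed

text \<open>The reproducing kernel at \<open>a\<close>, scaled so that its weighted modulus is a
  Gaussian bump with value 1 at \<open>a\<close>; its energy is therefore the same for all
  \<open>a\<close>.\<close>

definition nkernel :: "complex ^ 'n \<Rightarrow> complex ^ 'n \<Rightarrow> complex" where
  "nkernel a z = of_real (exp (- (\<alpha> / 2) * (norm a)\<^sup>2)) * exp (of_real \<alpha> * hermitian z a)"

lemma wt_nkernel: "wt \<alpha> (nkernel a) z = exp (- (\<alpha> / 2) * (norm (z - a))\<^sup>2)"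
proof -
  have "norm (nkernel a z) = exp (- (\<alpha> / 2) * (norm a)\<^sup>2) * exp (\<alpha> * Re (hermitian z a))"
    by (simp add: nkernel_def norm_mult)
  then show ?thesis
    by (simp only: wt_def norm_diff_sq exp_add[symmetric]) (simp add: field_simps)
qed

lemma energy_nkernel:
  "\<exists>E\<ge>0. \<forall>a :: complex ^ 'n. energy \<alpha> p (nkernel a) = ennreal E"
proof (intro exI conjI allI)
  let ?\<beta> = "p * \<alpha> / 2"
  have b: "?\<beta> > 0" using alpha_pos p_gt1 by simp
  show "0 \<le> gauss_mass TYPE(complex ^ 'n) ?\<beta>" using b by (rule gauss_mass_nonneg)
  fix a :: "complex ^ 'n"
  have "energy \<alpha> p (nkernel a) = (\<integral>\<^sup>+z. ennreal (exp (- ?\<beta> * (norm (a - z))\<^sup>2)) \<partial>lborel)"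
    unfolding energy_def wt_nkernel by (intro nn_integral_cong) (simp add: powr_def norm_minus_commute)
  also have "\<dots> = ennreal (gauss_mass TYPE(complex ^ 'n) ?\<beta>)" by (rule nn_integral_gaussian_shift[OF b])
  finally show "energy \<alpha> p (nkernel a) = ennreal (gauss_mass TYPE(complex ^ 'n) ?\<beta>)" .
qed

lemma nkernel_in_fock: "nkernel a \<in> fock \<alpha> p"
proof -
  have "entire (nkernel a)"
    unfolding nkernel_def[abs_def] by (intro entire_mult entire_const entire_exp_hermitian)
  moreover obtain E where "energy \<alpha> p (nkernel a) = ennreal E" using energy_nkernel by blast
  ultimately show ?thesis by (simp add: fock_iff)
qed

text \<open>The norms grow by margins \<open>L m\<close> that force the decay. For two indices the
  larger one determines the distance, and its bound is the stronger, so the estimate in terms of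
  \<open>m\<close> also holds for \<open>k > m\<close>.\<close>

lemma sparse_sequence:
  fixes P :: "nat \<Rightarrow> complex ^ 'n \<Rightarrow> bool"
  assumes ex: "\<And>m R. \<exists>a. norm a \<ge> R \<and> P m a"
  shows "\<exists>a. (\<forall>m. P m (a m)) \<and> (\<forall>k m. k \<noteq> m \<longrightarrow> exp (- (\<alpha> / 2) * (norm (a m - a k))\<^sup>2) \<le> (1 / 16) ^ m)"
proof -
  have "\<exists>L\<ge>0. exp (- (\<alpha> / 2) * L\<^sup>2) \<le> (1 / 16) ^ m" for m :: nat
  proof -
    obtain L where L: "L \<ge> 0" "1 * exp (- (\<alpha> / 4) * L\<^sup>2) \<le> (1 / 16) ^ m"
      using gaussian_tail_small[of "(1 / 16) ^ m" 1] by auto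
    have "exp (- (\<alpha> / 2) * L\<^sup>2) \<le> exp (- (\<alpha> / 4) * L\<^sup>2)" using alpha_pos by simp
    also have "\<dots> \<le> (1 / 16) ^ m" using L(2) by (simp only: mult_1)
    finally show ?thesis using L(1) by blast
  qed
  then obtain L where L: "\<And>m. L m \<ge> 0" "\<And>m. exp (- (\<alpha> / 2) * (L m)\<^sup>2) \<le> (1 / 16) ^ m" by metis
  obtain a where a: "\<And>m. P m (a m)" "\<And>m. norm (a (Suc m)) \<ge> norm (a m) + L (Suc m)"
    using dependent_nat_choice[of P "\<lambda>m x y. norm y \<ge> norm x + L (Suc m)"] ex by metis
  have "incseq (\<lambda>m. norm (a m))"
  proof (rule incseq_SucI)
    fix m show "norm (a m) \<le> norm (a (Suc m))" using a(2)[of m] L(1)[of "Suc m"] by linarith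
  qed
  then have mono: "norm (a k) \<le> norm (a m)" if "k \<le> m" for k m using that by (auto simp: incseq_def)
  have less: "norm (a m - a k) \<ge> L m" if "k < m" for k m
  proof -
    obtain m' where m': "m = Suc m'" "k \<le> m'"
      using less_imp_Suc_add[OF \<open>k < m\<close>] by (metis le_add1)
    have "norm (a m) \<ge> norm (a k) + L m" using a(2)[of m'] mono[OF m'(2)] unfolding m'(1) by linarith
    then show ?thesis using norm_triangle_ineq2[of "a m" "a k"] by linarith
  qed
  have "exp (- (\<alpha> / 2) * (norm (a m - a k))\<^sup>2) \<le> (1 / 16) ^ m" if "k \<noteq> m" for k m
  proof -
    define j where "j = max k m"
    have "norm (a m - a k) \<ge> L j"
      using that less[of k m] less[of m k] unfolding j_def by (cases "k < m") (auto simp: norm_minus_commute max_def)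
    then have "(L j)\<^sup>2 \<le> (norm (a m - a k))\<^sup>2" using L(1) by (intro power_mono) auto
    then have "exp (- (\<alpha> / 2) * (norm (a m - a k))\<^sup>2) \<le> exp (- (\<alpha> / 2) * (L j)\<^sup>2)" using alpha_pos by simp
    also have "\<dots> \<le> (1 / 16) ^ j" by (rule L(2))
    also have "\<dots> \<le> (1 / 16) ^ m" unfolding j_def by (intro power_decreasing) auto
    finally show ?thesis .
  qed
  with a(1) show ?thesis by blast
qed

text \<open>If \<open>B\<close> spans the cokernel, a nontrivial combination of
  \<open>card B + 1\<close> kernel series lies in the range. At \<open>a m\<close> its own term has
  size \<open>|X m| / 4 ^ m\<close>, whereas the other terms and, by
  \<open>toeplitz_point_small\<close>, the whole sum are of order \<open>1 / 16 ^ m\<close>. Hence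
  \<open>|X m|\<close> decays, yet it is periodic in \<open>m\<close>.\<close>

lemma toeplitz_not_fredholm:
  fixes h :: "complex ^ 'n \<Rightarrow> complex"
  assumes h: "bounded_symbol M h" and osc: "slowly_oscillating h"
    and lim: "filterlim (\<lambda>m. norm (zs m)) at_top sequentially" "(\<lambda>m. h (zs m)) \<longlonglongrightarrow> 0"
  shows "\<not> fredholm_on (fock \<alpha> p) N (toeplitz \<alpha> h)"
proof
  assume "fredholm_on (fock \<alpha> p) N (toeplitz \<alpha> h)"
  then obtain B where B: "finite B" "fock \<alpha> p \<subseteq> cfun.span (toeplitz \<alpha> h ` fock \<alpha> p \<union> B)"
    unfolding fredholm_on_def by blast
  define d where "d = Suc (card B)"
  have d: "d > 0" by (simp add: d_def)
  let ?small = "\<lambda>m z. \<forall>u\<in>fock \<alpha> p. ennreal (wt \<alpha> (toeplitz \<alpha> h u) z powr p) \<le> ennreal (((1 / 16) ^ m) powr p) * energy \<alpha> p u"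
  have "\<exists>a. norm a \<ge> R \<and> ?small m a" for m :: nat and R :: real
  proof -
    have "(1 / 16 :: real) ^ m > 0" by simp
    from toeplitz_point_small[OF h osc this] obtain R' \<eta> where \<eta>: "\<eta> > 0"
      and small: "\<And>z. norm z > R' \<Longrightarrow> norm (h z) \<le> \<eta> \<Longrightarrow> ?small m z" by blast
    have "\<forall>\<^sub>F m in sequentially. norm (zs m) > max R R'" using lim(1) by (simp only: filterlim_at_top_dense)
    moreover have "\<forall>\<^sub>F m in sequentially. dist (h (zs m)) 0 < \<eta>" by (rule tendstoD[OF lim(2) \<eta>])
    ultimately have "\<forall>\<^sub>F m in sequentially. norm (zs m) > max R R' \<and> dist (h (zs m)) 0 < \<eta>" by (rule eventually_conj)
    then obtain k where "norm (zs k) > max R R'" "dist (h (zs k)) 0 < \<eta>"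
      unfolding eventually_sequentially by blast
    then show ?thesis using small[of "zs k"] by (intro exI[of _ "zs k"]) simp
  qed
  from sparse_sequence[of ?small, OF this] obtain a where a: "\<forall>m. ?small m (a m)"
    "\<forall>k m. k \<noteq> m \<longrightarrow> exp (- (\<alpha> / 2) * (norm (a m - a k))\<^sup>2) \<le> (1 / 16) ^ m"
    by (elim exE conjE) (rule that; assumption)
  note small = a(1)[rule_format] and sep = a(2)[rule_format]
  obtain E where E: "E \<ge> 0" "\<And>b :: complex ^ 'n. energy \<alpha> p (nkernel b) = ennreal E" using energy_nkernel by blast
  \<comment> \<open>Series \<open>i\<close> uses only indices congruent to \<open>i\<close> modulo
    \<open>d\<close>, so each coefficient is tested at infinitely many points. The rate
    \<open>1 / 4\<close> makes the series converge and still exceeds the rate \<open>1 / 16\<close>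
    of smallness and separation.\<close>
  define e where "e i m = (if m mod d = i then (1 / 4) ^ m else 0 :: real)" for i m :: nat
  have e: "0 \<le> e i m" "e i m \<le> (1 / 4) ^ m" for i m by (auto simp: e_def)
  have "\<exists>v. v \<in> fock \<alpha> p \<and> (\<forall>z. (\<lambda>m. of_real (e i m) * nkernel (a m) z) sums v z)" for i
  proof -
    let ?u = "\<lambda>m z. of_real (e i m) * nkernel (a m) z"
    have uX: "?u m \<in> fock \<alpha> p" for m by (rule fock_scale[OF nkernel_in_fock])
    have ue: "energy \<alpha> p (?u m) \<le> ennreal (E * (4 powr - p) ^ m)" for m
    proof -
      have "energy \<alpha> p (?u m) \<le> ennreal (((1 / 4) ^ m) powr p) * energy \<alpha> p (nkernel (a m))"
        by (rule energy_mono[OF fockD(3)[OF nkernel_in_fock]])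
          (use e p_gt1 in \<open>auto simp: norm_mult intro: mult_right_mono\<close>)
      also have "((1 / 4 :: real) ^ m) powr p = (4 powr - p) ^ m"
        by (simp add: powr_realpow[symmetric] powr_powr powr_minus powr_divide power_one_over[symmetric] inverse_eq_divide mult.commute)
      finally show ?thesis using E by (simp add: ennreal_mult[symmetric] mult.commute)
    qed
    obtain v where "v \<in> fock \<alpha> p" "\<And>z. (\<lambda>k. ?u k z) sums v z"
      using fock_complete[OF uX ue E(1)] by metis
    then show ?thesis by blast
  qed
  then obtain v where v: "\<And>i. v i \<in> fock \<alpha> p" "\<And>i z. (\<lambda>m. of_real (e i m) * nkernel (a m) z) sums v i z"
    by metis
  have sub: "cfun.subspace (toeplitz \<alpha> h ` fock \<alpha> p)"
    unfolding cfun.subspace_def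
  proof (intro conjI ballI allI)
    have "toeplitz \<alpha> h 0 = 0" using toeplitz_fscale[of h 0 0] by (simp only: cfun.scale_zero_left)
    with imageI[OF cfun.subspace_0[OF subspace_fock], of "toeplitz \<alpha> h"]
    show "0 \<in> toeplitz \<alpha> h ` fock \<alpha> p" by (simp only:)
    fix x assume "x \<in> toeplitz \<alpha> h ` fock \<alpha> p"
    then obtain u where u: "u \<in> fock \<alpha> p" "x = toeplitz \<alpha> h u" by blast
    show "x + y \<in> toeplitz \<alpha> h ` fock \<alpha> p" if "y \<in> toeplitz \<alpha> h ` fock \<alpha> p" for y
    proof -
      obtain v where "v \<in> fock \<alpha> p" "y = toeplitz \<alpha> h v" using \<open>y \<in> _\<close> by blast
      then show ?thesis using u imageI[OF cfun.subspace_add[OF subspace_fock], of u v "toeplitz \<alpha> h"]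
        by (simp only: toeplitz_plus[OF h])
    qed
    show "fscale c x \<in> toeplitz \<alpha> h ` fock \<alpha> p" for c
      using u imageI[OF cfun.subspace_scale[OF subspace_fock], of u "toeplitz \<alpha> h" c]
      by (simp only: toeplitz_fscale)
  qed
  obtain x where x: "\<exists>i\<le>card B. x i \<noteq> 0" "(\<Sum>i\<le>card B. fscale (x i) (v i)) \<in> toeplitz \<alpha> h ` fock \<alpha> p"
    using dependent_modulo_subspace[OF sub B(1), of v] v(1) B(2) by blast
  obtain u where Tu: "(\<Sum>i\<le>card B. fscale (x i) (v i)) = toeplitz \<alpha> h u" and u: "u \<in> fock \<alpha> p"
    using x(2) by (rule imageE)
  \<comment> \<open>Exactly one of the series contains the kernel at \<open>a m\<close>, so its
    coefficient in the combination is \<open>X m * (1 / 4) ^ m\<close>.\<close>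
  define X where "X m = x (m mod d)" for m
  define Xmax where "Xmax = (\<Sum>i\<le>card B. norm (x i))"
  have Xmax: "norm (X m) \<le> Xmax" for m
  proof -
    have "m mod d \<le> card B" using d mod_less_divisor[of d m] by (simp add: d_def)
    then show ?thesis unfolding X_def Xmax_def by (intro member_le_sum) auto
  qed
  have Xmax0: "Xmax \<ge> 0" unfolding Xmax_def by (simp add: sum_nonneg)
  have Tsums: "(\<lambda>m. X m * of_real ((1 / 4) ^ m) * nkernel (a m) z) sums toeplitz \<alpha> h u z" for z
  proof -
    have "(\<lambda>m. \<Sum>i\<le>card B. x i * (of_real (e i m) * nkernel (a m) z)) sums (\<Sum>i\<le>card B. x i * v i z)"
      by (intro sums_sum sums_mult v(2))
    moreover have "(\<Sum>i\<le>card B. x i * v i z) = toeplitz \<alpha> h u z"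
      unfolding Tu[symmetric] by (simp add: sum_fun_apply fscale_def)
    moreover have "(\<Sum>i\<le>card B. x i * (of_real (e i m) * nkernel (a m) z)) = X m * of_real ((1 / 4) ^ m) * nkernel (a m) z" for m
    proof -
      have "m mod d \<le> card B" using d mod_less_divisor[of d m] by (simp add: d_def)
      have "(\<Sum>i\<le>card B. x i * (of_real (e i m) * nkernel (a m) z))
        = (\<Sum>i\<le>card B. if i = m mod d then X m * of_real ((1 / 4) ^ m) * nkernel (a m) z else 0)"
        by (intro sum.cong) (auto simp: e_def X_def)
      also have "\<dots> = X m * of_real ((1 / 4) ^ m) * nkernel (a m) z" using \<open>m mod d \<le> card B\<close> by simp
      finally show ?thesis .
    qed
    ultimately show ?thesis by simp
  qed
  obtain K where K: "K \<ge> 0" "\<And>m. wt \<alpha> (toeplitz \<alpha> h u) (a m) \<le> (1 / 16) ^ m * K"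
  proof -
    obtain b where b: "b \<ge> 0" "energy \<alpha> p u = ennreal b" using fockD(2)[OF u] by (cases "energy \<alpha> p u") auto
    have "wt \<alpha> (toeplitz \<alpha> h u) (a m) \<le> (1 / 16) ^ m * b powr (1 / p)" for m
    proof -
      have "ennreal (wt \<alpha> (toeplitz \<alpha> h u) (a m) powr p) \<le> ennreal (((1 / 16) ^ m) powr p * b)"
        using small[OF u, of m] b by (simp add: ennreal_mult)
      then have "wt \<alpha> (toeplitz \<alpha> h u) (a m) powr p \<le> ((1 / 16) ^ m) powr p * b" using b by simp
      then have "(wt \<alpha> (toeplitz \<alpha> h u) (a m) powr p) powr (1 / p) \<le> (((1 / 16) ^ m) powr p * b) powr (1 / p)"
        using p_gt1 by (intro powr_mono2) auto
      then show ?thesis using p_gt1 by (simp add: powr_powr powr_mult)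
    qed
    then show thesis by (intro that[of "b powr (1 / p)"]) auto
  qed
  \<comment> \<open>\<open>K\<close> bounds the value of the combination; the 2 is a rounded value
    of the geometric sum \<open>4 / 3\<close> over the other terms.\<close>
  define C where "C = K + 2 * Xmax"
  have Xle: "norm (X m) \<le> C * (1 / 4) ^ m" for m
  proof -
    \<comment> \<open>With this weight the moduli of the kernels at \<open>a m\<close> become
      \<open>wt\<close>: 1 for the kernel at \<open>a m\<close> itself, at most
      \<open>(1 / 16) ^ m\<close> for every other one.\<close>
    define g where "g = complex_of_real (exp (- (\<alpha> / 2) * (norm (a m))\<^sup>2))"
    define s where "s k = X k * of_real ((1 / 4) ^ k) * nkernel (a k) (a m) * g" for k
    have ns: "norm (s k) = norm (X k) * (1 / 4) ^ k * exp (- (\<alpha> / 2) * (norm (a m - a k))\<^sup>2)" for k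
      unfolding wt_nkernel[symmetric] s_def wt_def g_def by (simp add: norm_mult norm_power)
    have sm: "norm (s m) = norm (X m) * (1 / 4) ^ m" unfolding ns by simp
    have "s sums (toeplitz \<alpha> h u (a m) * g)" unfolding s_def by (rule sums_mult2[OF Tsums])
    moreover have "(\<lambda>k. if k = m then s k else 0) sums s m" by (rule sums_single)
    ultimately have "(\<lambda>k. s k - (if k = m then s k else 0)) sums (toeplitz \<alpha> h u (a m) * g - s m)"
      by (rule sums_diff)
    then have eq: "toeplitz \<alpha> h u (a m) * g - s m = (\<Sum>k. s k - (if k = m then s k else 0))" by (rule sums_unique)
    have geo: "(\<lambda>k. Xmax * (1 / 16) ^ m * (1 / 4) ^ k) sums (Xmax * (1 / 16) ^ m * (1 / (1 - 1 / 4)))"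
      by (intro sums_mult geometric_sums) simp
    have "norm (s k - (if k = m then s k else 0)) \<le> Xmax * (1 / 16) ^ m * (1 / 4) ^ k" for k
    proof (cases "k = m")
      case False
      have "norm (s k) \<le> Xmax * (1 / 4) ^ k * (1 / 16) ^ m"
        unfolding ns by (intro mult_mono mult_nonneg_nonneg Xmax sep False Xmax0) auto
      then show ?thesis using False by (simp add: mult_ac)
    qed (simp add: Xmax0)
    then have "norm (toeplitz \<alpha> h u (a m) * g - s m) \<le> (\<Sum>k. Xmax * (1 / 16) ^ m * (1 / 4) ^ k)"
      unfolding eq by (intro norm_suminf_le sums_summable[OF geo]) auto
    also have "\<dots> = Xmax * (1 / 16) ^ m * (1 / (1 - 1 / 4))" using sums_unique[OF geo] by simp
    also have "\<dots> \<le> Xmax * (1 / 16) ^ m * 2" by (intro mult_left_mono mult_nonneg_nonneg Xmax0) auto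
    finally have 1: "norm (toeplitz \<alpha> h u (a m) * g - s m) \<le> Xmax * (1 / 16) ^ m * 2" .
    have 2: "norm (toeplitz \<alpha> h u (a m) * g) = wt \<alpha> (toeplitz \<alpha> h u) (a m)"
      unfolding g_def wt_def by (simp add: norm_mult)
    have "norm (s m) \<le> norm (toeplitz \<alpha> h u (a m) * g) + norm (toeplitz \<alpha> h u (a m) * g - s m)"
      by (metis norm_triangle_sub norm_minus_commute)
    then have "norm (X m) * (1 / 4) ^ m \<le> (1 / 16) ^ m * K + Xmax * (1 / 16) ^ m * 2"
      using 1 2 K(2)[of m] sm by linarith
    also have "\<dots> = (C * (1 / 4) ^ m) * (1 / 4) ^ m"
      by (simp add: C_def algebra_simps power_mult_distrib[symmetric])
    finally show ?thesis by simp
  qed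
  have C0: "C \<ge> 0" using K(1) Xmax0 by (simp add: C_def)
  have "x i = 0" if "i \<le> card B" for i
  proof -
    \<comment> \<open>The coefficient \<open>x i\<close> recurs at all indices
      \<open>i + d * j\<close>, where the bound tends to 0.\<close>
    have "norm (x i) \<le> C * (1 / 4) ^ j" for j
    proof -
      have "i < d" using that by (simp add: d_def)
      then have "X (i + d * j) = x i" by (simp add: X_def)
      then have "norm (x i) \<le> C * (1 / 4) ^ (i + d * j)" using Xle[of "i + d * j"] by simp
      also have "\<dots> \<le> C * (1 / 4) ^ j"
        using C0 d by (intro mult_left_mono power_decreasing) (auto simp: trans_le_add2)
      finally show ?thesis .
    qed
    note le = this
    have "(\<lambda>j. C * (1 / 4) ^ j) \<longlonglongrightarrow> C * 0" by (intro tendsto_mult tendsto_const LIMSEQ_power_zero) simp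
    then have "norm (x i) \<le> C * 0" by (rule LIMSEQ_le_const) (use le in blast)
    then show "x i = 0" by simp
  qed
  with x(1) show False by blast
qed

end

text \<open>Otherwise points of norm above \<open>m\<close> with values within
  \<open>1 / (m + 1)\<close> of \<open>c\<close> would form a sequence exhibiting \<open>c\<close>
  as a limit value.\<close>

lemma bounded_below_off_limit_values:
  fixes f :: "complex ^ 'n \<Rightarrow> complex"
  assumes "c \<notin> limit_values f"
  shows "\<exists>R. \<exists>\<delta>>0. \<forall>z. norm z > R \<longrightarrow> norm (f z - c) \<ge> \<delta>"
proof (rule ccontr)
  assume neg: "\<nexists>R. \<exists>\<delta>>0. \<forall>z. norm z > R \<longrightarrow> norm (f z - c) \<ge> \<delta>"
  have "\<exists>z. norm z > real m \<and> norm (f z - c) < 1 / real (Suc m)" for m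
  proof (rule ccontr)
    assume "\<nexists>z. norm z > real m \<and> norm (f z - c) < 1 / real (Suc m)"
    then have "\<forall>z. norm z > real m \<longrightarrow> norm (f z - c) \<ge> 1 / real (Suc m)" by (meson not_less)
    moreover have "1 / real (Suc m) > 0" by simp
    ultimately show False using neg by blast
  qed
  then obtain z where z: "\<And>m. norm (z m) > real m" "\<And>m. norm (f (z m) - c) < 1 / real (Suc m)" by metis
  have "filterlim (\<lambda>m. norm (z m)) at_top sequentially"
    by (rule filterlim_at_top_mono[OF filterlim_real_sequentially]) (use z(1) in \<open>auto intro: always_eventually less_imp_le\<close>)
  moreover have "(\<lambda>m. f (z m) - c) \<longlonglongrightarrow> 0"
    by (rule Lim_null_comparison[OF always_eventually LIMSEQ_inverse_real_of_nat])
      (use z(2) in \<open>auto simp: inverse_eq_divide intro: less_imp_le\<close>)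
  then have "(\<lambda>m. f (z m)) \<longlonglongrightarrow> c" by (rule LIM_zero_cancel)
  ultimately have "c \<in> limit_values f" unfolding limit_values_def by blast
  with assms show False ..
qed

theorem theorem33:
  fixes \<alpha> p :: real and f :: "complex ^ 'n \<Rightarrow> complex"
  assumes "\<alpha> > 0" and "1 < p" and "f \<in> VO"
  shows "essential_spectrum_on (fock \<alpha> p) (Lp_norm \<alpha> p) (toeplitz \<alpha> f) = limit_values f"
proof -
  interpret fock_setting \<alpha> p using assms by unfold_locales
  obtain M where M: "bounded_symbol M f" using VO_bounded_symbol[OF assms(3)] by blast
  have osc: "slowly_oscillating (\<lambda>z. f z - c)" for c
    by (rule slowly_oscillating_diff_const[OF VO_slowly_oscillating[OF assms(3)]])
  note bd = bounded_symbol_diff_const[OF M]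
  \<comment> \<open>On the Fock space \<open>P (c u) = c u\<close>, so \<open>c\<close> may be moved
    into the symbol.\<close>
  have "fredholm_on (fock \<alpha> p) (Lp_norm \<alpha> p) (\<lambda>g. toeplitz \<alpha> f g - fscale c g)
    \<longleftrightarrow> fredholm_on (fock \<alpha> p) (Lp_norm \<alpha> p) (toeplitz \<alpha> (\<lambda>z. f z - c))" for c
  proof (rule fredholm_on_cong[OF _ subspace_fock])
    fix u :: "complex ^ 'n \<Rightarrow> complex" assume u: "u \<in> fock \<alpha> p"
    show "toeplitz \<alpha> f u - fscale c u = toeplitz \<alpha> (\<lambda>z. f z - c) u"
    proof
      fix z
      note cu = fock_scale[OF u, of c]
      have "fock_proj \<alpha> (\<lambda>w. f w * u w - c * u w) z = fock_proj \<alpha> (\<lambda>w. f w * u w) z - fock_proj \<alpha> (\<lambda>w. c * u w) z"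
        by (rule fock_proj_diff[OF symbol_mult(1,3)[OF M u] fockD(3,2)[OF cu]])
      then show "(toeplitz \<alpha> f u - fscale c u) z = toeplitz \<alpha> (\<lambda>z. f z - c) u z"
        by (simp add: toeplitz_def fscale_def left_diff_distrib fockD(4)[OF cu])
    qed
  qed
  moreover have "\<not> fredholm_on (fock \<alpha> p) (Lp_norm \<alpha> p) (toeplitz \<alpha> (\<lambda>z. f z - c))" if lv: "c \<in> limit_values f" for c
  proof -
    obtain zs where zs: "filterlim (\<lambda>m. norm (zs m)) at_top sequentially" "(\<lambda>m. f (zs m)) \<longlonglongrightarrow> c"
      using lv unfolding limit_values_def by blast
    show ?thesis by (rule toeplitz_not_fredholm[OF bd osc zs(1) LIM_zero[OF zs(2)]])
  qed
  moreover have "fredholm_on (fock \<alpha> p) (Lp_norm \<alpha> p) (toeplitz \<alpha> (\<lambda>z. f z - c))" if nlv: "c \<notin> limit_values f" for c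
  proof -
    obtain R \<delta> where R: "\<delta> > 0" "\<And>z. norm z > R \<Longrightarrow> norm (f z - c) \<ge> \<delta>"
      using bounded_below_off_limit_values[OF nlv] by blast
    show ?thesis by (rule toeplitz_fredholm[OF bd osc R(2,1)])
  qed
  ultimately show ?thesis unfolding essential_spectrum_on_def by blast
qed

end
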